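(* Let $A_1,\dots,A_n$ be real symmetric $d\times d$ matrices ($d\ge2$) satisfying $\sum_{i=1}^nA_i^2\preceq I_d$. Fix a unit vector $v\in\mathbb R^d$ and write the block decomposition of $A_i$ with respect to $\mathbb R^d=\operatorname{span}\{v\}\oplus v^\perp$ (in an orthonormal basis adapted to it) as $$A_i=\begin{pmatrix} a_i & u_i^\top \\ {u_i} & D_i \end{pmatrix},\qquad a_i\in\mathbb R,\ u_i\in\mathbb R^{d-1},\ D_i\in\mathbb R^{(d-1)\times(d-1)}.$$ For $g\in\mathbb R^n$ let $a(g)=\frac14\sum_i g_ia_i$, $b(g)=\frac14\sum_i g_iu_i$, $C(g)=\frac14\sum_i g_iD_i$. Let $\Omega_0=\{g\in\mathbb R^n:|a(g)|<1,\ \|C(g)\|_{\mathrm{op}}<1\}$, let $$w_0(g)=(1-a(g)^2)^4\det(I_{d-1}-C(g)^2)^4\,\mathbf 1_{\Omega_0}(g),$$ and let $\mu_0$ be the probability measure $d\mu_0(g)=\frac{w_0(g)}{\mathbb E w_0}\,d\gamma_n(g)$, where $\gamma_n$ is the standard Gaussian measure on $\mathbb R^n$ and $\mathbb E w_0=\int w_0\,d\gamma_n$. For $g\in\Omega_0$ define $$\xi_+(g)=\frac{b(g)^\top(I+C(g))^{-1}b(g)}{1+a(g)},\qquad \xi_-(g)=\frac{b(g)^\top(I-C(g))^{-1}b(g)}{1-a(g)}.$$ Then $$\mathbb E_{\mu_0}\bigl[(1-\xi_+)_+^4(1-\xi_-)_+^4\bigr]\ge c_{\mathrm{Schur}},\qquad\text{where}\quad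 c_{\mathrm{Schur}}=\Bigl[1-\frac18\bigl(\Lambda^2+\Lambda^{-2}\bigr)\Bigr]^8,\quad \Lambda=8-4\sqrt3 .$$
   Context: $\|\cdot\|_{\mathrm{op}}$ is the operator norm, $\preceq$ the Loewner order, $(t)_+=\max\{t,0\}$, and $(t)_+^4=(\max\{t,0\})^4$. *)

theory Defs
  imports "HOL-Probability.Probability"
begin

definition pos_semidef :: "real^'d^'d \<Rightarrow> bool" where
  "pos_semidef M \<longleftrightarrow> transpose M = M \<and> (\<forall>x. 0 \<le> x \<bullet> (M *v x))"

text \<open>The order \<open>\<le>\<close> of the library on \<open>real^'d^'d\<close> is componentwise, hence a separate
  relation for the Loewner order.\<close>

definition loewner_le :: "real^'d^'d \<Rightarrow> real^'d^'d \<Rightarrow> bool"  (infix "\<preceq>\<^sub>L" 50) where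
  "M \<preceq>\<^sub>L N \<longleftrightarrow> pos_semidef (N - M)"

definition op_norm :: "real^'m^'m \<Rightarrow> real" where
  "op_norm M = onorm ((*v) M)"

text \<open>An orthonormal basis of \<open>v\<^sup>\<bottom>\<close> indexed by a finite type. Together with a unit vector \<open>v\<close> in
  \<open>real^'d\<close> it is an orthonormal basis of \<open>real^'d\<close>; in particular \<open>CARD('m) = CARD('d) - 1\<close>.\<close>

definition onb_of_complement :: "real^'d \<Rightarrow> ('m::finite \<Rightarrow> real^'d) \<Rightarrow> bool" where
  "onb_of_complement v e \<longleftrightarrow>
     (\<forall>j k. e j \<bullet> e k = (if j = k then 1 else 0)) \<and> span (range e) = {v}\<^sup>\<bottom>"

text \<open>The entries of the matrix of \<open>M\<close> in the orthonormal basis consisting of \<open>v\<close> and the \<open>e j\<close>.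
  For symmetric \<open>M\<close> the upper right block is the transpose of \<open>block_u\<close>.\<close>

definition block_a :: "real^'d \<Rightarrow> real^'d^'d \<Rightarrow> real" where
  "block_a v M = v \<bullet> (M *v v)"

definition block_u :: "real^'d \<Rightarrow> ('m::finite \<Rightarrow> real^'d) \<Rightarrow> real^'d^'d \<Rightarrow> real^'m" where
  "block_u v e M = (\<chi> j. e j \<bullet> (M *v v))"

definition block_D :: "('m::finite \<Rightarrow> real^'d) \<Rightarrow> real^'d^'d \<Rightarrow> real^'m^'m" where
  "block_D e M = (\<chi> j k. e j \<bullet> (M *v e k))"

definition std_gaussian :: "(real^'n) measure" where
  "std_gaussian = density lborel (\<lambda>g. ennreal (\<Prod>i\<in>UNIV. std_normal_density (g $ i)))"

text \<open>In what follows \<open>a i\<close>, \<open>u i\<close>, \<open>D i\<close> are the blocks of the \<open>i\<close>-th matrix.\<close>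

definition lin_a :: "('n::finite \<Rightarrow> real) \<Rightarrow> real^'n \<Rightarrow> real" where
  "lin_a a g = (1/4) * (\<Sum>i\<in>UNIV. g $ i * a i)"

definition lin_b :: "('n::finite \<Rightarrow> real^'m) \<Rightarrow> real^'n \<Rightarrow> real^'m" where
  "lin_b u g = (1/4) *\<^sub>R (\<Sum>i\<in>UNIV. g $ i *\<^sub>R u i)"

definition lin_C :: "('n::finite \<Rightarrow> real^'m^'m) \<Rightarrow> real^'n \<Rightarrow> real^'m^'m" where
  "lin_C D g = (1/4) *\<^sub>R (\<Sum>i\<in>UNIV. g $ i *\<^sub>R D i)"

definition Omega0 :: "('n::finite \<Rightarrow> real) \<Rightarrow> ('n \<Rightarrow> real^'m^'m) \<Rightarrow> (real^'n) set" where
  "Omega0 a D = {g. \<bar>lin_a a g\<bar> < 1 \<and> op_norm (lin_C D g) < 1}"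

definition w0 :: "('n::finite \<Rightarrow> real) \<Rightarrow> ('n \<Rightarrow> real^'m^'m) \<Rightarrow> real^'n \<Rightarrow> real" where
  "w0 a D g =
     (1 - (lin_a a g)\<^sup>2)^4 * (det (mat 1 - lin_C D g ** lin_C D g))^4 * indicator (Omega0 a D) g"

definition mu0 :: "('n::finite \<Rightarrow> real) \<Rightarrow> ('n \<Rightarrow> real^'m^'m) \<Rightarrow> (real^'n) measure" where
  "mu0 a D =
     density std_gaussian (\<lambda>g. ennreal (w0 a D g / (\<integral>h. w0 a D h \<partial>std_gaussian)))"

text \<open>\<open>xi_plus\<close> and \<open>xi_minus\<close> are meaningful on \<open>Omega0\<close> only; their values elsewhere are
  irrelevant because \<open>mu0\<close> does not charge the complement of \<open>Omega0\<close>.\<close>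

definition xi_plus ::
  "('n::finite \<Rightarrow> real) \<Rightarrow> ('n \<Rightarrow> real^'m) \<Rightarrow> ('n \<Rightarrow> real^'m^'m) \<Rightarrow> real^'n \<Rightarrow> real" where
  "xi_plus a u D g =
     (lin_b u g \<bullet> (matrix_inv (mat 1 + lin_C D g) *v lin_b u g)) / (1 + lin_a a g)"

definition xi_minus ::
  "('n::finite \<Rightarrow> real) \<Rightarrow> ('n \<Rightarrow> real^'m) \<Rightarrow> ('n \<Rightarrow> real^'m^'m) \<Rightarrow> real^'n \<Rightarrow> real" where
  "xi_minus a u D g =
     (lin_b u g \<bullet> (matrix_inv (mat 1 - lin_C D g) *v lin_b u g)) / (1 - lin_a a g)"

definition Lam :: real where
  "Lam = 8 - 4 * sqrt 3"

definition c_Schur :: real where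
  "c_Schur = (1 - (1/8) * (Lam\<^sup>2 + 1 / Lam\<^sup>2))^8"

end

theory Submission
  imports Defs
begin

text \<open>
  Let \<open>w\<close> be the density \<open>w\<^sub>0\<close> times the Gaussian density, \<open>Z\<close> its integral, \<open>G = w (I + C)\<inverse>\<close> and \<open>M = \<integral> G\<close>. The fourth
  powers of the determinants make \<open>G\<close> a log-concave matrix weight in the sense of Nakano, with the Gaussian factor
  contributing the identity to the curvature. Positivity of this kind is inherited by marginals (Prekopa's theorem for
  matrices), which yields a Brascamp-Lieb inequality for linear maps \<open>c\<close> from \<open>\<real>\<^sup>n\<close> to vectors:
  \<open>\<integral> c \<bullet> G c - \<Sum>\<^sub>i c e\<^sub>i \<bullet> M (c e\<^sub>i) \<le> (\<integral> G c) \<bullet> M\<inverse> (\<integral> G c)\<close>.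

  For \<open>c g = C g y\<close>, the identity \<open>G C = w I - G\<close> turns it into the quadratic (Dyson) inequality
  \<open>(1 - \<parallel>\<Pi>\<parallel> / 16) \<parallel>\<Pi>\<parallel> \<le> 1\<close> for the mean resolvent \<open>\<Pi> = M / Z\<close>, and continuity in the size of \<open>C\<close> gives \<open>\<parallel>\<Pi>\<parallel> \<le> 11/10\<close>.
  For \<open>c = b\<close> it then bounds the mean of \<open>x = b \<bullet> (I + C)\<inverse> b\<close> by \<open>121/1600\<close>. With the roles of \<open>C\<close> and the \<open>1 \<times> 1\<close> matrix \<open>a\<close>
  exchanged, the mean of \<open>1 / (1 - a\<^sup>2)\<close> is at most \<open>11/10\<close>. By the symmetry \<open>g \<mapsto> - g\<close> the mean of
  \<open>y = b \<bullet> (I - C)\<inverse> b\<close> equals that of \<open>x\<close>.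

  Pointwise, \<open>(1 - \<xi>\<^sub>+)\<^sub>+ (1 - \<xi>\<^sub>-)\<^sub>+ \<ge> 1 - 2 (x + y) - (1 / (1 - a\<^sup>2) - 1) / 2\<close>, whose mean is at least \<open>3/5\<close>. By convexity
  of \<open>t\<^sup>4\<close> the expectation in question is at least \<open>(3/5)\<^sup>4\<close>, which exceeds \<open>c_Schur\<close>.\<close>

section \<open>Positive definite matrices\<close>

text \<open>The obstacle is the truncation: \<open>G\<close> vanishes off \<open>Omega0\<close>,
  while the one-dimensional argument inverts \<open>G\<close> along whole segments. Hence all
  curvature is computed for smooth positive definite approximants on the whole space, and only
  integrated inequalities pass to the limit. The curvature condition is Nakano's, with an
  independent vector for every direction, because it has to reproduce itself when the variables are
  integrated out one at a time. In the curvature of \<open>w\<close> times the inverse of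
  \<open>I + C\<close>, differentiating the inverse produces a term with two indices exchanged; the
  Hessian of the log determinant of the same matrix dominates it.

  Constants: 1/16 is the square of the 1/4 in \<open>lin_a\<close>, \<open>lin_b\<close>,
  \<open>lin_C\<close>. The equation (1 - p/16) p = 1 has the roots 8 - 4 sqrt 3, which is
  \<open>Lam\<close>, and 8 + 4 sqrt 3; 11/10 is a rational number slightly above the smaller one.
  The bound 121/1600 is (11/10)^2 / 16, and 3/5 is what remains of 1 after the losses 4 * 121/1600
  and 1/20, rounded up to 2/5.\<close>

lemma psd_form_Cauchy_Schwarz:
  fixes B :: "'a::real_vector \<Rightarrow> 'a \<Rightarrow> real"
  assumes lin: "\<And>x. linear (B x)" and sym: "\<And>x y. B x y = B y x" and psd: "\<And>x. 0 \<le> B x x"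
  shows "(B x y)\<^sup>2 \<le> B x x * B y y"
proof -
  have ex: "0 \<le> B x x + 2 * t * B x y + t\<^sup>2 * B y y" for t
  proof -
    have "B (x + t *\<^sub>R y) (x + t *\<^sub>R y) = B x x + 2 * t * B x y + t\<^sup>2 * B y y"
      using linear_add[OF lin] linear_scale[OF lin] sym
      by (simp add: sym[of "x + t *\<^sub>R y"] algebra_simps power2_eq_square)
    with psd show ?thesis by metis
  qed
  show ?thesis
  proof (cases "B y y = 0")
    case True
    have "B x y = 0"
    proof (rule ccontr)
      assume n: "B x y \<noteq> 0"
      \<comment> \<open>With \<open>B y y = 0\<close> the polynomial in \<open>t\<close> is affine,
        and this argument is the point where it takes the value -1.\<close>
      have "B x x + 2 * (- (B x x + 1) / (2 * B x y)) * B x y = -1"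
        using n by (simp add: field_simps)
      with ex[of "- (B x x + 1) / (2 * B x y)"] True show False by simp
    qed
    then show ?thesis using True by simp
  next
    case False
    then have p: "0 < B y y" using psd[of y] by simp
    have "0 \<le> (B x x + 2 * (- B x y / B y y) * B x y + (- B x y / B y y)\<^sup>2 * B y y) * B y y"
      using ex[of "- B x y / B y y"] psd[of y] by (rule mult_nonneg_nonneg)
    also have "\<dots> = B x x * B y y - (B x y)\<^sup>2"
      using p by (simp add: field_simps power2_eq_square)
    finally show ?thesis by simp
  qed
qed

text \<open>Cholesky elimination: subtracting the rank one form \<open>B b x * B b y / B b b\<close> keeps the form
  positive semidefinite and puts \<open>b\<close> into its kernel.\<close>

lemma psd_form_sum_squares:
  fixes B :: "'a::euclidean_space \<Rightarrow> 'a \<Rightarrow> real"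
  assumes "\<And>x. linear (B x)" and "\<And>x y. B x y = B y x" and "\<And>x. 0 \<le> B x x"
  shows "\<exists>v::'a\<Rightarrow>'a. \<forall>x y. B x y = (\<Sum>k\<in>Basis. (v k \<bullet> x) * (v k \<bullet> y))"
proof -
  have "finite S \<Longrightarrow> S \<subseteq> Basis \<Longrightarrow> \<exists>(v::'a\<Rightarrow>'a) D. (\<forall>x. linear (D x)) \<and> (\<forall>x y. D x y = D y x) \<and>
    (\<forall>x. 0 \<le> D x x) \<and> (\<forall>k\<in>S. \<forall>x. D x k = 0) \<and>
    (\<forall>x y. B x y = (\<Sum>k\<in>S. (v k \<bullet> x) * (v k \<bullet> y)) + D x y)" for S
  proof (induction S rule: finite_induct)
    case empty
    show ?case using assms by (intro exI[of _ "\<lambda>_. 0"] exI[of _ B]) auto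
  next
    case (insert j S)
    have "S \<subseteq> Basis" using insert.prems by simp
    from insert.IH[OF this] obtain v D where "(\<forall>x. linear (D x)) \<and> (\<forall>x y. D x y = D y x) \<and>
        (\<forall>x. 0 \<le> D x x) \<and> (\<forall>k\<in>S. \<forall>x. D x k = 0) \<and>
        (\<forall>x y. B x y = (\<Sum>k\<in>S. (v k \<bullet> x) * (v k \<bullet> y)) + D x y)"
      by (elim exE) (rule that, assumption)
    then have lin: "\<And>x. linear (D x)" and sym: "\<And>x y. D x y = D y x"
      and psd: "\<And>x. 0 \<le> D x x" and ker: "\<And>k x. k \<in> S \<Longrightarrow> D x k = 0"
      and dec: "\<And>x y. B x y = (\<Sum>k\<in>S. (v k \<bullet> x) * (v k \<bullet> y)) + D x y"
      by blast+
    note CS = psd_form_Cauchy_Schwarz[OF lin sym psd]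
    \<comment> \<open>The Riesz vector of the functional \<open>D j\<close>; divided by
      \<open>sqrt (D j j)\<close> it becomes the new vector of the decomposition.\<close>
    define r where "r = (\<Sum>b\<in>Basis. D j b *\<^sub>R b)"
    have r: "D j x = r \<bullet> x" for x
    proof -
      have "D j x = D j (\<Sum>b\<in>Basis. (x \<bullet> b) *\<^sub>R b)" by (simp add: euclidean_representation)
      also have "\<dots> = (\<Sum>b\<in>Basis. (x \<bullet> b) * D j b)"
        by (simp add: linear_sum[OF lin] linear_scale[OF lin])
      also have "\<dots> = r \<bullet> x" by (simp add: r_def inner_sum_left mult.commute inner_commute[of x])
      finally show ?thesis .
    qed
    have upd: "(\<Sum>k\<in>S. ((v(j := w)) k \<bullet> x) * ((v(j := w)) k \<bullet> y)) = (\<Sum>k\<in>S. (v k \<bullet> x) * (v k \<bullet> y))" for w x y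
      using insert.hyps by (intro sum.cong) auto
    show ?case
    proof (cases "D j j = 0")
      case True
      have "D x j = 0" for x using CS[of x j] True by simp
      then have k: "D x k = 0" if "k \<in> insert j S" for x k using that ker by auto
      have d: "B x y = (\<Sum>k\<in>insert j S. ((v(j := 0)) k \<bullet> x) * ((v(j := 0)) k \<bullet> y)) + D x y" for x y
        using insert.hyps upd[of 0] by (simp add: dec)
      show ?thesis
        by (rule exI[of _ "v(j := 0)"], rule exI[of _ D]) (intro conjI allI ballI lin sym psd k d)
    next
      case False
      then have d: "0 < D j j" using psd[of j] by simp
      define E where "E x y = D x y - D j x * D j y / D j j" for x y
      have E1: "linear (E x)" for x
        unfolding E_def using lin by (intro linearI)
          (simp_all add: linear_add[OF lin] linear_scale[OF lin] algebra_simps add_divide_distrib)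
      have E2: "E x y = E y x" for x y unfolding E_def using sym[of x y] by simp
      have E3: "0 \<le> E x x" for x
        using CS[of j x] d by (simp add: E_def field_simps power2_eq_square)
      have E4: "E x k = 0" if "k \<in> insert j S" for x k
        using that d ker[of k] sym[of j x] by (auto simp: E_def)
      have E5: "B x y = (\<Sum>k\<in>insert j S. ((v(j := r /\<^sub>R sqrt (D j j))) k \<bullet> x) *
          ((v(j := r /\<^sub>R sqrt (D j j))) k \<bullet> y)) + E x y" for x y
      proof -
        have "(\<Sum>k\<in>insert j S. ((v(j := r /\<^sub>R sqrt (D j j))) k \<bullet> x) *
          ((v(j := r /\<^sub>R sqrt (D j j))) k \<bullet> y)) = D j x * D j y / D j j + (\<Sum>k\<in>S. (v k \<bullet> x) * (v k \<bullet> y))"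
          using d by (subst sum.insert[OF insert.hyps], subst upd) (simp add: r field_simps)
        then show ?thesis by (simp add: dec E_def)
      qed
      show ?thesis
        by (rule exI[of _ "v(j := r /\<^sub>R sqrt (D j j))"], rule exI[of _ E])
          (intro conjI allI ballI E1 E2 E3 E4 E5)
    qed
  qed
  from this[OF finite_Basis order_refl] obtain v :: "'a \<Rightarrow> 'a" and D where "(\<forall>x. linear (D x)) \<and> (\<forall>x y. D x y = D y x) \<and>
      (\<forall>x. 0 \<le> D x x) \<and> (\<forall>k\<in>Basis. \<forall>x. D x k = 0) \<and>
      (\<forall>x y. B x y = (\<Sum>k\<in>Basis. (v k \<bullet> x) * (v k \<bullet> y)) + D x y)"
    by (elim exE) (rule that, assumption)
  then have lin: "\<And>x. linear (D x)"
      and ker: "\<And>k x. k \<in> Basis \<Longrightarrow> D x k = (0::real)"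
      and dec: "\<And>x y. B x y = (\<Sum>k\<in>Basis. (v k \<bullet> x) * (v k \<bullet> y)) + D x y"
    by blast+
  have "D x y = 0" for x y
  proof -
    have "D x y = D x (\<Sum>b\<in>Basis. (y \<bullet> b) *\<^sub>R b)" by (simp add: euclidean_representation)
    also have "\<dots> = 0" by (simp add: linear_sum[OF lin] linear_scale[OF lin] ker)
    finally show ?thesis .
  qed
  then show ?thesis using dec by (intro exI[of _ v] allI) (simp only: add_0_right)
qed

definition posdef :: "real^'m^'m \<Rightarrow> bool" where
  "posdef A \<longleftrightarrow> transpose A = A \<and> (\<forall>x. x \<noteq> 0 \<longrightarrow> 0 < x \<bullet> (A *v x))"

lemma inner_matrix_sym:
  fixes A :: "real^'m^'m"
  assumes "transpose A = A"
  shows "x \<bullet> (A *v y) = y \<bullet> (A *v x)"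
  by (metis assms dot_lmul_matrix inner_commute transpose_matrix_vector)

lemma symmetric_matrixI:
  fixes A :: "real^'m^'m"
  assumes "\<And>x y. x \<bullet> (A *v y) = y \<bullet> (A *v x)"
  shows "transpose A = A"
proof -
  have "A$i$j = A$j$i" for i j
    using assms[of "axis i 1" "axis j 1"]
    by (simp add: matrix_vector_mult_basis inner_axis' column_def)
  then show ?thesis by (simp add: transpose_def vec_eq_iff)
qed

lemma matrix_vector_mult_uminus: "(- A) *v x = - (A *v x)" for A :: "real^'m^'k"
  by (metis add.inverse_unique add.right_inverse matrix_vector_mult_0 matrix_vector_mult_add_rdistrib)

lemma posdef_nonneg: "posdef A \<Longrightarrow> 0 \<le> x \<bullet> (A *v x)"
  by (cases "x = 0") (auto simp: posdef_def less_imp_le)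

lemma posdef_sym: "posdef A \<Longrightarrow> x \<bullet> (A *v y) = y \<bullet> (A *v x)"
  by (rule inner_matrix_sym) (simp add: posdef_def)

lemma matrix_inv_works:
  fixes A :: "real^'m^'m"
  assumes "invertible A"
  shows "A ** matrix_inv A = mat 1" "matrix_inv A ** A = mat 1"
proof -
  have "A ** matrix_inv A = mat 1 \<and> matrix_inv A ** A = mat 1"
    unfolding matrix_inv_def using assms unfolding invertible_def by (rule someI_ex)
  then show "A ** matrix_inv A = mat 1" "matrix_inv A ** A = mat 1" by auto
qed

lemma matrix_inv_vec:
  fixes A :: "real^'m^'m"
  assumes "invertible A"
  shows "A *v (matrix_inv A *v x) = x" "matrix_inv A *v (A *v x) = x"
  using matrix_inv_works[OF assms] by (simp_all add: matrix_vector_mul_assoc)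

lemma matrix_inv_unique:
  fixes A B :: "real^'m^'m"
  assumes "A ** B = mat 1"
  shows "matrix_inv A = B" "invertible A"
proof -
  show i: "invertible A" using assms invertible_right_inverse by blast
  show "matrix_inv A = B"
    by (metis assms matrix_inv_works(2)[OF i] matrix_mul_assoc matrix_mul_lid matrix_mul_rid)
qed

lemma posdef_invertible:
  assumes "posdef A" shows "invertible A"
proof -
  have "\<forall>x. A *v x = 0 \<longrightarrow> x = 0"
    using assms by (force simp: posdef_def)
  then show ?thesis
    using invertible_left_inverse matrix_left_invertible_ker by blast
qed

lemmas posdef_inv_vec = matrix_inv_vec[OF posdef_invertible]

lemma posdef_inv:
  assumes "posdef A" shows "posdef (matrix_inv A)"
proof -
  note v = posdef_inv_vec[OF assms]
  have "x \<bullet> (matrix_inv A *v y) = y \<bullet> (matrix_inv A *v x)" for x y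
    using posdef_sym[OF assms, of "matrix_inv A *v x" "matrix_inv A *v y"] by (simp add: v inner_commute)
  moreover have "0 < x \<bullet> (matrix_inv A *v x)" if "x \<noteq> 0" for x
  proof -
    have "matrix_inv A *v x \<noteq> 0" using v(1)[of x] that by auto
    then show ?thesis using assms v(1)[of x] unfolding posdef_def by (metis inner_commute)
  qed
  ultimately show ?thesis by (simp add: posdef_def symmetric_matrixI)
qed

lemma psd_matrix_sum_squares:
  fixes A :: "real^'m^'m"
  assumes "\<And>x. 0 \<le> x \<bullet> (A *v x)" "transpose A = A"
  shows "\<exists>v::real^'m\<Rightarrow>real^'m. \<forall>x y. x \<bullet> (A *v y) = (\<Sum>k\<in>Basis. (v k \<bullet> x) * (v k \<bullet> y))"
  using assms inner_matrix_sym
  by (intro psd_form_sum_squares linearI) (auto simp: algebra_simps inner_add_right)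

section \<open>Continuity and derivatives of the matrix inverse and the determinant\<close>

lemma bounded_bilinear_matrix_vector: "bounded_bilinear (\<lambda>(A::real^'m^'k) x. A *v x)"
  by (rule bilinear_conv_bounded_bilinear[THEN iffD1])
    (auto simp: bilinear_def intro!: linearI simp: algebra_simps scaleR_matrix_vector_assoc)

lemma bounded_bilinear_matrix_matrix: "bounded_bilinear (\<lambda>(A::real^'m^'k) (B::real^'l^'m). A ** B)"
  by (rule bilinear_conv_bounded_bilinear[THEN iffD1])
    (auto simp: bilinear_def matrix_matrix_mult_def vec_eq_iff algebra_simps sum.distrib
      sum_distrib_left intro!: linearI)

lemma bounded_linear_transpose: "bounded_linear (transpose :: real^'m^'k \<Rightarrow> real^'k^'m)"
  by (rule linear_conv_bounded_linear[THEN iffD1])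
    (auto intro!: linearI simp: transpose_def vec_eq_iff)

lemma bounded_linear_trace: "bounded_linear (trace :: real^'m^'m \<Rightarrow> real)"
  by (rule linear_conv_bounded_linear[THEN iffD1])
    (auto intro!: linearI simp: trace_def sum.distrib sum_distrib_left)

lemmas continuous_on_mult_vec [continuous_intros] =
  bounded_bilinear.continuous_on[OF bounded_bilinear_matrix_vector]
lemmas continuous_on_mult_mat [continuous_intros] =
  bounded_bilinear.continuous_on[OF bounded_bilinear_matrix_matrix]
lemmas continuous_on_trace [continuous_intros] = bounded_linear.continuous_on[OF bounded_linear_trace]
lemmas tendsto_mult_vec [tendsto_intros] = bounded_bilinear.tendsto[OF bounded_bilinear_matrix_vector]
lemmas tendsto_mult_mat [tendsto_intros] = bounded_bilinear.tendsto[OF bounded_bilinear_matrix_matrix]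

lemma continuous_on_det [continuous_intros]:
  fixes f :: "'a::topological_space \<Rightarrow> real^'m^'m"
  shows "continuous_on S f \<Longrightarrow> continuous_on S (\<lambda>x. det (f x))"
  unfolding det_def by (intro continuous_intros)

lemma tendsto_det [tendsto_intros]:
  fixes f :: "'a \<Rightarrow> real^'m^'m"
  shows "(f \<longlongrightarrow> A) F \<Longrightarrow> ((\<lambda>x. det (f x)) \<longlongrightarrow> det A) F"
  unfolding det_def by (intro tendsto_intros)

text \<open>Cramer's rule, column by column. The right-hand side is a polynomial in the entries,
  which gives continuity of the inverse and, later, bounds that do not deteriorate as
  \<open>det A\<close> tends to 0.\<close>

lemma matrix_inv_entry:
  fixes A :: "real^'m^'m"
  assumes "det A \<noteq> 0"
  shows "det A * matrix_inv A $ k $ l = det (\<chi> i j. if j = k then axis l 1 $ i else A$i$j)"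
proof -
  have "A *v (matrix_inv A *v axis l 1) = axis l 1"
    using assms by (simp add: matrix_inv_vec invertible_det_nz)
  then have "matrix_inv A *v axis l 1 = (\<chi> k. det(\<chi> i j. if j=k then axis l 1$i else A$i$j) / det A)"
    using cramer[OF assms] by blast
  then have "(matrix_inv A *v axis l 1)$k = det(\<chi> i j. if j=k then axis l 1$i else A$i$j) / det A"
    by simp
  then show ?thesis using assms by (simp add: matrix_vector_mult_basis column_def field_simps)
qed

lemma tendsto_matrix_inv:
  fixes f :: "'a \<Rightarrow> real^'m^'m"
  assumes f: "(f \<longlongrightarrow> A) F" and A: "invertible A"
  shows "((\<lambda>x. matrix_inv (f x)) \<longlongrightarrow> matrix_inv A) F"
proof (intro vec_tendstoI)
  fix k l
  have dA: "det A \<noteq> 0" using A by (simp add: invertible_det_nz)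
  have ev: "\<forall>\<^sub>F x in F. det (f x) \<noteq> 0"
    using tendsto_imp_eventually_ne[OF tendsto_det[OF f] dA] .
  have "((\<lambda>x. det (\<chi> i j. if j = k then axis l 1 $ i else f x$i$j) / det (f x)) \<longlongrightarrow>
      det (\<chi> i j. if j = k then axis l 1 $ i else A$i$j) / det A) F"
  proof (intro tendsto_divide tendsto_det dA f vec_tendstoI)
    fix i j
    show "((\<lambda>x. (\<chi> i j. if j = k then axis l 1 $ i else f x$i$j) $ i $ j) \<longlongrightarrow>
        (\<chi> i j. if j = k then axis l 1 $ i else A$i$j) $ i $ j) F"
      by (cases "j = k") (simp_all add: tendsto_vec_nth f)
  qed
  also have "det (\<chi> i j. if j = k then axis l 1 $ i else A$i$j) / det A = matrix_inv A $ k $ l"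
    using dA matrix_inv_entry[OF dA, of k l] by (simp add: field_simps)
  finally show "((\<lambda>x. matrix_inv (f x) $ k $ l) \<longlongrightarrow> matrix_inv A $ k $ l) F"
  proof (rule Lim_transform_eventually)
    show "\<forall>\<^sub>F x in F. det (\<chi> i j. if j = k then axis l 1 $ i else f x$i$j) / det (f x) = matrix_inv (f x) $ k $ l"
      using ev
    proof eventually_elim
      case (elim x)
      then show ?case using matrix_inv_entry[OF elim, of k l] by (simp add: field_simps)
    qed
  qed
qed

lemma continuous_on_matrix_inv [continuous_intros]:
  fixes f :: "'a::topological_space \<Rightarrow> real^'m^'m"
  shows "continuous_on S f \<Longrightarrow> (\<And>x. x \<in> S \<Longrightarrow> invertible (f x)) \<Longrightarrow> continuous_on S (\<lambda>x. matrix_inv (f x))"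
  unfolding continuous_on_def by (auto intro!: tendsto_matrix_inv)

text \<open>The resolvent identity; inserted into a difference quotient it yields the derivative of
  the inverse.\<close>

lemma matrix_inv_diff:
  fixes A B :: "real^'m^'m"
  assumes "invertible A" "invertible B"
  shows "matrix_inv B - matrix_inv A = - (matrix_inv B ** (B - A) ** matrix_inv A)"
  by (simp add: matrix_eq matrix_vector_mul_assoc[symmetric] matrix_inv_vec[OF assms(1)]
      matrix_inv_vec[OF assms(2)] algebra_simps matrix_vector_mult_uminus)

lemma has_vector_derivative_quotient:
  fixes f :: "real \<Rightarrow> 'b::real_normed_vector"
  shows "(f has_vector_derivative D) (at t) \<longleftrightarrow> ((\<lambda>x. (f x - f t) /\<^sub>R (x - t)) \<longlongrightarrow> D) (at t)"
proof -
  have "norm ((1 / norm (x - t)) *\<^sub>R (f x - (f t + (x - t) *\<^sub>R D))) = norm ((f x - f t) /\<^sub>R (x - t) - D)"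
    if "x \<noteq> t" for x
  proof -
    have "(f x - f t) /\<^sub>R (x - t) - D = (f x - (f t + (x - t) *\<^sub>R D)) /\<^sub>R (x - t)"
      using that by (simp add: scaleR_diff_right scaleR_add_right)
    then show ?thesis by (simp add: divide_inverse)
  qed
  then have "((\<lambda>x. norm ((1 / norm (x - t)) *\<^sub>R (f x - (f t + (x - t) *\<^sub>R D)))) \<longlongrightarrow> 0) (at t) \<longleftrightarrow>
     ((\<lambda>x. norm ((f x - f t) /\<^sub>R (x - t) - D)) \<longlongrightarrow> 0) (at t)"
    by (intro filterlim_cong refl) (auto simp: eventually_at_filter)
  then have "((\<lambda>x. (1 / norm (x - t)) *\<^sub>R (f x - (f t + (x - t) *\<^sub>R D))) \<longlongrightarrow> 0) (at t) \<longleftrightarrow>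
     ((\<lambda>x. (f x - f t) /\<^sub>R (x - t) - D) \<longlongrightarrow> 0) (at t)"
    by (simp only: tendsto_norm_zero_iff)
  then show ?thesis
    unfolding has_vector_derivative_def has_derivative_within
    by (simp only: LIM_zero_iff bounded_linear_scaleR_left simp_thms)
qed

lemma has_vector_derivative_matrix_inv:
  fixes f :: "real \<Rightarrow> real^'m^'m"
  assumes f: "(f has_vector_derivative D) (at t)" and i: "\<And>x. invertible (f x)"
  shows "((\<lambda>x. matrix_inv (f x)) has_vector_derivative - (matrix_inv (f t) ** D ** matrix_inv (f t))) (at t)"
proof -
  have c: "(f \<longlongrightarrow> f t) (at t)"
    using has_vector_derivative_continuous[OF f] by (simp add: continuous_within)
  have "((\<lambda>x. - (matrix_inv (f x) ** ((f x - f t) /\<^sub>R (x - t)) ** matrix_inv (f t))) \<longlongrightarrow>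
     - (matrix_inv (f t) ** D ** matrix_inv (f t))) (at t)"
    using f unfolding has_vector_derivative_quotient
    by (intro tendsto_intros tendsto_matrix_inv c i)
  moreover have "- (matrix_inv (f x) ** ((f x - f t) /\<^sub>R (x - t)) ** matrix_inv (f t))
      = (matrix_inv (f x) - matrix_inv (f t)) /\<^sub>R (x - t)" for x
    by (simp add: matrix_inv_diff i bounded_bilinear.scaleR_left[OF bounded_bilinear_matrix_matrix]
        bounded_bilinear.scaleR_right[OF bounded_bilinear_matrix_matrix])
  ultimately show ?thesis
    unfolding has_vector_derivative_quotient by simp
qed

text \<open>Jacobi's formula. Differentiating the Leibniz expansion gives determinants in which one
  row of \<open>f t\<close> is replaced by the same row of \<open>D = B ** f t\<close>. That row is
  a combination of the rows of \<open>f t\<close>, and only its diagonal coefficient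
  \<open>B $ i $ i\<close> contributes.\<close>

lemma has_real_derivative_det:
  fixes f :: "real \<Rightarrow> real^'m^'m"
  assumes f: "(f has_vector_derivative D) (at t)" and i: "invertible (f t)"
  shows "((\<lambda>x. det (f x)) has_real_derivative (det (f t) * trace (matrix_inv (f t) ** D))) (at t)"
proof -
  have c: "((\<lambda>x. f x $ i $ j) has_real_derivative D $ i $ j) (at t)" for i j
  proof -
    have "((\<lambda>x. f x $ i $ j) has_vector_derivative D $ i $ j) (at t)"
      by (rule bounded_linear.has_vector_derivative[OF bounded_linear_compose[OF bounded_linear_vec_nth bounded_linear_vec_nth] f])
    then show ?thesis by (simp add: has_real_derivative_iff_has_vector_derivative)
  qed
  define B where "B = D ** matrix_inv (f t)"
  have BD: "D = B ** f t" using matrix_inv_works[OF i] by (simp add: B_def matrix_mul_assoc[symmetric])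
  have row: "det (\<chi> j. if j = i then D $ i else f t $ j) = B $ i $ i * det (f t)" for i
  proof -
    have e: "D $ i = (\<Sum>j\<in>UNIV. B $ i $ j *s row j (f t))"
      by (subst BD) (simp add: vec_eq_iff matrix_matrix_mult_def row_def)
    have "det (\<chi> j. if j = i then D $ i else f t $ j) =
        det (\<chi> j. if j = i then (\<Sum>j\<in>UNIV. B $ i $ j *s row j (f t)) else row j (f t))"
      unfolding e by (rule arg_cong[of _ _ det]) (simp add: vec_eq_iff row_def)
    also have "\<dots> = B $ i $ i * det (f t)" by (rule cramer_lemma_transpose)
    finally show ?thesis .
  qed
  have "((\<lambda>x. det (f x)) has_real_derivative
     (\<Sum>p\<in>{p. p permutes UNIV}. of_int (sign p) * (\<Sum>i\<in>UNIV. D $ i $ p i * (\<Prod>j\<in>UNIV - {i}. f t $ j $ p j)))) (at t)"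
    unfolding det_def by (intro DERIV_sum DERIV_cmult has_field_derivative_prod) (rule c)
  also have "(\<Sum>p\<in>{p. p permutes UNIV}. of_int (sign p) * (\<Sum>i\<in>UNIV. D $ i $ p i * (\<Prod>j\<in>UNIV - {i}. f t $ j $ p j)))
     = (\<Sum>i\<in>UNIV. det (\<chi> j. if j = i then D $ i else f t $ j))"
    unfolding det_def sum_distrib_left
  proof (subst sum.swap, intro sum.cong refl)
    fix i :: 'm and p :: "'m \<Rightarrow> 'm"
    have "(\<Prod>k\<in>UNIV. (\<chi> j. if j = i then D $ i else f t $ j) $ k $ p k) =
      D $ i $ p i * (\<Prod>j\<in>UNIV - {i}. f t $ j $ p j)"
      by (subst prod.remove[of _ i]) (auto intro!: prod.cong)
    then show "of_int (sign p) * (D $ i $ p i * (\<Prod>j\<in>UNIV - {i}. f t $ j $ p j)) =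
        of_int (sign p) * (\<Prod>k\<in>UNIV. (\<chi> j. if j = i then D $ i else f t $ j) $ k $ p k)" by simp
  qed
  also have "\<dots> = det (f t) * trace B" by (simp add: row trace_def sum_distrib_left mult.commute)
  also have "trace B = trace (matrix_inv (f t) ** D)" unfolding B_def by (rule trace_mul_sym)
  finally show ?thesis .
qed

section \<open>A Prekopa theorem for matrix weights\<close>

lemma posdef_integral:
  fixes G :: "real \<Rightarrow> real^'m^'m"
  assumes ab: "\<alpha> < \<beta>" and pd: "\<And>t. posdef (G t)" and cont: "continuous_on UNIV G"
  shows "posdef (integral {\<alpha>..\<beta>} G)"
proof -
  have i: "G integrable_on {\<alpha>..\<beta>}"
    by (intro integrable_continuous_interval continuous_on_subset[OF cont]) auto
  have "transpose (integral {\<alpha>..\<beta>} G) = integral {\<alpha>..\<beta>} (transpose \<circ> G)"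
    by (rule integral_linear[OF i bounded_linear_transpose, symmetric])
  also have "transpose \<circ> G = G" using pd by (auto simp: posdef_def)
  finally have t: "transpose (integral {\<alpha>..\<beta>} G) = integral {\<alpha>..\<beta>} G" .
  have "0 < x \<bullet> (integral {\<alpha>..\<beta>} G *v x)" if x: "x \<noteq> 0" for x
  proof -
    have bl: "bounded_linear (\<lambda>A. x \<bullet> (A *v x))"
      by (rule bounded_linear_compose[OF bounded_linear_inner_right
            bounded_bilinear.bounded_linear_left[OF bounded_bilinear_matrix_vector]])
    have "x \<bullet> (integral {\<alpha>..\<beta>} G *v x) = integral {\<alpha>..\<beta>} (\<lambda>t. x \<bullet> (G t *v x))"
      using integral_linear[OF i bl] by (simp add: o_def)
    also have "\<dots> > 0"
    proof -
      have "continuous_on {\<alpha>..\<beta>} (\<lambda>t. x \<bullet> (G t *v x))"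
        by (intro continuous_intros continuous_on_subset[OF cont]) auto
      then show ?thesis
        using integral_less_real[of \<alpha> \<beta> "\<lambda>_. 0" "\<lambda>t. x \<bullet> (G t *v x)"] ab pd x
        by (auto simp: posdef_def)
    qed
    finally show ?thesis .
  qed
  with t show ?thesis by (simp add: posdef_def)
qed

text \<open>One-dimensional solution of the adjoint equation: with \<open>c\<close> the \<open>G\<close>-mean and \<open>Y\<close> the primitive of
  \<open>H - G c\<close>, the test vector \<open>v = - G\<inverse> Y\<close> vanishes at both ends, and the form in the
  hypothesis equals \<open>c \<bullet> G c - v' \<bullet> G v' - K\<close> minus a total derivative.\<close>

lemma matrix_Prekopa_interval:
  fixes G G1 G2 :: "real \<Rightarrow> real^'m^'m" and H H1 :: "real \<Rightarrow> real^'m" and K :: "real \<Rightarrow> real"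
  assumes ab: "\<alpha> < \<beta>"
    and pd: "\<And>t. posdef (G t)"
    and dG: "\<And>t. (G has_vector_derivative G1 t) (at t)"
    and dG1: "\<And>t. (G1 has_vector_derivative G2 t) (at t)"
    and dH: "\<And>t. (H has_vector_derivative H1 t) (at t)"
    and sym: "\<And>t. transpose (G1 t) = G1 t"
    and cK: "continuous_on UNIV K"
    and N: "\<And>t v. 0 \<le> (G1 t *v v + H t) \<bullet> (matrix_inv (G t) *v (G1 t *v v + H t))
        - v \<bullet> (G2 t *v v) - 2 * (v \<bullet> H1 t) - K t"
  shows "0 \<le> integral {\<alpha>..\<beta>} H \<bullet> (matrix_inv (integral {\<alpha>..\<beta>} G) *v integral {\<alpha>..\<beta>} H)
      - integral {\<alpha>..\<beta>} K"
proof -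
  have cG: "continuous_on UNIV G" and cH: "continuous_on UNIV H"
    using dG dH by (auto intro!: continuous_at_imp_continuous_on has_vector_derivative_continuous)
  define M where "M = integral {\<alpha>..\<beta>} G"
  define c where "c = matrix_inv M *v integral {\<alpha>..\<beta>} H"
  have pM: "posdef M" unfolding M_def by (rule posdef_integral[OF ab pd cG])
  have Mc: "M *v c = integral {\<alpha>..\<beta>} H" by (simp add: c_def posdef_inv_vec[OF pM])
  note pd_sym = posdef_sym[OF pd] and iv = posdef_inv_vec[OF pd]
  note int = integrable_continuous_interval[OF continuous_on_subset[OF _ subset_UNIV]]
  have blc: "bounded_linear (\<lambda>A::real^'m^'m. A *v c)"
    by (rule bounded_bilinear.bounded_linear_left[OF bounded_bilinear_matrix_vector])
  have blcc: "bounded_linear (\<lambda>A::real^'m^'m. c \<bullet> (A *v c))"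
    by (rule bounded_linear_compose[OF bounded_linear_inner_right blc])
  define Y where "Y t = integral {\<alpha>..t} (\<lambda>s. H s - G s *v c)" for t
  have cY: "continuous_on UNIV (\<lambda>s. H s - G s *v c)"
    by (intro continuous_intros cG cH)
  have dY: "(Y has_vector_derivative H t - G t *v c) (at t within {\<alpha>..\<beta>})" if "t \<in> {\<alpha>..\<beta>}" for t
    unfolding Y_def by (rule integral_has_vector_derivative[OF continuous_on_subset[OF cY subset_UNIV] that])
  have Ya: "Y \<alpha> = 0" by (simp add: Y_def)
  \<comment> \<open>\<open>c\<close> is chosen so that \<open>H - G c\<close> has integral 0; this
    removes the boundary term at the right end.\<close>
  have Yb: "Y \<beta> = 0"
  proof -
    have "integral {\<alpha>..\<beta>} (\<lambda>s. G s *v c) = M *v c"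
      using integral_linear[OF int[OF cG] blc] by (simp add: o_def M_def)
    then show ?thesis
      using Mc by (simp add: Y_def integral_diff[OF int[OF cH] int] continuous_intros cG)
  qed
  define v where "v t = - (matrix_inv (G t) *v Y t)" for t
  define w where "w t = G1 t *v v t + H t" for t
  define u where "u t = matrix_inv (G t) *v w t" for t
  have dv: "(v has_vector_derivative (c - u t)) (at t within {\<alpha>..\<beta>})" if t: "t \<in> {\<alpha>..\<beta>}" for t
  proof -
    have "((\<lambda>t. matrix_inv (G t) *v Y t) has_vector_derivative
        (matrix_inv (G t) *v (H t - G t *v c) + (- (matrix_inv (G t) ** G1 t ** matrix_inv (G t))) *v Y t))
        (at t within {\<alpha>..\<beta>})"
      by (rule bounded_bilinear.has_vector_derivative[OF bounded_bilinear_matrix_vector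
            has_vector_derivative_at_within[OF has_vector_derivative_matrix_inv[OF dG posdef_invertible[OF pd]]] dY[OF t]])
    from has_vector_derivative_minus[OF this]
    have "(v has_vector_derivative - (matrix_inv (G t) *v (H t - G t *v c) + (- (matrix_inv (G t) ** G1 t ** matrix_inv (G t))) *v Y t))
       (at t within {\<alpha>..\<beta>})" unfolding v_def .
    also have "- (matrix_inv (G t) *v (H t - G t *v c) + (- (matrix_inv (G t) ** G1 t ** matrix_inv (G t))) *v Y t) = c - u t"
      by (simp add: u_def w_def v_def iv matrix_vector_mult_uminus matrix_vector_mul_assoc[symmetric]
          algebra_simps linear_neg[OF matrix_vector_mul_linear])
    finally show ?thesis .
  qed
  \<comment> \<open>The boundary term of the integration by parts: it vanishes with \<open>v\<close>
    at both ends, so its derivative \<open>D\<close> has integral 0.\<close>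
  define \<Phi> where "\<Phi> t = v t \<bullet> (G1 t *v v t) + 2 * (v t \<bullet> H t)" for t
  define D where "D t = 2 * ((c - u t) \<bullet> w t) + v t \<bullet> (G2 t *v v t) + 2 * (v t \<bullet> H1 t)" for t
  have d\<Phi>: "(\<Phi> has_vector_derivative D t) (at t within {\<alpha>..\<beta>})" if t: "t \<in> {\<alpha>..\<beta>}" for t
  proof -
    have 1: "((\<lambda>t. G1 t *v v t) has_vector_derivative (G1 t *v (c - u t) + G2 t *v v t)) (at t within {\<alpha>..\<beta>})"
      by (rule bounded_bilinear.has_vector_derivative[OF bounded_bilinear_matrix_vector
            has_vector_derivative_at_within[OF dG1] dv[OF t]])
    have 2: "((\<lambda>t. v t \<bullet> (G1 t *v v t)) has_vector_derivative
        (v t \<bullet> (G1 t *v (c - u t) + G2 t *v v t) + (c - u t) \<bullet> (G1 t *v v t))) (at t within {\<alpha>..\<beta>})"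
      by (rule bounded_bilinear.has_vector_derivative[OF bounded_bilinear_inner dv[OF t] 1])
    have 3: "((\<lambda>t. v t \<bullet> H t) has_vector_derivative (v t \<bullet> H1 t + (c - u t) \<bullet> H t)) (at t within {\<alpha>..\<beta>})"
      by (rule bounded_bilinear.has_vector_derivative[OF bounded_bilinear_inner dv[OF t]
            has_vector_derivative_at_within[OF dH]])
    have "(\<Phi> has_vector_derivative (v t \<bullet> (G1 t *v (c - u t) + G2 t *v v t) + (c - u t) \<bullet> (G1 t *v v t))
       + 2 * (v t \<bullet> H1 t + (c - u t) \<bullet> H t)) (at t within {\<alpha>..\<beta>})"
      unfolding \<Phi>_def by (intro has_vector_derivative_add 2 has_vector_derivative_mult_right 3)
    also have "(v t \<bullet> (G1 t *v (c - u t) + G2 t *v v t) + (c - u t) \<bullet> (G1 t *v v t))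
       + 2 * (v t \<bullet> H1 t + (c - u t) \<bullet> H t) = D t"
      using inner_matrix_sym[OF sym, of "v t" t "c - u t"]
      by (simp add: D_def w_def inner_add_right)
    finally show ?thesis .
  qed
  have "(D has_integral (\<Phi> \<beta> - \<Phi> \<alpha>)) {\<alpha>..\<beta>}"
    by (rule fundamental_theorem_of_calculus) (use ab d\<Phi> in auto)
  then have D0: "(D has_integral 0) {\<alpha>..\<beta>}" by (simp add: \<Phi>_def v_def Ya Yb)
  \<comment> \<open>Hypothesis \<open>N\<close> at \<open>v t\<close> bounds the terms with
    \<open>G2\<close> and \<open>H1\<close>. What remains is completed to the
    \<open>G\<close>-square of \<open>c - u t\<close>, which is the derivative of \<open>v\<close>,
    by means of \<open>G t *v u t = w t\<close>.\<close>
  have le: "D t \<le> c \<bullet> (G t *v c) - K t" for t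
  proof -
    have Gu: "G t *v u t = w t" by (simp add: u_def iv)
    have "0 \<le> (c - u t) \<bullet> (G t *v (c - u t))" by (rule posdef_nonneg[OF pd])
    also have "\<dots> = c \<bullet> (G t *v c) - 2 * (c \<bullet> w t) + u t \<bullet> w t"
      using pd_sym[of "u t" t c] by (simp add: Gu matrix_vector_mult_diff_distrib inner_diff)
    finally have "2 * (c \<bullet> w t) - u t \<bullet> w t \<le> c \<bullet> (G t *v c)" by simp
    moreover have "0 \<le> w t \<bullet> u t - v t \<bullet> (G2 t *v v t) - 2 * (v t \<bullet> H1 t) - K t"
      using N[of t "v t"] by (simp add: w_def u_def)
    ultimately show ?thesis by (simp add: D_def inner_diff inner_commute)
  qed
  have "integral {\<alpha>..\<beta>} (\<lambda>t. c \<bullet> (G t *v c) - K t) = c \<bullet> (M *v c) - integral {\<alpha>..\<beta>} K"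
    using integral_linear[OF int[OF cG] blcc] integrable_linear[OF int[OF cG] blcc]
    by (simp add: o_def M_def integral_diff int[OF cK])
  moreover have "(\<lambda>t. c \<bullet> (G t *v c) - K t) integrable_on {\<alpha>..\<beta>}"
    by (intro int continuous_intros cG cK)
  ultimately have "((\<lambda>t. c \<bullet> (G t *v c) - K t) has_integral (c \<bullet> (M *v c) - integral {\<alpha>..\<beta>} K)) {\<alpha>..\<beta>}"
    by (simp add: has_integral_integrable_integral)
  from has_integral_le[OF D0 this le] have "0 \<le> c \<bullet> (M *v c) - integral {\<alpha>..\<beta>} K" by simp
  then have "0 \<le> integral {\<alpha>..\<beta>} H \<bullet> c - integral {\<alpha>..\<beta>} K" by (simp only: Mc inner_commute)
  then show ?thesis by (simp only: c_def M_def)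
qed

section \<open>Integration along one direction\<close>

text \<open>The result is again a function on the whole space, the integrated direction included, so
  that one locale serves at every stage of the iteration. On a compact interval continuity suffices
  for integrability and for differentiation under the integral.\<close>

definition line_int :: "real \<Rightarrow> 'a::real_vector \<Rightarrow> ('a \<Rightarrow> 'b::real_normed_vector) \<Rightarrow> 'a \<Rightarrow> 'b" where
  "line_int L b f z = integral {-L..L} (\<lambda>t. f (z + t *\<^sub>R b))"

lemma continuous_on_line:
  fixes f :: "'a::euclidean_space \<Rightarrow> 'b::banach"
  assumes "continuous_on UNIV f"
  shows "continuous_on S (\<lambda>t. f (z + t *\<^sub>R b))"
  by (rule continuous_on_compose2[OF assms]) (auto intro!: continuous_intros)

lemma line_integrable:
  fixes f :: "'a::euclidean_space \<Rightarrow> 'b::banach"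
  assumes "continuous_on UNIV f"
  shows "(\<lambda>t. f (z + t *\<^sub>R b)) integrable_on {\<alpha>..\<beta>}"
  by (intro integrable_continuous_interval continuous_on_line assms)

lemma continuous_on_line_int:
  fixes f :: "'a::euclidean_space \<Rightarrow> 'b::banach"
  assumes "continuous_on UNIV f"
  shows "continuous_on UNIV (line_int L b f)"
proof -
  have "continuous_on UNIV (\<lambda>z. integral (cbox (-L) L) (\<lambda>t. f (z + t *\<^sub>R b)))"
    by (rule integral_continuous_on_param)
      (auto simp: split_beta intro!: continuous_on_compose2[OF assms] continuous_intros)
  then show ?thesis by (simp add: line_int_def[abs_def])
qed

lemma has_vector_derivative_line:
  fixes f :: "'a::real_vector \<Rightarrow> 'b::real_normed_vector"
  assumes "\<And>z. ((\<lambda>t. f (z + t *\<^sub>R b)) has_vector_derivative g z) (at 0)"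
  shows "((\<lambda>t. f (z + t *\<^sub>R b)) has_vector_derivative g (z + t *\<^sub>R b)) (at t)"
proof -
  have "((\<lambda>s. f ((z + t *\<^sub>R b) + (s - t) *\<^sub>R b)) has_vector_derivative 1 *\<^sub>R g (z + t *\<^sub>R b)) (at t)"
    by (rule vector_diff_chain_at[of "\<lambda>s. s - t" 1 t "\<lambda>s. f ((z + t *\<^sub>R b) + s *\<^sub>R b)", unfolded o_def])
      (auto intro!: derivative_eq_intros assms)
  moreover have "z + t *\<^sub>R b + (s - t) *\<^sub>R b = z + s *\<^sub>R b" for s
    by (simp add: scaleR_left.diff)
  ultimately show ?thesis by simp
qed

lemma line_int_derivative:
  fixes f :: "'a::euclidean_space \<Rightarrow> 'b::banach"
  assumes d: "\<And>z. ((\<lambda>t. f (z + t *\<^sub>R c)) has_vector_derivative g z) (at 0)"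
    and cf: "continuous_on UNIV f" and cg: "continuous_on UNIV g"
  shows "((\<lambda>t. line_int L b f (z + t *\<^sub>R c)) has_vector_derivative line_int L b g z) (at 0)"
proof -
  have e: "z + s *\<^sub>R c + t *\<^sub>R b = (z + t *\<^sub>R b) + s *\<^sub>R c" for s t by (simp add: algebra_simps)
  have "((\<lambda>s. integral (cbox (-L) L) (\<lambda>t. f (z + s *\<^sub>R c + t *\<^sub>R b))) has_vector_derivative
      integral (cbox (-L) L) (\<lambda>t. g (z + 0 *\<^sub>R c + t *\<^sub>R b))) (at 0 within UNIV)"
  proof (rule leibniz_rule_vector_derivative)
    show "((\<lambda>s. f (z + s *\<^sub>R c + t *\<^sub>R b)) has_vector_derivative g (z + s *\<^sub>R c + t *\<^sub>R b)) (at s within UNIV)" for s t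
      unfolding e using has_vector_derivative_line[of f c g, OF d] by simp
    show "continuous_on (UNIV \<times> cbox (-L) L) (\<lambda>(s, t). g (z + s *\<^sub>R c + t *\<^sub>R b))"
      by (auto simp: split_beta intro!: continuous_on_compose2[OF cg] continuous_intros)
    show "(\<lambda>t. f (z + s *\<^sub>R c + t *\<^sub>R b)) integrable_on cbox (-L) L" for s
      using line_integrable[OF cf] by simp
  qed auto
  then show ?thesis by (simp add: line_int_def)
qed

text \<open>\<open>G1\<close>, \<open>G2\<close> and \<open>H1\<close> are partial derivatives in the directions of \<open>Basis\<close>. The condition \<open>curv\<close> is Nakano
  semipositivity of the metric \<open>G\<close>, bordered by \<open>H\<close> and \<open>K\<close>; it survives integration over one variable, and
  without any variable left it is the inequality \<open>K \<le> H \<bullet> G\<inverse> H\<close>.\<close>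

locale nakano =
  fixes G :: "'a::euclidean_space \<Rightarrow> real^'m^'m" and G1 :: "'a \<Rightarrow> 'a \<Rightarrow> real^'m^'m"
    and G2 :: "'a \<Rightarrow> 'a \<Rightarrow> 'a \<Rightarrow> real^'m^'m" and H :: "'a \<Rightarrow> real^'m" and H1 :: "'a \<Rightarrow> 'a \<Rightarrow> real^'m"
    and K :: "'a \<Rightarrow> real"
  assumes pd: "\<And>z. posdef (G z)"
    and dG: "\<And>b z. b \<in> Basis \<Longrightarrow> ((\<lambda>t. G (z + t *\<^sub>R b)) has_vector_derivative G1 b z) (at 0)"
    and dG1: "\<And>b c z. b \<in> Basis \<Longrightarrow> c \<in> Basis \<Longrightarrow>
        ((\<lambda>t. G1 b (z + t *\<^sub>R c)) has_vector_derivative G2 b c z) (at 0)"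
    and dH: "\<And>b z. b \<in> Basis \<Longrightarrow> ((\<lambda>t. H (z + t *\<^sub>R b)) has_vector_derivative H1 b z) (at 0)"
    and sym1: "\<And>b z. b \<in> Basis \<Longrightarrow> transpose (G1 b z) = G1 b z"
    and sym2: "\<And>b c z. b \<in> Basis \<Longrightarrow> c \<in> Basis \<Longrightarrow> transpose (G2 b c z) = G2 b c z"
    and comm2: "\<And>b c z. b \<in> Basis \<Longrightarrow> c \<in> Basis \<Longrightarrow> G2 b c z = G2 c b z"
    and cG: "continuous_on UNIV G" and cG1: "\<And>b. b \<in> Basis \<Longrightarrow> continuous_on UNIV (G1 b)"
    and cG2: "\<And>b c. b \<in> Basis \<Longrightarrow> c \<in> Basis \<Longrightarrow> continuous_on UNIV (G2 b c)"
    and cH: "continuous_on UNIV H" and cH1: "\<And>b. b \<in> Basis \<Longrightarrow> continuous_on UNIV (H1 b)"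
    and cK: "continuous_on UNIV K"
    and curv: "\<And>z \<xi>. 0 \<le> ((\<Sum>b\<in>Basis. G1 b z *v \<xi> b) + H z) \<bullet>
        (matrix_inv (G z) *v ((\<Sum>b\<in>Basis. G1 b z *v \<xi> b) + H z))
      - (\<Sum>b\<in>Basis. \<Sum>c\<in>Basis. \<xi> b \<bullet> (G2 b c z *v \<xi> c)) - 2 * (\<Sum>b\<in>Basis. \<xi> b \<bullet> H1 b z) - K z"

lemma transpose_line_int:
  fixes f :: "'a::euclidean_space \<Rightarrow> real^'m^'m"
  assumes "continuous_on UNIV f" "\<And>z. transpose (f z) = f z"
  shows "transpose (line_int L b f z) = line_int L b f z"
  using integral_linear[OF line_integrable[OF assms(1)] bounded_linear_transpose] assms(2)
  by (simp add: line_int_def o_def)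

text \<open>The family \<xi> is kept constant along the line, and an arbitrary vector
  \<open>v\<close> is added to its member in direction \<open>e\<close>. As a condition on
  \<open>v\<close>, \<open>curv\<close> is the hypothesis of \<open>matrix_Prekopa_interval\<close>,
  with the terms that depend on \<xi> alone moved into \<open>H\<close> (here \<open>w\<close>) and
  \<open>K\<close> (here \<open>k\<close>). Since \<xi> is constant, the integrals of
  \<open>w\<close> and \<open>k\<close> are again of the form required by
  \<open>curv\<close>.\<close>

lemma nakano_line_int:
  assumes "nakano G G1 G2 H H1 K" and L: "L > 0" and e: "e \<in> Basis"
  shows "nakano (line_int L e G) (\<lambda>b. line_int L e (G1 b)) (\<lambda>b c. line_int L e (G2 b c))
    (line_int L e H) (\<lambda>b. line_int L e (H1 b)) (line_int L e K)"
proof -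
  interpret nakano G G1 G2 H H1 K by fact
  show ?thesis
  proof
    show "posdef (line_int L e G z)" for z
      unfolding line_int_def by (intro posdef_integral pd continuous_on_line cG) (use L in auto)
    fix z :: 'a and \<xi> :: "'a \<Rightarrow> real^'b"
    define w where "w t = (\<Sum>b\<in>Basis. G1 b (z + t *\<^sub>R e) *v \<xi> b) + H (z + t *\<^sub>R e)" for t
    define w1 where "w1 t = (\<Sum>b\<in>Basis. G2 b e (z + t *\<^sub>R e) *v \<xi> b) + H1 e (z + t *\<^sub>R e)" for t
    define k where "k t = (\<Sum>b\<in>Basis. \<Sum>c\<in>Basis. \<xi> b \<bullet> (G2 b c (z + t *\<^sub>R e) *v \<xi> c))
        + 2 * (\<Sum>b\<in>Basis. \<xi> b \<bullet> H1 b (z + t *\<^sub>R e)) + K (z + t *\<^sub>R e)" for t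
    have ck: "continuous_on UNIV k"
      unfolding k_def by (intro continuous_intros continuous_on_line cG2 cH1 cK)
    have "0 \<le> integral {-L..L} w \<bullet> (matrix_inv (integral {-L..L} (\<lambda>t. G (z + t *\<^sub>R e))) *v integral {-L..L} w)
      - integral {-L..L} k"
    proof (rule matrix_Prekopa_interval)
      show "-L < L" using L by simp
      show "posdef (G (z + t *\<^sub>R e))" for t by (rule pd)
      show "((\<lambda>t. G (z + t *\<^sub>R e)) has_vector_derivative G1 e (z + t *\<^sub>R e)) (at t)" for t
        using has_vector_derivative_line[of G e "G1 e", OF dG[OF e]] .
      show "((\<lambda>t. G1 e (z + t *\<^sub>R e)) has_vector_derivative G2 e e (z + t *\<^sub>R e)) (at t)" for t
        using has_vector_derivative_line[of "G1 e" e "G2 e e", OF dG1[OF e e]] .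
      show "(w has_vector_derivative w1 t) (at t)" for t
        unfolding w_def w1_def
        by (intro has_vector_derivative_add has_vector_derivative_sum
            has_vector_derivative_line[of H e "H1 e", OF dH[OF e]]
            bounded_linear.has_vector_derivative[OF bounded_bilinear.bounded_linear_left[OF bounded_bilinear_matrix_vector]]
            has_vector_derivative_line[of "G1 b" e "G2 b e" for b, OF dG1[OF _ e]])
      show "transpose (G1 e (z + t *\<^sub>R e)) = G1 e (z + t *\<^sub>R e)" for t by (rule sym1[OF e])
      show "continuous_on UNIV k" by (rule ck)
      fix t v
      let ?z = "z + t *\<^sub>R e"
      define \<eta> :: "'a \<Rightarrow> real^'b" where "\<eta> = (\<lambda>b. if b = e then v else 0)"
      have s1: "(\<Sum>b\<in>Basis. f b (\<eta> b)) = f e v" if "\<And>b. f b 0 = 0" for f :: "'a \<Rightarrow> real^'b \<Rightarrow> real"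
      proof -
        have "(\<Sum>b\<in>Basis. f b (\<eta> b)) = (\<Sum>b\<in>Basis. if b = e then f e v else 0)"
          by (intro sum.cong refl) (simp add: \<eta>_def that)
        then show ?thesis using e by (simp add: sum.delta)
      qed
      have s2: "(\<Sum>b\<in>Basis. f b (\<eta> b)) = f e v" if "\<And>b. f b 0 = 0" for f :: "'a \<Rightarrow> real^'b \<Rightarrow> real^'b"
      proof -
        have "(\<Sum>b\<in>Basis. f b (\<eta> b)) = (\<Sum>b\<in>Basis. if b = e then f e v else 0)"
          by (intro sum.cong refl) (simp add: \<eta>_def that)
        then show ?thesis using e by (simp add: sum.delta)
      qed
      have a1: "(\<Sum>b\<in>Basis. G1 b ?z *v (\<xi> b + \<eta> b)) = (\<Sum>b\<in>Basis. G1 b ?z *v \<xi> b) + G1 e ?z *v v"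
        using s2[of "\<lambda>b x. G1 b ?z *v x"] by (simp add: matrix_vector_right_distrib sum.distrib)
      have a2: "(\<Sum>b\<in>Basis. (\<xi> b + \<eta> b) \<bullet> H1 b ?z) = (\<Sum>b\<in>Basis. \<xi> b \<bullet> H1 b ?z) + v \<bullet> H1 e ?z"
        using s1[of "\<lambda>b x. x \<bullet> H1 b ?z"] by (simp add: inner_add_left sum.distrib)
      \<comment> \<open>The mixed terms between \<xi> and \<open>v\<close> occur twice and agree,
        because \<open>G2\<close> is symmetric both as a matrix and in its two directions.\<close>
      have a3: "(\<Sum>b\<in>Basis. \<Sum>c\<in>Basis. (\<xi> b + \<eta> b) \<bullet> (G2 b c ?z *v (\<xi> c + \<eta> c))) =
          (\<Sum>b\<in>Basis. \<Sum>c\<in>Basis. \<xi> b \<bullet> (G2 b c ?z *v \<xi> c)) + 2 * (v \<bullet> (\<Sum>b\<in>Basis. G2 b e ?z *v \<xi> b))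
           + v \<bullet> (G2 e e ?z *v v)"
      proof -
        have sw: "x \<bullet> (G2 b e ?z *v v) = v \<bullet> (G2 b e ?z *v x)" if "b \<in> Basis" for b x
          by (rule inner_matrix_sym[OF sym2[OF that e]])
        have s3: "(\<Sum>c\<in>Basis. G2 b c ?z *v \<eta> c) = G2 b e ?z *v v" for b
          using s2[of "\<lambda>c x. G2 b c ?z *v x"] by simp
        have "(\<Sum>b\<in>Basis. \<Sum>c\<in>Basis. (\<xi> b + \<eta> b) \<bullet> (G2 b c ?z *v (\<xi> c + \<eta> c))) =
           (\<Sum>b\<in>Basis. (\<xi> b + \<eta> b) \<bullet> ((\<Sum>c\<in>Basis. G2 b c ?z *v \<xi> c) + G2 b e ?z *v v))"
          by (simp add: matrix_vector_right_distrib sum.distrib inner_sum_right[symmetric] s3)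
        also have "\<dots> = (\<Sum>b\<in>Basis. \<xi> b \<bullet> ((\<Sum>c\<in>Basis. G2 b c ?z *v \<xi> c) + G2 b e ?z *v v)) +
            v \<bullet> ((\<Sum>c\<in>Basis. G2 e c ?z *v \<xi> c) + G2 e e ?z *v v)"
          using s1[of "\<lambda>b x. x \<bullet> ((\<Sum>c\<in>Basis. G2 b c ?z *v \<xi> c) + G2 b e ?z *v v)"]
          by (simp add: inner_add_left sum.distrib)
        also have "(\<Sum>b\<in>Basis. \<xi> b \<bullet> ((\<Sum>c\<in>Basis. G2 b c ?z *v \<xi> c) + G2 b e ?z *v v)) =
            (\<Sum>b\<in>Basis. \<Sum>c\<in>Basis. \<xi> b \<bullet> (G2 b c ?z *v \<xi> c)) + (\<Sum>b\<in>Basis. v \<bullet> (G2 b e ?z *v \<xi> b))"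
          by (simp add: inner_add_right sum.distrib inner_sum_right sw)
        also have "(\<Sum>c\<in>Basis. G2 e c ?z *v \<xi> c) = (\<Sum>b\<in>Basis. G2 b e ?z *v \<xi> b)"
          by (intro sum.cong refl) (simp add: comm2[OF e])
        finally show ?thesis by (simp add: inner_add_right inner_sum_right)
      qed
      have "0 \<le> ((\<Sum>b\<in>Basis. G1 b ?z *v (\<xi> b + \<eta> b)) + H ?z) \<bullet>
          (matrix_inv (G ?z) *v ((\<Sum>b\<in>Basis. G1 b ?z *v (\<xi> b + \<eta> b)) + H ?z))
        - (\<Sum>b\<in>Basis. \<Sum>c\<in>Basis. (\<xi> b + \<eta> b) \<bullet> (G2 b c ?z *v (\<xi> c + \<eta> c)))
        - 2 * (\<Sum>b\<in>Basis. (\<xi> b + \<eta> b) \<bullet> H1 b ?z) - K ?z"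
        by (rule curv)
      moreover have "(\<Sum>b\<in>Basis. G1 b ?z *v (\<xi> b + \<eta> b)) + H ?z = G1 e ?z *v v + w t"
        by (simp add: a1 w_def)
      ultimately show "0 \<le> (G1 e ?z *v v + w t) \<bullet> (matrix_inv (G ?z) *v (G1 e ?z *v v + w t))
        - v \<bullet> (G2 e e ?z *v v) - 2 * (v \<bullet> w1 t) - k t"
        by (simp add: a2 a3 w1_def k_def inner_add_right)
    qed
    moreover have "integral {-L..L} w = (\<Sum>b\<in>Basis. line_int L e (G1 b) z *v \<xi> b) + line_int L e H z"
    proof -
      have bl: "bounded_linear (\<lambda>A::real^'b^'b. A *v x)" for x
        by (rule bounded_bilinear.bounded_linear_left[OF bounded_bilinear_matrix_vector])
      have 1: "(\<lambda>t. G1 b (z + t *\<^sub>R e) *v \<xi> b) integrable_on {-L..L}" if "b \<in> Basis" for b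
        using integrable_linear[OF line_integrable[OF cG1[OF that]] bl] by (simp add: o_def)
      have 2: "integral {-L..L} (\<lambda>t. G1 b (z + t *\<^sub>R e) *v \<xi> b) = line_int L e (G1 b) z *v \<xi> b" if "b \<in> Basis" for b
        using integral_linear[OF line_integrable[OF cG1[OF that]] bl] by (simp add: o_def line_int_def)
      show ?thesis
        unfolding w_def by (simp add: integral_add integral_sum integrable_sum 1 2 line_integrable[OF cH])
          (simp add: line_int_def)
    qed
    moreover have "integral {-L..L} k = (\<Sum>b\<in>Basis. \<Sum>c\<in>Basis. \<xi> b \<bullet> (line_int L e (G2 b c) z *v \<xi> c))
       + 2 * (\<Sum>b\<in>Basis. \<xi> b \<bullet> line_int L e (H1 b) z) + line_int L e K z"
    proof -
      have bl: "bounded_linear (\<lambda>A::real^'b^'b. y \<bullet> (A *v x))" for x y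
        by (rule bounded_linear_compose[OF bounded_linear_inner_right
           bounded_bilinear.bounded_linear_left[OF bounded_bilinear_matrix_vector]])
      have 1: "(\<lambda>t. y \<bullet> (G2 b c (z + t *\<^sub>R e) *v x)) integrable_on {-L..L}"
        "integral {-L..L} (\<lambda>t. y \<bullet> (G2 b c (z + t *\<^sub>R e) *v x)) = y \<bullet> (line_int L e (G2 b c) z *v x)"
        if "b \<in> Basis" "c \<in> Basis" for b c x y
        using integrable_linear[OF line_integrable[OF cG2[OF that]] bl]
          integral_linear[OF line_integrable[OF cG2[OF that]] bl] by (simp_all add: o_def line_int_def)
      have 2: "(\<lambda>t. y \<bullet> H1 b (z + t *\<^sub>R e)) integrable_on {-L..L}"
        "integral {-L..L} (\<lambda>t. y \<bullet> H1 b (z + t *\<^sub>R e)) = y \<bullet> line_int L e (H1 b) z"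
        if "b \<in> Basis" for b y
        using integrable_linear[OF line_integrable[OF cH1[OF that]] bounded_linear_inner_right]
          integral_linear[OF line_integrable[OF cH1[OF that]] bounded_linear_inner_right] by (simp_all add: o_def line_int_def)
      show ?thesis
        unfolding k_def
        by (simp add: integral_add integral_sum integrable_sum integrable_add 1 2 line_integrable[OF cK])
          (simp add: line_int_def)
    qed
    ultimately show "0 \<le> ((\<Sum>b\<in>Basis. line_int L e (G1 b) z *v \<xi> b) + line_int L e H z) \<bullet>
         (matrix_inv (line_int L e G z) *v ((\<Sum>b\<in>Basis. line_int L e (G1 b) z *v \<xi> b) + line_int L e H z))
       - (\<Sum>b\<in>Basis. \<Sum>c\<in>Basis. \<xi> b \<bullet> (line_int L e (G2 b c) z *v \<xi> c))
       - 2 * (\<Sum>b\<in>Basis. \<xi> b \<bullet> line_int L e (H1 b) z) - line_int L e K z"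
      by (simp add: line_int_def)
  next
    fix b c :: 'a and z :: 'a
    assume "b \<in> Basis" "c \<in> Basis"
    then have "G2 b c = G2 c b" by (intro ext comm2)
    then show "line_int L e (G2 b c) z = line_int L e (G2 c b) z" by simp
  qed (auto intro!: line_int_derivative dG dG1 dH continuous_on_line_int cG cG1 cG2 cH cH1 cK
      transpose_line_int sym1 sym2)
qed

section \<open>Iterated integration over a cube\<close>

text \<open>Only the coordinates in \<open>S\<close> are integrated, starting from the base point
  \<open>z\<close>. The product measure indexed by \<open>S\<close> admits induction on
  \<open>S\<close> by Fubini, and for \<open>S = Basis\<close> it turns into Lebesgue
  measure.\<close>

definition box_int :: "real \<Rightarrow> 'a set \<Rightarrow> ('a::euclidean_space \<Rightarrow> 'b::euclidean_space) \<Rightarrow> 'a \<Rightarrow> 'b" where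
  "box_int L S f z = (\<integral>x. (\<Prod>b\<in>S. indicator {-L..L} (x b)) *\<^sub>R f (z + (\<Sum>b\<in>S. x b *\<^sub>R b)) \<partial>(\<Pi>\<^sub>M b\<in>S. lborel))"

lemma box_int_integrable:
  fixes f :: "'a::euclidean_space \<Rightarrow> 'b::euclidean_space"
  assumes f: "continuous_on UNIV f" and S: "finite S" "S \<subseteq> Basis"
  shows "integrable (\<Pi>\<^sub>M b\<in>S. lborel) (\<lambda>x. (\<Prod>b\<in>S. indicator {-L..L} (x b)) *\<^sub>R f (z + (\<Sum>b\<in>S. x b *\<^sub>R b)))"
proof -
  interpret product_sigma_finite "\<lambda>b::'a. lborel :: real measure" by standard
  have fm: "f \<in> borel_measurable borel" using f by (rule borel_measurable_continuous_onI)
  define R where "R = real (card S) * \<bar>L\<bar>"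
  have "bounded (f ` cball z R)"
    by (intro compact_imp_bounded compact_continuous_image continuous_on_subset[OF f]) auto
  then obtain B where "\<forall>u\<in>f ` cball z R. norm u \<le> B" unfolding bounded_iff by blast
  then have B: "\<And>y. y \<in> cball z R \<Longrightarrow> norm (f y) \<le> B" by blast
  have "integrable (\<Pi>\<^sub>M b\<in>S. lborel) (\<lambda>x. (\<Prod>b\<in>S. indicator {-L..L} (x b)) * B)"
    using S by (intro integrable_mult_left product_integrable_prod integrable_real_indicator)
      (auto simp: emeasure_lborel_Icc_eq)
  then show ?thesis
  proof (rule Bochner_Integration.integrable_bound)
    show "(\<lambda>x. (\<Prod>b\<in>S. indicator {-L..L} (x b)) *\<^sub>R f (z + (\<Sum>b\<in>S. x b *\<^sub>R b))) \<in> borel_measurable (\<Pi>\<^sub>M b\<in>S. lborel)"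
      by (intro borel_measurable_scaleR borel_measurable_prod measurable_compose[OF _ fm]) measurable
    show "AE x in \<Pi>\<^sub>M b\<in>S. lborel. norm ((\<Prod>b\<in>S. indicator {-L..L} (x b)) *\<^sub>R f (z + (\<Sum>b\<in>S. x b *\<^sub>R b)))
      \<le> norm ((\<Prod>b\<in>S. indicator {-L..L} (x b)) * B)"
    proof (intro AE_I2)
      fix x :: "'a \<Rightarrow> real"
      show "norm ((\<Prod>b\<in>S. indicator {-L..L} (x b)) *\<^sub>R f (z + (\<Sum>b\<in>S. x b *\<^sub>R b)))
        \<le> norm ((\<Prod>b\<in>S. indicator {-L..L} (x b)) * B)"
      proof (cases "\<forall>b\<in>S. x b \<in> {-L..L}")
        case True
        have "norm (\<Sum>b\<in>S. x b *\<^sub>R b) \<le> (\<Sum>b\<in>S. \<bar>L\<bar>)"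
          using True by (intro sum_norm_le) (auto simp: norm_Basis[OF subsetD[OF S(2)]])
        then have "norm (f (z + (\<Sum>b\<in>S. x b *\<^sub>R b))) \<le> B"
          by (intro B) (simp add: R_def dist_norm)
        then show ?thesis using True by simp
      next
        case False
        then have "(\<Prod>b\<in>S. indicator {-L..L} (x b)) = (0::real)" using S by (auto simp: prod_zero_iff indicator_def)
        then show ?thesis by simp
      qed
    qed
  qed
qed

lemma line_int_lborel:
  fixes f :: "'a::euclidean_space \<Rightarrow> 'b::euclidean_space"
  assumes f: "continuous_on UNIV f"
  shows "(\<integral>t. indicator {-L..L} t *\<^sub>R f (z + t *\<^sub>R b) \<partial>lborel) = line_int L b f z"
proof -
  have "set_integrable lborel {-L..L} (\<lambda>t. f (z + t *\<^sub>R b))"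
    unfolding set_integrable_def by (intro borel_integrable_compact continuous_on_line f) auto
  from set_borel_integral_eq_integral(2)[OF this] show ?thesis
    by (simp add: set_lebesgue_integral_def line_int_def)
qed

lemma box_int_insert:
  fixes f :: "'a::euclidean_space \<Rightarrow> 'b::euclidean_space"
  assumes f: "continuous_on UNIV f" and S: "finite S" "e \<notin> S" "insert e S \<subseteq> Basis"
  shows "box_int L (insert e S) f z = box_int L S (line_int L e f) z"
proof -
  interpret product_sigma_finite "\<lambda>b::'a. lborel :: real measure" by standard
  have "box_int L (insert e S) f z = (\<integral>x. \<integral>y. (\<Prod>b\<in>insert e S. indicator {-L..L} ((x(e := y)) b)) *\<^sub>R
     f (z + (\<Sum>b\<in>insert e S. (x(e := y)) b *\<^sub>R b)) \<partial>lborel \<partial>(\<Pi>\<^sub>M b\<in>S. lborel))"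
    unfolding box_int_def by (rule product_integral_insert[OF S(1,2) box_int_integrable[OF f]]) (use S in auto)
  also have "\<dots> = (\<integral>x. (\<Prod>b\<in>S. indicator {-L..L} (x b)) *\<^sub>R line_int L e f (z + (\<Sum>b\<in>S. x b *\<^sub>R b)) \<partial>(\<Pi>\<^sub>M b\<in>S. lborel))"
  proof (intro Bochner_Integration.integral_cong refl)
    fix x :: "'a \<Rightarrow> real"
    have 1: "(\<Prod>b\<in>insert e S. indicator {-L..L} ((x(e := y)) b)) =
        indicator {-L..L} y * (\<Prod>b\<in>S. indicator {-L..L} (x b) :: real)" for y
      using S by (subst prod.insert) (auto intro!: arg_cong2[where f="(*)"] prod.cong)
    have "(\<Sum>b\<in>S. (x(e := y)) b *\<^sub>R b) = (\<Sum>b\<in>S. x b *\<^sub>R b)" for y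
      using S by (intro sum.cong) auto
    then have 2: "z + (\<Sum>b\<in>insert e S. (x(e := y)) b *\<^sub>R b) = (z + (\<Sum>b\<in>S. x b *\<^sub>R b)) + y *\<^sub>R e" for y
      using S by simp
    have "(\<integral>y. (\<Prod>b\<in>insert e S. indicator {-L..L} ((x(e := y)) b)) *\<^sub>R
     f (z + (\<Sum>b\<in>insert e S. (x(e := y)) b *\<^sub>R b)) \<partial>lborel) =
      (\<integral>y. (\<Prod>b\<in>S. indicator {-L..L} (x b)) *\<^sub>R (indicator {-L..L} y *\<^sub>R f ((z + (\<Sum>b\<in>S. x b *\<^sub>R b)) + y *\<^sub>R e)) \<partial>lborel)"
      unfolding 1 2 by (simp add: mult.commute)
    also have "\<dots> = (\<Prod>b\<in>S. indicator {-L..L} (x b)) *\<^sub>R line_int L e f (z + (\<Sum>b\<in>S. x b *\<^sub>R b))"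
      by (simp only: integral_scaleR_right line_int_lborel[OF f])
    finally show "(\<integral>y. (\<Prod>b\<in>insert e S. indicator {-L..L} ((x(e := y)) b)) *\<^sub>R
     f (z + (\<Sum>b\<in>insert e S. (x(e := y)) b *\<^sub>R b)) \<partial>lborel) =
      (\<Prod>b\<in>S. indicator {-L..L} (x b)) *\<^sub>R line_int L e f (z + (\<Sum>b\<in>S. x b *\<^sub>R b))" .
  qed
  finally show ?thesis by (simp add: box_int_def)
qed

lemma box_int_empty [simp]: "box_int L {} f z = f z"
  by (simp add: box_int_def PiM_empty lebesgue_integral_count_space_finite)

text \<open>Every step replaces all the functions by their line integrals, hence they are arbitrary
  in the induction. When no coordinate is left, \<open>curv\<close> is read off at the zero
  family.\<close>

lemma nakano_box_int:
  assumes "nakano G G1 G2 H H1 K" "L > 0" "finite S" "S \<subseteq> Basis"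
  shows "0 \<le> box_int L S H z \<bullet> (matrix_inv (box_int L S G z) *v box_int L S H z) - box_int L S K z"
  using assms(3,4,1)
proof (induction S arbitrary: G G1 G2 H H1 K rule: finite_induct)
  case empty
  from nakano.curv[OF empty.prems(2), of z "\<lambda>_. 0"] show ?case by simp
next
  case (insert e S)
  interpret nakano G G1 G2 H H1 K by fact
  note 1 = box_int_insert[OF _ insert.hyps insert.prems(1)]
  show ?case
    unfolding 1[OF cG] 1[OF cH] 1[OF cK]
    using insert.IH[OF _ nakano_line_int[OF insert.prems(2) \<open>L > 0\<close>, of e]] insert.prems by auto
qed

lemma box_int_Basis:
  fixes f :: "'a::euclidean_space \<Rightarrow> 'b::euclidean_space"
  assumes f: "continuous_on UNIV f"
  shows "box_int L Basis f 0 = (\<integral>z. indicator {z. \<forall>b\<in>Basis. \<bar>z \<bullet> b\<bar> \<le> L} z *\<^sub>R f z \<partial>lborel)"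
proof -
  have fm: "f \<in> borel_measurable borel" using f by (rule borel_measurable_continuous_onI)
  have cl: "{z::'a. \<forall>b\<in>Basis. \<bar>z \<bullet> b\<bar> \<le> L} \<in> sets borel"
    by measurable
  have "(\<integral>z. indicator {z. \<forall>b\<in>Basis. \<bar>z \<bullet> b\<bar> \<le> L} z *\<^sub>R f z \<partial>lborel) =
    (\<integral>x. indicator {z. \<forall>b\<in>Basis. \<bar>z \<bullet> b\<bar> \<le> L} (\<Sum>b\<in>Basis. x b *\<^sub>R b) *\<^sub>R f (\<Sum>b\<in>Basis. x b *\<^sub>R b) \<partial>(\<Pi>\<^sub>M b\<in>Basis. lborel))"
    by (subst lborel_eq, subst integral_distr) (use fm cl in auto)
  also have "\<dots> = box_int L Basis f 0"
    unfolding box_int_def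
  proof (intro Bochner_Integration.integral_cong refl)
    fix x :: "'a \<Rightarrow> real"
    have sb: "(\<Sum>b\<in>Basis. x b *\<^sub>R b) \<bullet> c = x c" if "c \<in> Basis" for c
      using that by (simp add: inner_sum_left inner_Basis if_distrib cong: if_cong)
    then have "indicator {z. \<forall>b\<in>Basis. \<bar>z \<bullet> b\<bar> \<le> L} (\<Sum>b\<in>Basis. x b *\<^sub>R b) = (\<Prod>b\<in>Basis. indicator {-L..L} (x b) :: real)"
    proof (cases "\<forall>b\<in>Basis. \<bar>x b\<bar> \<le> L")
      case True
      then have "(\<Prod>b\<in>Basis. indicator {-L..L} (x b) :: real) = 1"
        by (intro prod.neutral) (auto simp: abs_le_iff)
      moreover have "indicator {z. \<forall>b\<in>Basis. \<bar>z \<bullet> b\<bar> \<le> L} (\<Sum>b\<in>Basis. x b *\<^sub>R b) = (1::real)"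
        using True sb by simp
      ultimately show ?thesis by simp
    next
      case False
      then obtain d where d: "d \<in> Basis" "\<not> \<bar>x d\<bar> \<le> L" by blast
      then have "x d \<notin> {-L..L}" by auto
      with d have "(\<Prod>b\<in>Basis. indicator {-L..L} (x b) :: real) = 0"
        by (intro prod_zero bexI[of _ d]) auto
      moreover have "indicator {z. \<forall>b\<in>Basis. \<bar>z \<bullet> b\<bar> \<le> L} (\<Sum>b\<in>Basis. x b *\<^sub>R b) = (0::real)"
        using False sb by auto
      ultimately show ?thesis by simp
    qed
    then show "indicator {z. \<forall>b\<in>Basis. \<bar>z \<bullet> b\<bar> \<le> L} (\<Sum>b\<in>Basis. x b *\<^sub>R b) *\<^sub>R f (\<Sum>b\<in>Basis. x b *\<^sub>R b) =
       (\<Prod>b\<in>Basis. indicator {-L..L} (x b)) *\<^sub>R f (0 + (\<Sum>b\<in>Basis. x b *\<^sub>R b))" by simp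
  qed
  finally show ?thesis ..
qed

section \<open>Weights of the form \<open>exp l * s\<inverse>\<close>\<close>

text \<open>\<open>curv\<close> is Nakano positivity of the weight after the substitution \<xi> b =
  s (y b) and division by \<open>exp l\<close>. Its left-hand side is the margin that a standard
  Gaussian factor supplies; the last term on the right, with \<open>b\<close> and \<open>c\<close>
  exchanged, is the one that comes from differentiating the inverse.\<close>

locale smooth_weight =
  fixes s :: "'a::euclidean_space \<Rightarrow> real^'m^'m" and s1 :: "'a \<Rightarrow> 'a \<Rightarrow> real^'m^'m"
    and s2 :: "'a \<Rightarrow> 'a \<Rightarrow> 'a \<Rightarrow> real^'m^'m" and l :: "'a \<Rightarrow> real" and l1 :: "'a \<Rightarrow> 'a \<Rightarrow> real"
    and l2 :: "'a \<Rightarrow> 'a \<Rightarrow> 'a \<Rightarrow> real"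
  assumes pd: "\<And>z. posdef (s z)"
    and ds: "\<And>b z. b \<in> Basis \<Longrightarrow> ((\<lambda>t. s (z + t *\<^sub>R b)) has_vector_derivative s1 b z) (at 0)"
    and ds1: "\<And>b c z. b \<in> Basis \<Longrightarrow> c \<in> Basis \<Longrightarrow>
        ((\<lambda>t. s1 b (z + t *\<^sub>R c)) has_vector_derivative s2 b c z) (at 0)"
    and dl: "\<And>b z. b \<in> Basis \<Longrightarrow> ((\<lambda>t. l (z + t *\<^sub>R b)) has_real_derivative l1 b z) (at 0)"
    and dl1: "\<And>b c z. b \<in> Basis \<Longrightarrow> c \<in> Basis \<Longrightarrow>
        ((\<lambda>t. l1 b (z + t *\<^sub>R c)) has_real_derivative l2 b c z) (at 0)"
    and sym1: "\<And>b z. b \<in> Basis \<Longrightarrow> transpose (s1 b z) = s1 b z"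
    and sym2: "\<And>b c z. b \<in> Basis \<Longrightarrow> c \<in> Basis \<Longrightarrow> transpose (s2 b c z) = s2 b c z"
    and comm2: "\<And>b c z. b \<in> Basis \<Longrightarrow> c \<in> Basis \<Longrightarrow> s2 b c z = s2 c b z"
    and comml2: "\<And>b c z. b \<in> Basis \<Longrightarrow> c \<in> Basis \<Longrightarrow> l2 b c z = l2 c b z"
    and cs: "continuous_on UNIV s" and cs1: "\<And>b. b \<in> Basis \<Longrightarrow> continuous_on UNIV (s1 b)"
    and cs2: "\<And>b c. b \<in> Basis \<Longrightarrow> c \<in> Basis \<Longrightarrow> continuous_on UNIV (s2 b c)"
    and cl: "continuous_on UNIV l" and cl1: "\<And>b. b \<in> Basis \<Longrightarrow> continuous_on UNIV (l1 b)"
    and cl2: "\<And>b c. b \<in> Basis \<Longrightarrow> c \<in> Basis \<Longrightarrow> continuous_on UNIV (l2 b c)"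
    and curv: "\<And>z y. (\<Sum>b\<in>Basis. y b \<bullet> (s z *v y b)) \<le>
      (\<Sum>b\<in>Basis. \<Sum>c\<in>Basis. - l2 b c z * (y b \<bullet> (s z *v y c)) + y b \<bullet> (s2 b c z *v y c)
        - (s1 c z *v y b) \<bullet> (matrix_inv (s z) *v (s1 b z *v y c)))"
begin

definition "X z = matrix_inv (s z)"
definition "W z = exp (l z) *\<^sub>R X z"
text \<open>\<open>V1\<close> and \<open>V2\<close> are the first and second partial derivatives of
  \<open>W\<close>, divided by \<open>exp l\<close>.\<close>

definition "V1 b z = l1 b z *\<^sub>R X z - X z ** s1 b z ** X z"
definition "V2 b c z = (l1 b z * l1 c z + l2 b c z) *\<^sub>R X z - l1 b z *\<^sub>R (X z ** s1 c z ** X z)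
  - l1 c z *\<^sub>R (X z ** s1 b z ** X z) + X z ** s1 c z ** X z ** s1 b z ** X z
  + X z ** s1 b z ** X z ** s1 c z ** X z - X z ** s2 b c z ** X z"

lemma X_sym: "transpose (X z) = X z"
  using posdef_inv[OF pd] by (simp add: X_def posdef_def)

lemma X_vec: "s z *v (X z *v x) = x" "X z *v (s z *v x) = x"
  by (simp_all add: X_def posdef_inv_vec[OF pd])

lemma cX: "continuous_on UNIV X"
  unfolding X_def by (intro continuous_intros cs posdef_invertible pd)

lemma W_posdef: "posdef (W z)"
  using posdef_inv[OF pd, of z] X_sym[of z]
  by (auto simp: posdef_def W_def X_def transpose_scalar scaleR_matrix_vector_assoc[symmetric])

lemma W_inv: "matrix_inv (W z) = exp (- l z) *\<^sub>R s z"
proof (rule matrix_inv_unique)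
  show "W z ** (exp (- l z) *\<^sub>R s z) = mat 1"
    by (simp add: matrix_eq W_def X_vec matrix_vector_mul_assoc[symmetric] scaleR_matrix_vector_assoc[symmetric]
        matrix_vector_mult_scaleR exp_minus)
qed

lemma dX: "b \<in> Basis \<Longrightarrow> ((\<lambda>t. X (z + t *\<^sub>R b)) has_vector_derivative - (X z ** s1 b z ** X z)) (at 0)"
  unfolding X_def
  using has_vector_derivative_matrix_inv[OF ds posdef_invertible[OF pd]] by simp

interpretation mm: bounded_bilinear "\<lambda>(A::real^'m^'m) (B::real^'m^'m). A ** B"
  by (rule bounded_bilinear_matrix_matrix)

interpretation tr: bounded_linear "transpose :: real^'m^'m \<Rightarrow> real^'m^'m"
  by (rule bounded_linear_transpose)

lemmas dmm = bounded_bilinear.has_vector_derivative[OF bounded_bilinear_matrix_matrix]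

lemma dW:
  assumes b: "b \<in> Basis"
  shows "((\<lambda>t. W (z + t *\<^sub>R b)) has_vector_derivative exp (l z) *\<^sub>R V1 b z) (at 0)"
proof -
  have "((\<lambda>t. exp (l (z + t *\<^sub>R b))) has_real_derivative exp (l z) * l1 b z) (at 0)"
    using DERIV_fun_exp[OF dl[OF b, of z]] by simp
  from has_vector_derivative_scaleR[OF this dX[OF b, of z]]
  show ?thesis by (simp add: W_def V1_def algebra_simps)
qed

lemma dV1:
  assumes b: "b \<in> Basis" and c: "c \<in> Basis"
  shows "((\<lambda>t. exp (l (z + t *\<^sub>R c)) *\<^sub>R V1 b (z + t *\<^sub>R c)) has_vector_derivative exp (l z) *\<^sub>R V2 b c z) (at 0)"
proof -
  have e: "((\<lambda>t. exp (l (z + t *\<^sub>R c))) has_real_derivative exp (l z) * l1 c z) (at 0)"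
    using DERIV_fun_exp[OF dl[OF c, of z]] by simp
  have "((\<lambda>t. V1 b (z + t *\<^sub>R c)) has_vector_derivative
      (l1 b z *\<^sub>R (- (X z ** s1 c z ** X z)) + l2 b c z *\<^sub>R X z)
      - ((X z ** s1 b z) ** (- (X z ** s1 c z ** X z)) +
          (X z ** s2 b c z + (- (X z ** s1 c z ** X z)) ** s1 b z) ** X z)) (at 0)"
    unfolding V1_def
    using has_vector_derivative_diff[OF has_vector_derivative_scaleR[OF dl1[OF b c, of z] dX[OF c, of z]]
        dmm[OF dmm[OF dX[OF c, of z] ds1[OF b c, of z]] dX[OF c, of z]]] by simp
  from has_vector_derivative_scaleR[OF e this]
  have "((\<lambda>t. exp (l (z + t *\<^sub>R c)) *\<^sub>R V1 b (z + t *\<^sub>R c)) has_vector_derivative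
     exp (l z) *\<^sub>R ((l1 b z *\<^sub>R (- (X z ** s1 c z ** X z)) + l2 b c z *\<^sub>R X z)
      - ((X z ** s1 b z) ** (- (X z ** s1 c z ** X z)) +
          (X z ** s2 b c z + (- (X z ** s1 c z ** X z)) ** s1 b z) ** X z)) +
      (exp (l z) * l1 c z) *\<^sub>R V1 b z) (at 0)" by simp
  also have "exp (l z) *\<^sub>R ((l1 b z *\<^sub>R (- (X z ** s1 c z ** X z)) + l2 b c z *\<^sub>R X z)
      - ((X z ** s1 b z) ** (- (X z ** s1 c z ** X z)) +
          (X z ** s2 b c z + (- (X z ** s1 c z ** X z)) ** s1 b z) ** X z)) +
      (exp (l z) * l1 c z) *\<^sub>R V1 b z = exp (l z) *\<^sub>R V2 b c z"
    by (simp add: V1_def V2_def mm.minus_left mm.minus_right mm.add_left mm.diff_left matrix_mul_assoc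
        scaleR_add_left scaleR_add_right scaleR_diff_right mult.commute mult.left_commute)
  finally show ?thesis .
qed

lemma inner_X: "x \<bullet> (X z *v y) = (X z *v x) \<bullet> y"
  by (metis inner_matrix_sym[OF X_sym] inner_commute)

lemma inner_s1: "b \<in> Basis \<Longrightarrow> x \<bullet> (s1 b z *v y) = (s1 b z *v x) \<bullet> y"
  by (metis inner_matrix_sym[OF sym1] inner_commute)

text \<open>In the variables \<open>y\<close>, the first derivative applied to \<xi> b is
  \<open>X\<close> applied to \<open>q b = l1 b \<xi> b - s1 b (y b)\<close>. When the quadratic
  form in the \<open>q b\<close> is expanded and \<open>V2\<close> subtracted, all terms with
  \<open>l1\<close> cancel, and so does one of the two products of first derivatives of
  \<open>s\<close>. The second derivatives and the exchanged product remain, which is the right-hand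
  side of \<open>curv\<close>.\<close>

lemma W_curv:
  "(\<Sum>b\<in>Basis. \<xi> b \<bullet> (W z *v \<xi> b)) \<le> (\<Sum>b\<in>Basis. (exp (l z) *\<^sub>R V1 b z) *v \<xi> b) \<bullet>
     (matrix_inv (W z) *v (\<Sum>b\<in>Basis. (exp (l z) *\<^sub>R V1 b z) *v \<xi> b))
    - (\<Sum>b\<in>Basis. \<Sum>c\<in>Basis. \<xi> b \<bullet> ((exp (l z) *\<^sub>R V2 b c z) *v \<xi> c))"
proof -
  define y where "y b = X z *v \<xi> b" for b
  have \<xi>: "\<xi> b = s z *v y b" for b by (simp add: y_def X_vec)
  define q where "q b = l1 b z *\<^sub>R \<xi> b - s1 b z *v y b" for b
  have V1q: "V1 b z *v \<xi> b = X z *v q b" for b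
    by (simp add: V1_def q_def y_def matrix_vector_mul_assoc[symmetric] algebra_simps scaleR_matrix_vector_assoc[symmetric])
  have "(\<Sum>b\<in>Basis. (exp (l z) *\<^sub>R V1 b z) *v \<xi> b) = exp (l z) *\<^sub>R (X z *v (\<Sum>b\<in>Basis. q b))"
    by (simp add: scaleR_matrix_vector_assoc[symmetric] V1q scaleR_sum_right linear_sum[OF matrix_vector_mul_linear])
  then have "(\<Sum>b\<in>Basis. (exp (l z) *\<^sub>R V1 b z) *v \<xi> b) \<bullet> (matrix_inv (W z) *v (\<Sum>b\<in>Basis. (exp (l z) *\<^sub>R V1 b z) *v \<xi> b))
     = exp (l z) * ((X z *v (\<Sum>b\<in>Basis. q b)) \<bullet> (\<Sum>c\<in>Basis. q c))"
    by (simp add: W_inv X_vec scaleR_matrix_vector_assoc[symmetric] matrix_vector_mult_scaleR exp_minus)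
  also have "\<dots> = exp (l z) * (\<Sum>b\<in>Basis. \<Sum>c\<in>Basis. (X z *v q b) \<bullet> q c)"
    by (subst sum.swap) (simp add: linear_sum[OF matrix_vector_mul_linear] inner_sum_left inner_sum_right)
  finally have 1: "(\<Sum>b\<in>Basis. (exp (l z) *\<^sub>R V1 b z) *v \<xi> b) \<bullet> (matrix_inv (W z) *v (\<Sum>b\<in>Basis. (exp (l z) *\<^sub>R V1 b z) *v \<xi> b))
     - (\<Sum>b\<in>Basis. \<Sum>c\<in>Basis. \<xi> b \<bullet> ((exp (l z) *\<^sub>R V2 b c z) *v \<xi> c)) =
     exp (l z) * (\<Sum>b\<in>Basis. \<Sum>c\<in>Basis. (X z *v q b) \<bullet> q c - \<xi> b \<bullet> (V2 b c z *v \<xi> c))"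
    by (simp add: scaleR_matrix_vector_assoc[symmetric] sum_distrib_left sum_subtractf right_diff_distrib)
  have "(X z *v q b) \<bullet> q c - \<xi> b \<bullet> (V2 b c z *v \<xi> c) =
     - l2 b c z * (y b \<bullet> (s z *v y c)) + y b \<bullet> (s2 b c z *v y c)
        - (s1 c z *v y b) \<bullet> (X z *v (s1 b z *v y c))" if b: "b \<in> Basis" and c: "c \<in> Basis" for b c
  proof -
    have "(X z *v q b) \<bullet> q c = l1 b z * l1 c z * (y b \<bullet> \<xi> c) - l1 b z * (y b \<bullet> (s1 c z *v y c))
       - l1 c z * ((s1 b z *v y b) \<bullet> y c) + (s1 b z *v y b) \<bullet> (X z *v (s1 c z *v y c))"
    proof -
      have "X z *v \<xi> b = y b" by (simp add: y_def)
      then have "X z *v q b = l1 b z *\<^sub>R y b - X z *v (s1 b z *v y b)"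
        by (simp add: q_def matrix_vector_mult_diff_distrib matrix_vector_mult_scaleR)
      moreover have "(X z *v (s1 b z *v y b)) \<bullet> \<xi> c = (s1 b z *v y b) \<bullet> y c"
        "(X z *v (s1 b z *v y b)) \<bullet> (s1 c z *v y c) = (s1 b z *v y b) \<bullet> (X z *v (s1 c z *v y c))"
        by (simp_all add: y_def inner_X)
      ultimately have "(X z *v q b) \<bullet> \<xi> c = l1 b z * (y b \<bullet> \<xi> c) - (s1 b z *v y b) \<bullet> y c"
        "(X z *v q b) \<bullet> (s1 c z *v y c) = l1 b z * (y b \<bullet> (s1 c z *v y c))
          - (s1 b z *v y b) \<bullet> (X z *v (s1 c z *v y c))"
        by (simp_all only: inner_diff_left inner_scaleR_left)
      then show ?thesis
        by (simp add: q_def[of c] inner_diff_right right_diff_distrib mult.left_commute)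
    qed
    moreover have "\<xi> b \<bullet> (V2 b c z *v \<xi> c) = (l1 b z * l1 c z + l2 b c z) * (y b \<bullet> \<xi> c) - l1 b z * (y b \<bullet> (s1 c z *v y c))
       - l1 c z * ((s1 b z *v y b) \<bullet> y c) + (s1 c z *v y b) \<bullet> (X z *v (s1 b z *v y c))
       + (s1 b z *v y b) \<bullet> (X z *v (s1 c z *v y c)) - y b \<bullet> (s2 b c z *v y c)"
    proof -
      have "V2 b c z *v \<xi> c = (l1 b z * l1 c z + l2 b c z) *\<^sub>R y c - l1 b z *\<^sub>R (X z *v (s1 c z *v y c))
        - l1 c z *\<^sub>R (X z *v (s1 b z *v y c)) + X z *v (s1 c z *v (X z *v (s1 b z *v y c)))
        + X z *v (s1 b z *v (X z *v (s1 c z *v y c))) - X z *v (s2 b c z *v y c)"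
        by (simp only: V2_def matrix_vector_mul_assoc[symmetric] scaleR_matrix_vector_assoc[symmetric]
          matrix_vector_mult_add_rdistrib matrix_vector_mult_diff_rdistrib y_def)
      moreover have "\<xi> b \<bullet> (X z *v u) = y b \<bullet> u" for u by (simp add: y_def inner_X)
      moreover have "\<xi> b \<bullet> y c = y b \<bullet> \<xi> c" by (simp add: y_def inner_X)
      moreover have "y b \<bullet> (s1 b z *v u) = (s1 b z *v y b) \<bullet> u" "y b \<bullet> (s1 c z *v u) = (s1 c z *v y b) \<bullet> u" for u
        by (rule inner_s1[OF b]) (rule inner_s1[OF c])
      ultimately show ?thesis
        by (simp add: inner_add_right inner_diff_right)
    qed
    ultimately show ?thesis by (simp add: \<xi>[of c] algebra_simps)
  qed
  then have "(\<Sum>b\<in>Basis. \<Sum>c\<in>Basis. (X z *v q b) \<bullet> q c - \<xi> b \<bullet> (V2 b c z *v \<xi> c)) =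
     (\<Sum>b\<in>Basis. \<Sum>c\<in>Basis. - l2 b c z * (y b \<bullet> (s z *v y c)) + y b \<bullet> (s2 b c z *v y c)
        - (s1 c z *v y b) \<bullet> (X z *v (s1 b z *v y c)))"
    by (intro sum.cong refl) simp
  also have "\<dots> \<ge> (\<Sum>b\<in>Basis. y b \<bullet> (s z *v y b))"
    unfolding X_def by (rule curv)
  finally have "(\<Sum>b\<in>Basis. y b \<bullet> (s z *v y b)) \<le> (\<Sum>b\<in>Basis. \<Sum>c\<in>Basis. (X z *v q b) \<bullet> q c - \<xi> b \<bullet> (V2 b c z *v \<xi> c))" .
  moreover have "(\<Sum>b\<in>Basis. \<xi> b \<bullet> (W z *v \<xi> b)) = exp (l z) * (\<Sum>b\<in>Basis. y b \<bullet> (s z *v y b))"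
    by (simp add: W_def scaleR_matrix_vector_assoc[symmetric] sum_distrib_left y_def X_vec inner_commute)
  ultimately show ?thesis unfolding 1 by simp
qed

text \<open>The curvature excess \<open>\<Sum>b. \<xi> b \<bullet> W (\<xi> b)\<close>, due to the Gaussian factor, completes the square with \<open>x\<close>.\<close>

lemma nakano_affine:
  fixes x :: "'a \<Rightarrow> real^'m"
  defines "c \<equiv> \<lambda>z. \<Sum>b\<in>Basis. (z \<bullet> b) *\<^sub>R x b"
  shows "nakano W (\<lambda>b z. exp (l z) *\<^sub>R V1 b z) (\<lambda>b d z. exp (l z) *\<^sub>R V2 b d z)
    (\<lambda>z. W z *v c z) (\<lambda>b z. W z *v x b + (exp (l z) *\<^sub>R V1 b z) *v c z)
    (\<lambda>z. c z \<bullet> (W z *v c z) - (\<Sum>b\<in>Basis. x b \<bullet> (W z *v x b)))"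
proof
  have cc: "continuous_on UNIV c" unfolding c_def by (intro continuous_intros)
  have cW: "continuous_on UNIV W" unfolding W_def by (intro continuous_intros cX cl)
  have cV1: "continuous_on UNIV (\<lambda>z. exp (l z) *\<^sub>R V1 b z)" if "b \<in> Basis" for b
    unfolding V1_def by (intro continuous_intros cX cl cl1 cs1 that)
  show "continuous_on UNIV W" by (rule cW)
  show "continuous_on UNIV (\<lambda>z. exp (l z) *\<^sub>R V1 b z)" if "b \<in> Basis" for b by (rule cV1[OF that])
  show "continuous_on UNIV (\<lambda>z. exp (l z) *\<^sub>R V2 b d z)" if "b \<in> Basis" "d \<in> Basis" for b d
    unfolding V2_def by (intro continuous_intros cX cl cl1 cl2 cs1 cs2 that)
  show "continuous_on UNIV (\<lambda>z. W z *v c z)" by (intro continuous_intros cW cc)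
  show "continuous_on UNIV (\<lambda>z. W z *v x b + (exp (l z) *\<^sub>R V1 b z) *v c z)" if "b \<in> Basis" for b
    by (intro continuous_intros cW cc cV1 that)
  show "continuous_on UNIV (\<lambda>z. c z \<bullet> (W z *v c z) - (\<Sum>b\<in>Basis. x b \<bullet> (W z *v x b)))"
    by (intro continuous_intros cW cc)
  show "posdef (W z)" for z by (rule W_posdef)
  show "((\<lambda>t. W (z + t *\<^sub>R b)) has_vector_derivative exp (l z) *\<^sub>R V1 b z) (at 0)" if "b \<in> Basis" for b z
    by (rule dW[OF that])
  show "((\<lambda>t. exp (l (z + t *\<^sub>R d)) *\<^sub>R V1 b (z + t *\<^sub>R d)) has_vector_derivative exp (l z) *\<^sub>R V2 b d z) (at 0)"
    if "b \<in> Basis" "d \<in> Basis" for b d z by (rule dV1[OF that])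
  have cb: "c (z + t *\<^sub>R b) = c z + t *\<^sub>R x b" if "b \<in> Basis" for b z t
  proof -
    have "(\<Sum>d\<in>Basis. (t * (b \<bullet> d)) *\<^sub>R x d) = (\<Sum>d\<in>Basis. if d = b then t *\<^sub>R x b else 0)"
      by (intro sum.cong refl) (auto simp: inner_Basis that)
    then show ?thesis using that
      by (simp add: c_def inner_add_left scaleR_add_left sum.distrib)
  qed
  have dc: "((\<lambda>t. c (z + t *\<^sub>R b)) has_vector_derivative x b) (at 0)" if "b \<in> Basis" for b z
    unfolding cb[OF that] by (auto intro!: derivative_eq_intros)
  show "((\<lambda>t. W (z + t *\<^sub>R b) *v c (z + t *\<^sub>R b)) has_vector_derivative
      W z *v x b + (exp (l z) *\<^sub>R V1 b z) *v c z) (at 0)" if "b \<in> Basis" for b z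
    using bounded_bilinear.has_vector_derivative[OF bounded_bilinear_matrix_vector dW[OF that, of z] dc[OF that, of z]] by simp
  show S1: "transpose (exp (l z) *\<^sub>R V1 b z) = exp (l z) *\<^sub>R V1 b z" if "b \<in> Basis" for b z
    using sym1[OF that, of z]
    by (simp add: V1_def tr.scaleR tr.diff matrix_transpose_mul X_sym matrix_mul_assoc)
  show "transpose (exp (l z) *\<^sub>R V2 b d z) = exp (l z) *\<^sub>R V2 b d z" if b: "b \<in> Basis" and d: "d \<in> Basis" for b d z
    using sym1[OF b, of z] sym1[OF d, of z] sym2[OF b d, of z]
    by (simp add: V2_def tr.scaleR tr.diff tr.add matrix_transpose_mul X_sym matrix_mul_assoc algebra_simps)
  show "exp (l z) *\<^sub>R V2 b d z = exp (l z) *\<^sub>R V2 d b z" if b: "b \<in> Basis" and d: "d \<in> Basis" for b d z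
    using comm2[OF that, of z] comml2[OF that, of z] by (simp add: V2_def algebra_simps)
  fix z :: 'a and \<xi> :: "'a \<Rightarrow> real^'m"
  define w where "w = (\<Sum>b\<in>Basis. (exp (l z) *\<^sub>R V1 b z) *v \<xi> b)"
  note iW = posdef_inv_vec[OF W_posdef, of z]
  have "(\<Sum>b\<in>Basis. \<xi> b \<bullet> ((exp (l z) *\<^sub>R V1 b z) *v c z)) = c z \<bullet> w"
    unfolding w_def inner_sum_right by (intro sum.cong refl) (simp only: inner_matrix_sym[OF S1])
  then have h: "(\<Sum>b\<in>Basis. \<xi> b \<bullet> (W z *v x b + (exp (l z) *\<^sub>R V1 b z) *v c z)) =
     (\<Sum>b\<in>Basis. \<xi> b \<bullet> (W z *v x b)) + c z \<bullet> w"
    by (simp add: inner_add_right sum.distrib)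
  have g: "(w + W z *v c z) \<bullet> (matrix_inv (W z) *v (w + W z *v c z)) =
     w \<bullet> (matrix_inv (W z) *v w) + 2 * (c z \<bullet> w) + c z \<bullet> (W z *v c z)"
    using posdef_sym[OF posdef_inv[OF W_posdef], of "W z *v c z" z w]
    by (simp add: matrix_vector_right_distrib inner_add iW inner_commute)
  have "0 \<le> (\<Sum>b\<in>Basis. (\<xi> b - x b) \<bullet> (W z *v (\<xi> b - x b)))"
    by (intro sum_nonneg posdef_nonneg W_posdef)
  also have "\<dots> = (\<Sum>b\<in>Basis. \<xi> b \<bullet> (W z *v \<xi> b)) - 2 * (\<Sum>b\<in>Basis. \<xi> b \<bullet> (W z *v x b)) + (\<Sum>b\<in>Basis. x b \<bullet> (W z *v x b))"
    using posdef_sym[OF W_posdef, of "x _" z "\<xi> _"]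
    by (simp add: matrix_vector_mult_diff_distrib inner_diff sum.distrib sum_subtractf sum_distrib_left algebra_simps)
  finally have f: "0 \<le> \<dots>" .
  show "0 \<le> ((\<Sum>b\<in>Basis. (exp (l z) *\<^sub>R V1 b z) *v \<xi> b) + W z *v c z) \<bullet>
        (matrix_inv (W z) *v ((\<Sum>b\<in>Basis. (exp (l z) *\<^sub>R V1 b z) *v \<xi> b) + W z *v c z))
      - (\<Sum>b\<in>Basis. \<Sum>d\<in>Basis. \<xi> b \<bullet> ((exp (l z) *\<^sub>R V2 b d z) *v \<xi> d))
      - 2 * (\<Sum>b\<in>Basis. \<xi> b \<bullet> (W z *v x b + (exp (l z) *\<^sub>R V1 b z) *v c z))
      - (c z \<bullet> (W z *v c z) - (\<Sum>b\<in>Basis. x b \<bullet> (W z *v x b)))"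
  proof -
    have "0 \<le> a1 + 2 * a2 + a3 - a4 - 2 * (a5 + a2) - (a3 - a6)"
      if "a7 \<le> a1 - a4" "0 \<le> a7 - 2 * a5 + a6" for a1 a2 a3 a4 a5 a6 a7 :: real
      using that by (simp add: algebra_simps)
    from this[OF W_curv[of \<xi> z, folded w_def] f] show ?thesis unfolding h w_def[symmetric] g .
  qed
qed

end

section \<open>Smooth approximation of the truncated determinant weight\<close>

text \<open>On the segment from the identity to \<open>A\<close> every matrix is positive definite,
  hence invertible, so the determinant cannot change sign there.\<close>

lemma posdef_det_pos:
  fixes A :: "real^'m^'m"
  assumes A: "posdef A"
  shows "0 < det A"
proof (rule ccontr)
  assume n: "\<not> 0 < det A"
  define f where "f t = det ((1 - t) *\<^sub>R mat 1 + t *\<^sub>R A)" for t :: real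
  have "\<exists>t\<ge>0. t \<le> 1 \<and> f t = 0"
  proof (rule IVT2')
    show "f 1 \<le> 0" "0 \<le> f 0" using n by (simp_all add: f_def)
    show "continuous_on {0..1} f" unfolding f_def by (intro continuous_intros)
  qed auto
  then obtain t where t: "0 \<le> t" "t \<le> 1" "f t = 0" by auto
  have "posdef ((1 - t) *\<^sub>R mat 1 + t *\<^sub>R A)"
    unfolding posdef_def
  proof (intro conjI allI impI)
    show "transpose ((1 - t) *\<^sub>R mat 1 + t *\<^sub>R A) = (1 - t) *\<^sub>R mat 1 + t *\<^sub>R A"
      using A bounded_linear_transpose[where 'm='m and 'k='m]
      by (simp add: posdef_def linear_simps transpose_scalar)
    fix x :: "real^'m" assume x: "x \<noteq> 0"
    have "x \<bullet> (((1 - t) *\<^sub>R mat 1 + t *\<^sub>R A) *v x) = (1 - t) * (x \<bullet> x) + t * (x \<bullet> (A *v x))"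
      by (simp add: matrix_vector_mult_add_rdistrib scaleR_matrix_vector_assoc[symmetric] inner_add_right)
    also have "\<dots> > 0"
    proof (cases "t = 0")
      case False
      then have "0 < t * (x \<bullet> (A *v x))" using A x t by (simp add: posdef_def)
      then show ?thesis using t by (simp add: add_nonneg_pos)
    qed (use x in simp)
    finally show "0 < x \<bullet> (((1 - t) *\<^sub>R mat 1 + t *\<^sub>R A) *v x)" .
  qed
  then show False using t(3) posdef_invertible invertible_det_nz by (auto simp: f_def)
qed

section \<open>Curvature terms as Gram matrices\<close>

text \<open>Schur's product theorem in coordinates: the entries of the entrywise product of two Gram
  matrices add up to a sum of squares.\<close>

lemma sum_products_square:
  fixes f :: "'i \<Rightarrow> 'j \<Rightarrow> real" and g :: "'i \<Rightarrow> 'k \<Rightarrow> real"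
  shows "(\<Sum>b\<in>I. \<Sum>c\<in>I. (\<Sum>p\<in>P. f b p * f c p) * (\<Sum>r\<in>R. g b r * g c r)) =
    (\<Sum>p\<in>P. \<Sum>r\<in>R. (\<Sum>b\<in>I. f b p * g b r)\<^sup>2)"
proof -
  have "(\<Sum>p\<in>P. \<Sum>r\<in>R. (\<Sum>b\<in>I. f b p * g b r)\<^sup>2) =
     (\<Sum>p\<in>P. \<Sum>r\<in>R. \<Sum>b\<in>I. \<Sum>c\<in>I. (f b p * f c p) * (g b r * g c r))"
    by (simp add: power2_eq_square sum_product mult_ac)
  also have "\<dots> = (\<Sum>p\<in>P. \<Sum>b\<in>I. \<Sum>r\<in>R. \<Sum>c\<in>I. (f b p * f c p) * (g b r * g c r))"
    by (intro sum.cong refl sum.swap)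
  also have "\<dots> = (\<Sum>b\<in>I. \<Sum>p\<in>P. \<Sum>r\<in>R. \<Sum>c\<in>I. (f b p * f c p) * (g b r * g c r))"
    by (rule sum.swap)
  also have "\<dots> = (\<Sum>b\<in>I. \<Sum>p\<in>P. \<Sum>c\<in>I. \<Sum>r\<in>R. (f b p * f c p) * (g b r * g c r))"
    by (intro sum.cong refl sum.swap)
  also have "\<dots> = (\<Sum>b\<in>I. \<Sum>c\<in>I. \<Sum>p\<in>P. \<Sum>r\<in>R. (f b p * f c p) * (g b r * g c r))"
    by (intro sum.cong refl sum.swap)
  also have "\<dots> = (\<Sum>b\<in>I. \<Sum>c\<in>I. (\<Sum>p\<in>P. f b p * f c p) * (\<Sum>r\<in>R. g b r * g c r))"
    by (simp add: sum_product)
  finally show ?thesis ..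
qed

lemma trace_sum_squares:
  fixes X A :: "real^'m^'m" and v :: "real^'m \<Rightarrow> real^'m"
  assumes v: "\<And>x y. x \<bullet> (X *v y) = (\<Sum>k\<in>Basis. (v k \<bullet> x) * (v k \<bullet> y))"
  shows "trace (X ** A) = (\<Sum>k\<in>Basis. v k \<bullet> (A *v v k))"
proof -
  have e: "(\<Sum>i\<in>UNIV. (w \<bullet> axis i 1) *\<^sub>R axis i 1) = w" for w :: "real^'m"
    unfolding inner_axis by (simp add: vec_eq_iff axis_def sum.delta if_distrib cong: if_cong)
  have "trace (X ** A) = (\<Sum>i\<in>UNIV. axis i 1 \<bullet> (X *v (A *v axis i 1)))"
    unfolding matrix_vector_mul_assoc by (simp add: trace_def matrix_vector_mult_basis inner_axis' column_def)
  also have "\<dots> = (\<Sum>k\<in>Basis. \<Sum>i\<in>UNIV. (v k \<bullet> axis i 1) * (v k \<bullet> (A *v axis i 1)))"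
    by (simp only: v) (rule sum.swap)
  also have "\<dots> = (\<Sum>k\<in>Basis. v k \<bullet> (A *v (\<Sum>i\<in>UNIV. (v k \<bullet> axis i 1) *\<^sub>R axis i 1)))"
    by (simp add: linear_sum[OF matrix_vector_mul_linear] inner_sum_right matrix_vector_mult_scaleR)
  finally show ?thesis by (simp add: e)
qed

text \<open>If \<open>X\<close> is the sum of the rank one matrices of the \<open>v k\<close>, the
  numbers v k . (A v l) serve as Hilbert-Schmidt coordinates of \<open>A\<close> relative to
  \<open>X\<close>. The trace is the inner product in these coordinates, so it forms a Gram matrix
  when \<open>A\<close> and \<open>B\<close> run through a family.\<close>

lemma trace_sandwich:
  fixes X A B :: "real^'m^'m" and v :: "real^'m \<Rightarrow> real^'m"
  assumes v: "\<And>x y. x \<bullet> (X *v y) = (\<Sum>k\<in>Basis. (v k \<bullet> x) * (v k \<bullet> y))" and A: "transpose A = A"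
  shows "trace (X ** A ** X ** B) = (\<Sum>p\<in>Basis\<times>Basis. (v (fst p) \<bullet> (A *v v (snd p))) * (v (fst p) \<bullet> (B *v v (snd p))))"
proof -
  have "trace (X ** A ** X ** B) = (\<Sum>l\<in>Basis. v l \<bullet> (A *v (X *v (B *v v l))))"
    using trace_sum_squares[OF v, of "A ** X ** B"] by (simp add: matrix_mul_assoc matrix_vector_mul_assoc)
  also have "\<dots> = (\<Sum>l\<in>Basis. (A *v v l) \<bullet> (X *v (B *v v l)))"
    by (intro sum.cong refl) (metis inner_matrix_sym[OF A] inner_commute)
  also have "\<dots> = (\<Sum>k\<in>Basis. \<Sum>l\<in>Basis. (v k \<bullet> (A *v v l)) * (v k \<bullet> (B *v v l)))"
    by (simp only: v) (rule sum.swap)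
  finally show ?thesis by (simp add: sum.cartesian_product split_beta)
qed

text \<open>The trace is the part of minus the Hessian of a log determinant that stems from first
  derivatives. Both it and the form of \<open>s\<close> are Gram matrices in \<open>b\<close> and
  \<open>c\<close>, and Schur's product theorem applies. The sizes of \<open>X\<close> and
  \<open>s\<close> may differ, as determinants of both blocks enter the weight.\<close>

lemma trace_gram_nonneg:
  fixes X :: "real^'k^'k" and s :: "real^'m^'m" and B :: "'i \<Rightarrow> real^'k^'k" and y :: "'i \<Rightarrow> real^'m"
  assumes "posdef X" "posdef s" "\<And>b. b \<in> I \<Longrightarrow> transpose (B b) = B b"
  shows "0 \<le> (\<Sum>b\<in>I. \<Sum>c\<in>I. trace (X ** B c ** X ** B b) * (y b \<bullet> (s *v y c)))"
proof -
  obtain v :: "real^'k \<Rightarrow> real^'k" where v: "\<And>x y. x \<bullet> (X *v y) = (\<Sum>k\<in>Basis. (v k \<bullet> x) * (v k \<bullet> y))"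
    using psd_matrix_sum_squares[OF posdef_nonneg[OF assms(1)]] assms(1) unfolding posdef_def by blast
  obtain u :: "real^'m \<Rightarrow> real^'m" where u: "\<And>x y. x \<bullet> (s *v y) = (\<Sum>k\<in>Basis. (u k \<bullet> x) * (u k \<bullet> y))"
    using psd_matrix_sum_squares[OF posdef_nonneg[OF assms(2)]] assms(2) unfolding posdef_def by blast
  have "(\<Sum>b\<in>I. \<Sum>c\<in>I. trace (X ** B c ** X ** B b) * (y b \<bullet> (s *v y c))) =
    (\<Sum>b\<in>I. \<Sum>c\<in>I. (\<Sum>p\<in>Basis\<times>Basis. (v (fst p) \<bullet> (B b *v v (snd p))) * (v (fst p) \<bullet> (B c *v v (snd p)))) *
       (\<Sum>r\<in>Basis. (u r \<bullet> y b) * (u r \<bullet> y c)))"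
    by (intro sum.cong refl) (simp add: trace_sandwich[OF v assms(3)] u mult.commute)
  also have "\<dots> \<ge> 0"
    unfolding sum_products_square by (intro sum_nonneg) simp
  finally show ?thesis .
qed

text \<open>With \<open>T k l r\<close> the coordinates of \<open>\<Sum>b. B b \<otimes> y b\<close>, the two sides are \<open>\<Sum> T k l r * T k r l\<close> and \<open>\<Sum> (T k l r)\<^sup>2\<close>.\<close>

lemma trace_swap_le:
  fixes s :: "real^'m^'m" and B :: "'i \<Rightarrow> real^'m^'m" and y :: "'i \<Rightarrow> real^'m"
  assumes s: "posdef s" and B: "\<And>b. b \<in> I \<Longrightarrow> transpose (B b) = B b"
  defines "X \<equiv> matrix_inv s"
  shows "(\<Sum>b\<in>I. \<Sum>c\<in>I. (B c *v y b) \<bullet> (X *v (B b *v y c))) \<le>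
     (\<Sum>b\<in>I. \<Sum>c\<in>I. trace (X ** B c ** X ** B b) * (y b \<bullet> (s *v y c)))"
proof -
  have X: "posdef X" unfolding X_def by (rule posdef_inv[OF s])
  obtain v :: "real^'m \<Rightarrow> real^'m" where v: "\<And>x y. x \<bullet> (X *v y) = (\<Sum>k\<in>Basis. (v k \<bullet> x) * (v k \<bullet> y))"
    using psd_matrix_sum_squares[OF posdef_nonneg[OF X]] X unfolding posdef_def by blast
  define g where "g b r = v r \<bullet> (s *v y b)" for b r
  define f where "f b k l = v k \<bullet> (B b *v v l)" for b k l
  define T where "T k l r = (\<Sum>b\<in>I. f b k l * g b r)" for k l r
  have pair: "(\<Sum>p\<in>Basis\<times>Basis. h (fst p) (snd p)) = (\<Sum>k\<in>Basis. \<Sum>l\<in>Basis. h k l)"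
    for h :: "real^'m \<Rightarrow> real^'m \<Rightarrow> real" by (simp add: sum.cartesian_product split_beta)
  have yX: "y b = X *v (s *v y b)" for b by (simp add: X_def posdef_inv_vec[OF s])
  have 1: "y b \<bullet> (s *v y c) = (\<Sum>r\<in>Basis. g b r * g c r)" for b c
    by (subst yX[of b]) (simp add: g_def v inner_commute[of "X *v _"] mult.commute)
  have "(\<Sum>b\<in>I. \<Sum>c\<in>I. trace (X ** B c ** X ** B b) * (y b \<bullet> (s *v y c))) =
    (\<Sum>b\<in>I. \<Sum>c\<in>I. (\<Sum>p\<in>Basis\<times>Basis. f b (fst p) (snd p) * f c (fst p) (snd p)) * (\<Sum>r\<in>Basis. g b r * g c r))"
    by (intro sum.cong refl) (simp add: trace_sandwich[OF v B] 1 f_def mult.commute)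
  also have "\<dots> = (\<Sum>k\<in>Basis. \<Sum>l\<in>Basis. \<Sum>r\<in>Basis. (T k l r)\<^sup>2)"
    unfolding sum_products_square using pair[of "\<lambda>k l. \<Sum>r\<in>Basis. (T k l r)\<^sup>2"] by (simp only: T_def)
  finally have R: "(\<Sum>b\<in>I. \<Sum>c\<in>I. trace (X ** B c ** X ** B b) * (y b \<bullet> (s *v y c))) =
     (\<Sum>k\<in>Basis. \<Sum>l\<in>Basis. \<Sum>r\<in>Basis. (T k l r)\<^sup>2)" .
  have 2: "v k \<bullet> (B c *v y b) = (\<Sum>l\<in>Basis. f c k l * g b l)" if c: "c \<in> I" for b c k
  proof -
    have "v k \<bullet> (B c *v y b) = (B c *v v k) \<bullet> (X *v (s *v y b))"
      using inner_matrix_sym[OF B[OF c], of "v k" "y b"] yX[of b] by (simp add: inner_commute)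
    also have "\<dots> = (\<Sum>l\<in>Basis. (v l \<bullet> (B c *v v k)) * g b l)" by (simp add: v g_def)
    also have "\<dots> = (\<Sum>l\<in>Basis. f c k l * g b l)"
      by (intro sum.cong refl) (simp add: f_def inner_matrix_sym[OF B[OF c], of "v k"])
    finally show ?thesis .
  qed
  have "(\<Sum>b\<in>I. \<Sum>c\<in>I. (B c *v y b) \<bullet> (X *v (B b *v y c))) =
     (\<Sum>b\<in>I. \<Sum>c\<in>I. \<Sum>k\<in>Basis. \<Sum>l\<in>Basis. \<Sum>r\<in>Basis. (f c k l * g c r) * (f b k r * g b l))"
    by (intro sum.cong refl) (simp add: v 2 sum_product mult_ac)
  also have "\<dots> = (\<Sum>k\<in>Basis. \<Sum>b\<in>I. \<Sum>c\<in>I. \<Sum>l\<in>Basis. \<Sum>r\<in>Basis. (f c k l * g c r) * (f b k r * g b l))"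
    by (simp only: sum.swap[where A=I and B=Basis])
  also have "\<dots> = (\<Sum>k\<in>Basis. \<Sum>l\<in>Basis. \<Sum>r\<in>Basis. \<Sum>b\<in>I. \<Sum>c\<in>I. (f c k l * g c r) * (f b k r * g b l))"
    by (simp only: sum.swap[where A=I and B=Basis])
  also have "\<dots> = (\<Sum>k\<in>Basis. \<Sum>l\<in>Basis. \<Sum>r\<in>Basis. T k l r * T k r l)"
    by (simp add: T_def sum_product mult.commute)
  \<comment> \<open>The arithmetic-geometric mean inequality; the two squares have equal sums, since
    \<open>l\<close> and \<open>r\<close> range over the same basis.\<close>
  also have "\<dots> \<le> (\<Sum>k\<in>Basis. \<Sum>l\<in>Basis. \<Sum>r\<in>Basis. ((T k l r)\<^sup>2 + (T k r l)\<^sup>2) / 2)"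
  proof (intro sum_mono)
    fix k l r
    show "T k l r * T k r l \<le> ((T k l r)\<^sup>2 + (T k r l)\<^sup>2) / 2"
      using sum_squares_bound[of "T k l r" "T k r l"] by simp
  qed
  also have "\<dots> = (\<Sum>k\<in>Basis. \<Sum>l\<in>Basis. \<Sum>r\<in>Basis. (T k l r)\<^sup>2)"
  proof (rule sum.cong[OF refl])
    fix k
    have "(\<Sum>l\<in>Basis. \<Sum>r\<in>Basis. (T k r l)\<^sup>2) = (\<Sum>l\<in>Basis. \<Sum>r\<in>Basis. (T k l r)\<^sup>2)"
      by (rule sum.swap)
    then show "(\<Sum>l\<in>Basis. \<Sum>r\<in>Basis. ((T k l r)\<^sup>2 + (T k r l)\<^sup>2) / 2) = (\<Sum>l\<in>Basis. \<Sum>r\<in>Basis. (T k l r)\<^sup>2)"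
      by (simp add: sum.distrib sum_divide_distrib[symmetric])
  qed
  finally show ?thesis unfolding R .
qed

section \<open>The penalty and the penalised determinants\<close>

text \<open>The exponent is even and at least 2, so that the Hessian carries the even power
  \<open>2*N\<close> and the penalty is convex. \<open>penal1\<close> and \<open>penal2\<close> are
  its directional derivatives.\<close>

definition penal :: "'a::euclidean_space set \<Rightarrow> nat \<Rightarrow> 'a \<Rightarrow> real" where
  "penal F N z = (\<Sum>f\<in>F. (z \<bullet> f) ^ (2*N+2))"
definition penal1 :: "'a::euclidean_space set \<Rightarrow> nat \<Rightarrow> 'a \<Rightarrow> 'a \<Rightarrow> real" where
  "penal1 F N b z = (\<Sum>f\<in>F. real (2*N+2) * (z \<bullet> f) ^ (2*N+1) * (b \<bullet> f))"
definition penal2 :: "'a::euclidean_space set \<Rightarrow> nat \<Rightarrow> 'a \<Rightarrow> 'a \<Rightarrow> 'a \<Rightarrow> real" where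
  "penal2 F N b c z = (\<Sum>f\<in>F. real (2*N+2) * (real (2*N+1) * (z \<bullet> f) ^ (2*N)) * (b \<bullet> f) * (c \<bullet> f))"

lemma penal_nonneg: "0 \<le> penal F N z"
  unfolding penal_def by (intro sum_nonneg) (intro zero_le_even_power, simp)

lemma penal_ge: "finite F \<Longrightarrow> f \<in> F \<Longrightarrow> \<bar>z \<bullet> f\<bar> ^ (2*N+2) \<le> penal F N z"
  unfolding penal_def
  using member_le_sum[of f F "\<lambda>f. (z \<bullet> f) ^ (2*N+2)"]
  by (simp add: power_even_abs zero_le_even_power del: power_Suc)

lemma DERIV_line_power:
  "((\<lambda>t. ((z + t *\<^sub>R b) \<bullet> f) ^ Suc n) has_real_derivative (1 + real n) * ((b \<bullet> f) * (z \<bullet> f) ^ n)) (at 0)"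
proof -
  have "((\<lambda>t. (z + t *\<^sub>R b) \<bullet> f) has_real_derivative b \<bullet> f) (at 0)"
    by (auto simp: inner_add_left intro!: derivative_eq_intros)
  from DERIV_power_Suc[OF this, of n] show ?thesis by simp
qed

lemma d_penal: "((\<lambda>t. penal F N (z + t *\<^sub>R b)) has_real_derivative penal1 F N b z) (at 0)"
  unfolding penal_def penal1_def
proof (intro DERIV_sum)
  fix f
  show "((\<lambda>t. ((z + t *\<^sub>R b) \<bullet> f) ^ (2*N+2)) has_real_derivative
      real (2*N+2) * (z \<bullet> f) ^ (2*N+1) * (b \<bullet> f)) (at 0)"
    using DERIV_line_power[of z b f "2*N+1"] by (simp add: mult_ac del: power_Suc)
qed

lemma d_penal1: "((\<lambda>t. penal1 F N b (z + t *\<^sub>R c)) has_real_derivative penal2 F N b c z) (at 0)"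
  unfolding penal1_def penal2_def
proof (intro DERIV_sum)
  fix f
  show "((\<lambda>t. real (2*N+2) * ((z + t *\<^sub>R c) \<bullet> f) ^ (2*N+1) * (b \<bullet> f)) has_real_derivative
      real (2*N+2) * (real (2*N+1) * (z \<bullet> f) ^ (2*N)) * (b \<bullet> f) * (c \<bullet> f)) (at 0)"
    using DERIV_cmult[OF DERIV_line_power[of z c f "2*N"], of "real (2*N+2) * (b \<bullet> f)"]
    by (simp add: mult_ac del: power_Suc)
qed

lemma continuous_penal [continuous_intros]:
  "continuous_on S (penal F N)" "continuous_on S (penal1 F N b)" "continuous_on S (penal2 F N b c)"
  unfolding penal_def penal1_def penal2_def by (intro continuous_intros)+

lemma penal2_comm: "penal2 F N b c z = penal2 F N c b z"
  by (simp add: penal2_def mult_ac)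

text \<open>The Hessian is a nonnegative combination of squares of the functionals in
  \<open>F\<close>, and each of them contracts the \<open>y b\<close> to the single vector
  \<open>Y f\<close>.\<close>

lemma penal2_convex:
  fixes A :: "real^'m^'m"
  assumes "\<And>x. 0 \<le> x \<bullet> (A *v x)"
  shows "0 \<le> (\<Sum>b\<in>Basis. \<Sum>c\<in>Basis. penal2 F N b c z * (y b \<bullet> (A *v y c)))"
proof -
  define w where "w f = real (2*N+2) * (real (2*N+1) * (z \<bullet> f) ^ (2*N))" for f
  define Y where "Y f = (\<Sum>b\<in>Basis. (b \<bullet> f) *\<^sub>R y b)" for f
  have "(\<Sum>b\<in>Basis. \<Sum>c\<in>Basis. penal2 F N b c z * (y b \<bullet> (A *v y c))) =
     (\<Sum>b\<in>Basis. \<Sum>c\<in>Basis. \<Sum>f\<in>F. w f * (((b \<bullet> f) *\<^sub>R y b) \<bullet> (A *v ((c \<bullet> f) *\<^sub>R y c))))"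
    by (intro sum.cong refl, simp only: penal2_def w_def sum_distrib_right matrix_vector_mult_scaleR)
      (simp add: mult_ac)
  also have "\<dots> = (\<Sum>f\<in>F. \<Sum>b\<in>Basis. \<Sum>c\<in>Basis. w f * (((b \<bullet> f) *\<^sub>R y b) \<bullet> (A *v ((c \<bullet> f) *\<^sub>R y c))))"
    by (simp only: sum.swap[where B=F])
  also have "\<dots> = (\<Sum>f\<in>F. w f * (Y f \<bullet> (A *v Y f)))"
    by (intro sum.cong refl)
      (simp only: Y_def linear_sum[OF matrix_vector_mul_linear] inner_sum_left inner_sum_right sum_distrib_left, rule sum.swap)
  also have "\<dots> \<ge> 0"
    using assms by (intro sum_nonneg mult_nonneg_nonneg) (auto simp: w_def)
  finally show ?thesis .
qed

text \<open>The tangent of \<open>t ^ n\<close> at 1, divided by \<open>n = 2*N+2\<close>. The gap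
  bounds the spectrum of the penalised matrix away from 0 on the whole space.\<close>

lemma bernoulli_gap:
  fixes t :: real
  assumes "0 \<le> t"
  shows "1 / real (2*N+2) \<le> 1 - t + t ^ (2*N+2)"
proof -
  define n where "n = real (2*N+2)"
  have n: "1 \<le> n" by (simp add: n_def)
  have "1 + n * (t - 1) \<le> t ^ (2*N+2)"
    using Bernoulli_inequality[of "t - 1" "2*N+2"] assms by (simp add: n_def algebra_simps del: power_Suc)
  then have "(1 + n * (t - 1)) / n \<le> t ^ (2*N+2) / n" using n by (intro divide_right_mono) auto
  also have "\<dots> \<le> t ^ (2*N+2)" using n assms by (simp add: divide_le_eq mult_le_cancel_left1 del: power_Suc)
  finally have "(1 + n * (t - 1)) / n \<le> t ^ (2*N+2)" .
  moreover have "(1 + n * (t - 1)) / n = 1 / n + t - 1" using n by (simp add: field_simps)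
  ultimately show ?thesis unfolding n_def by linarith
qed

text \<open>The functionals in \<open>F\<close> dominate the norm of \<open>C\<close>, so that adding their high even powers makes \<open>mat 1 + C\<close>
  positive definite on the whole space and changes it little where the norm of \<open>C\<close> is below \<open>1\<close>.\<close>

locale penalized =
  fixes F :: "'a::euclidean_space set" and N :: nat and C :: "'a \<Rightarrow> real^'m^'m"
  assumes finF: "finite F" and linC: "linear C" and symC: "\<And>z. transpose (C z) = C z"
    and dom: "\<And>z. \<exists>f\<in>F. \<forall>x. norm (C z *v x) \<le> \<bar>z \<bullet> f\<bar> * norm x"
begin

definition "S z = (1 + penal F N z) *\<^sub>R mat 1 + C z"
definition "S1 b z = penal1 F N b z *\<^sub>R mat 1 + C b"
definition "S2 b c z = penal2 F N b c z *\<^sub>R (mat 1 :: real^'m^'m)"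
definition "X z = matrix_inv (S z)"
text \<open>\<open>p1\<close> and \<open>p2\<close> are the first and second derivatives of the log
  determinant \<open>p\<close>, by Jacobi's formula. The penalty contributes to \<open>p2\<close>
  the term with \<open>trace (X z)\<close>, which is convex and must be compensated in the
  weight.\<close>

definition "p z = ln (det (S z))"
definition "p1 b z = trace (X z ** S1 b z)"
definition "p2 b c z = penal2 F N b c z * trace (X z) - trace (X z ** S1 c z ** X z ** S1 b z)"

lemma inner_S: "x \<bullet> (S z *v y) = (1 + penal F N z) * (x \<bullet> y) + x \<bullet> (C z *v y)"
  by (simp add: S_def matrix_vector_mult_add_rdistrib scaleR_matrix_vector_assoc[symmetric] inner_add_right)

text \<open>The functional of \<open>F\<close> that dominates \<open>C z\<close> bounds it below by
  minus its modulus; its own power in the penalty restores positivity through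
  \<open>bernoulli_gap\<close>.\<close>

lemma S_ge: "(1 / real (2*N+2)) * (x \<bullet> x) \<le> x \<bullet> (S z *v x)"
proof -
  obtain f where f: "f \<in> F" and n: "\<And>x. norm (C z *v x) \<le> \<bar>z \<bullet> f\<bar> * norm x" using dom[of z] by blast
  have "- (x \<bullet> (C z *v x)) \<le> norm x * norm (C z *v x)"
    using Cauchy_Schwarz_ineq2[of x "C z *v x"] by linarith
  also have "\<dots> \<le> norm x * (\<bar>z \<bullet> f\<bar> * norm x)" by (intro mult_left_mono n) auto
  finally have 1: "- (\<bar>z \<bullet> f\<bar> * (x \<bullet> x)) \<le> x \<bullet> (C z *v x)"
    by (simp add: dot_square_norm power2_eq_square mult_ac)
  have "1 / real (2*N+2) \<le> 1 - \<bar>z \<bullet> f\<bar> + penal F N z"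
    using bernoulli_gap[of "\<bar>z \<bullet> f\<bar>" N] penal_ge[OF finF f, of z N] by linarith
  then have "(1 / real (2*N+2)) * (x \<bullet> x) \<le> (1 - \<bar>z \<bullet> f\<bar> + penal F N z) * (x \<bullet> x)"
    by (intro mult_right_mono) auto
  with 1 show ?thesis by (simp add: inner_S algebra_simps)
qed

lemma pd: "posdef (S z)"
  unfolding posdef_def
proof (intro conjI allI impI)
  show "transpose (S z) = S z"
    by (rule symmetric_matrixI) (simp add: inner_S inner_matrix_sym[OF symC, of _ z] inner_commute)
  show "0 < x \<bullet> (S z *v x)" if "x \<noteq> 0" for x
  proof -
    have "0 < (1 / real (2*N+2)) * (x \<bullet> x)" using that by simp
    with S_ge[of x z] show ?thesis by linarith
  qed
qed

lemma blC: "bounded_linear C" using linC by (rule linear_conv_bounded_linear[THEN iffD1])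

lemma dS: "((\<lambda>t. S (z + t *\<^sub>R b)) has_vector_derivative S1 b z) (at 0)"
proof -
  have "((\<lambda>t. (1 + penal F N (z + t *\<^sub>R b)) *\<^sub>R (mat 1 :: real^'m^'m) + (C z + t *\<^sub>R C b)) has_vector_derivative
      ((1 + penal F N (z + 0 *\<^sub>R b)) *\<^sub>R 0 + (0 + penal1 F N b z) *\<^sub>R mat 1) + (0 + (0 *\<^sub>R 0 + 1 *\<^sub>R C b))) (at 0)"
    by (intro has_vector_derivative_add has_vector_derivative_scaleR DERIV_add d_penal DERIV_const
        has_vector_derivative_const DERIV_ident has_vector_derivative_scaleR)
  then show ?thesis
    by (simp add: S_def[abs_def] S1_def linear_add[OF linC] linear_scale[OF linC])
qed

lemma dS1: "((\<lambda>t. S1 b (z + t *\<^sub>R c)) has_vector_derivative S2 b c z) (at 0)"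
proof -
  have "((\<lambda>t. penal1 F N b (z + t *\<^sub>R c) *\<^sub>R (mat 1 :: real^'m^'m) + C b) has_vector_derivative
      (penal1 F N b (z + 0 *\<^sub>R c) *\<^sub>R 0 + penal2 F N b c z *\<^sub>R mat 1) + 0) (at 0)"
    by (intro has_vector_derivative_add has_vector_derivative_scaleR d_penal1 has_vector_derivative_const)
  then show ?thesis by (simp add: S1_def[abs_def] S2_def)
qed

lemma sym1: "transpose (S1 b z) = S1 b z"
  using bounded_linear_transpose[where 'm='m and 'k='m]
  by (simp add: S1_def linear_simps symC transpose_scalar)

lemma sym2: "transpose (S2 b c z) = S2 b c z"
  by (simp add: S2_def transpose_scalar)

lemma cS: "continuous_on UNIV S"
  unfolding S_def by (intro continuous_intros linear_continuous_on blC)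
lemma cS1: "continuous_on UNIV (S1 b)"
  unfolding S1_def by (intro continuous_intros)
lemma cS2: "continuous_on UNIV (S2 b c)"
  unfolding S2_def by (intro continuous_intros)
lemma cX: "continuous_on UNIV X"
  unfolding X_def by (intro continuous_intros cS posdef_invertible pd)

lemma dX: "((\<lambda>t. X (z + t *\<^sub>R b)) has_vector_derivative - (X z ** S1 b z ** X z)) (at 0)"
  unfolding X_def
  using has_vector_derivative_matrix_inv[OF dS posdef_invertible[OF pd]] by simp

lemma dp: "((\<lambda>t. p (z + t *\<^sub>R b)) has_real_derivative p1 b z) (at 0)"
proof -
  have d: "0 < det (S z)" by (rule posdef_det_pos[OF pd])
  have "((\<lambda>t. det (S (z + t *\<^sub>R b))) has_real_derivative det (S z) * p1 b z) (at 0)"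
    using has_real_derivative_det[OF dS[of z b]] posdef_invertible[OF pd, of z] by (simp add: p1_def X_def)
  from DERIV_chain2[OF DERIV_ln_divide, of "\<lambda>t. det (S (z + t *\<^sub>R b))" 0, OF _ this] d
  show ?thesis by (simp add: p_def[abs_def])
qed

lemma dp1: "((\<lambda>t. p1 b (z + t *\<^sub>R c)) has_real_derivative p2 b c z) (at 0)"
proof -
  have "((\<lambda>t. X (z + t *\<^sub>R c) ** S1 b (z + t *\<^sub>R c)) has_vector_derivative
      X z ** S2 b c z + (- (X z ** S1 c z ** X z)) ** S1 b z) (at 0)"
    using bounded_bilinear.has_vector_derivative[OF bounded_bilinear_matrix_matrix dX[of z c] dS1[of b z c]] by simp
  from bounded_linear.has_vector_derivative[OF bounded_linear_trace this]
  have "((\<lambda>t. p1 b (z + t *\<^sub>R c)) has_real_derivative trace (X z ** S2 b c z + (- (X z ** S1 c z ** X z)) ** S1 b z)) (at 0)"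
    by (simp add: p1_def has_real_derivative_iff_has_vector_derivative)
  also have "trace (X z ** S2 b c z + (- (X z ** S1 c z ** X z)) ** S1 b z) = p2 b c z"
    by (simp add: p2_def S2_def linear_simps[OF bounded_linear_trace] matrix_mul_assoc
      bounded_bilinear.minus_left[OF bounded_bilinear_matrix_matrix]
      bounded_bilinear.scaleR_right[OF bounded_bilinear_matrix_matrix])
  finally show ?thesis .
qed

lemma cp: "continuous_on UNIV p"
  unfolding p_def using posdef_det_pos[OF pd] by (intro continuous_intros cS) (auto simp: less_imp_neq[symmetric])
lemma cp1: "continuous_on UNIV (p1 b)"
  unfolding p1_def by (intro continuous_intros cS1 cX)
lemma cp2: "continuous_on UNIV (p2 b c)"
  unfolding p2_def by (intro continuous_intros cS1 cX)

lemma p2_comm: "p2 b c z = p2 c b z"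
  using trace_mul_sym[of "X z ** S1 c z" "X z ** S1 b z"]
  by (simp add: p2_def penal2_comm[of F N b] matrix_mul_assoc)

text \<open>\<open>S_ge\<close> bounds the inverse. The bound is linear in the exponent and uniform
  in \<open>z\<close>, so that a constant multiple of the penalty can compensate the convex term in
  \<open>p2\<close>.\<close>

lemma trace_X: "trace (X z) \<le> real (2*N+2) * real CARD('m)"
proof -
  define n where "n = real (2*N+2)"
  have n: "0 < n" by (simp add: n_def)
  have q: "x \<bullet> (X z *v x) \<le> n" if x: "norm x = 1" for x
  proof -
    let ?y = "X z *v x"
    have Sy: "S z *v ?y = x" by (simp add: X_def posdef_inv_vec[OF pd])
    have le: "x \<bullet> ?y \<le> norm ?y" using norm_cauchy_schwarz[of x ?y] x by simp
    have "(1 / n) * (norm ?y)\<^sup>2 \<le> ?y \<bullet> x"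
      using S_ge[of ?y z] unfolding Sy n_def[symmetric] by (simp add: dot_square_norm)
    then have "norm ?y * norm ?y \<le> n * (x \<bullet> ?y)" using n by (simp add: inner_commute field_simps power2_eq_square)
    also have "\<dots> \<le> n * norm ?y" using le n by (intro mult_left_mono) auto
    finally have "norm ?y * norm ?y \<le> n * norm ?y" .
    then have "norm ?y \<le> n" using n by (cases "norm ?y = 0") auto
    with le show ?thesis by simp
  qed
  have "trace (X z) = (\<Sum>i\<in>UNIV. axis i 1 \<bullet> (X z *v axis i 1))"
    by (simp add: trace_def matrix_vector_mult_basis inner_axis' column_def)
  also have "\<dots> \<le> (\<Sum>i\<in>(UNIV::'m set). n)" by (intro sum_mono q) simp
  finally show ?thesis by (simp add: n_def mult.commute)
qed

end

lemma penalized_uminus: "penalized F C \<Longrightarrow> penalized F (\<lambda>z. - C z)"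
  unfolding penalized_def
  using bounded_linear_transpose[where 'm='b and 'k='b]
  by (auto simp: linear_compose_neg linear_simps matrix_vector_mult_uminus)

section \<open>Curvature of the approximants\<close>

text \<open>The lower bound on \<open>k\<close> is four times the sum of the bounds of
  \<open>trace_X\<close> for the four determinants, two of each size. This is the convexity that the
  penalty inside the determinants adds to \<open>l\<close> and that \<open>- k * penal\<close> has
  to cancel.\<close>

locale approximant =
  P: penalized F N C + P2: penalized F N C2
  for F :: "'a::euclidean_space set" and N and C :: "'a \<Rightarrow> real^'m^'m" and C2 :: "'a \<Rightarrow> real^'k^'k" +
  fixes k :: real
  assumes k: "4 * (2 * (real (2*N+2) * real CARD('m)) + 2 * (real (2*N+2) * real CARD('k))) \<le> k"
begin

sublocale M: penalized F N "\<lambda>z. - C z" by (rule penalized_uminus) (rule P.penalized_axioms)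
sublocale M2: penalized F N "\<lambda>z. - C2 z" by (rule penalized_uminus) (rule P2.penalized_axioms)

definition "l z = - k * penal F N z - (z \<bullet> z) / 2 + 4 * (P.p z + M.p z + P2.p z + M2.p z)"
definition "l1 b z = - k * penal1 F N b z - z \<bullet> b + 4 * (P.p1 b z + M.p1 b z + P2.p1 b z + M2.p1 b z)"
definition "l2 b c z = - k * penal2 F N b c z - b \<bullet> c + 4 * (P.p2 b c z + M.p2 b c z + P2.p2 b c z + M2.p2 b c z)"

lemma dl: "((\<lambda>t. l (z + t *\<^sub>R b)) has_real_derivative l1 b z) (at 0)"
proof -
  have "((\<lambda>t. ((z + t *\<^sub>R b) \<bullet> (z + t *\<^sub>R b)) / 2) has_real_derivative z \<bullet> b) (at 0)"
    by (simp add: inner_add_left inner_add_right inner_commute[of b z])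
      (auto intro!: derivative_eq_intros)
  then show ?thesis
    unfolding l_def l1_def
    by (intro DERIV_add DERIV_diff DERIV_cmult d_penal P.dp M.dp P2.dp M2.dp)
qed

lemma dl1: "((\<lambda>t. l1 b (z + t *\<^sub>R c)) has_real_derivative l2 b c z) (at 0)"
proof -
  have "((\<lambda>t. (z + t *\<^sub>R c) \<bullet> b) has_real_derivative b \<bullet> c) (at 0)"
    by (simp add: inner_add_left inner_commute[of b c]) (auto intro!: derivative_eq_intros)
  then show ?thesis
    unfolding l1_def l2_def
    by (intro DERIV_add DERIV_diff DERIV_cmult d_penal1 P.dp1 M.dp1 P2.dp1 M2.dp1)
qed

text \<open>The Gaussian accounts for the left-hand side of \<open>curv\<close>. The Hessian of the
  penalty has the total coefficient \<open>k - 4 * \<tau>\<close>, which is nonnegative. The first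
  derivatives of the log determinants give Gram terms: \<open>gr\<close> from the three other
  determinants is nonnegative, and \<open>g\<close> from the determinant of \<open>P.S\<close>
  dominates the exchanged term \<open>sw\<close> (\<open>trace_swap_le\<close>).\<close>

sublocale smooth_weight P.S P.S1 P.S2 l l1 l2
proof
  show "continuous_on UNIV l" unfolding l_def
    by (intro continuous_intros P.cp M.cp P2.cp M2.cp) auto
  show "continuous_on UNIV (l1 b)" for b unfolding l1_def
    by (intro continuous_intros P.cp1 M.cp1 P2.cp1 M2.cp1)
  show "continuous_on UNIV (l2 b c)" for b c unfolding l2_def
    by (intro continuous_intros P.cp2 M.cp2 P2.cp2 M2.cp2)
  show "l2 b c z = l2 c b z" for b c z
    unfolding l2_def penal2_comm[of F N b] P.p2_comm[of b] M.p2_comm[of b] P2.p2_comm[of b] M2.p2_comm[of b]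
      inner_commute[of b] ..
  show "P.S2 b c z = P.S2 c b z" for b c z
    unfolding P.S2_def penal2_comm[of F N b] ..
  fix z :: 'a and y :: "'a \<Rightarrow> real^'m"
  let ?q = "\<lambda>b c. y b \<bullet> (P.S z *v y c)"
  let ?S = "\<lambda>f. \<Sum>b\<in>Basis. \<Sum>c\<in>Basis. f b c :: real"
  define \<tau> where "\<tau> = trace (P.X z) + trace (M.X z) + trace (P2.X z) + trace (M2.X z)"
  have "4 * (t1 + t2 + t3 + t4) \<le> k" if "t1 \<le> u" "t2 \<le> u" "t3 \<le> w" "t4 \<le> w" "4 * (2 * u + 2 * w) \<le> k" for t1 t2 t3 t4 u w
    using that by (simp add: algebra_simps)
  from this[OF P.trace_X[of z] M.trace_X[of z] P2.trace_X[of z] M2.trace_X[of z] k]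
  have \<tau>: "4 * \<tau> \<le> k" unfolding \<tau>_def .
  define gr where "gr b c = (trace (M.X z ** M.S1 c z ** M.X z ** M.S1 b z)
    + trace (P2.X z ** P2.S1 c z ** P2.X z ** P2.S1 b z) + trace (M2.X z ** M2.S1 c z ** M2.X z ** M2.S1 b z)) * ?q b c" for b c
  define g where "g b c = trace (P.X z ** P.S1 c z ** P.X z ** P.S1 b z) * ?q b c" for b c
  define sw where "sw b c = (P.S1 c z *v y b) \<bullet> (matrix_inv (P.S z) *v (P.S1 b z *v y c))" for b c
  have pdX: "posdef (P.X z)" "posdef (M.X z)" "posdef (P2.X z)" "posdef (M2.X z)"
    unfolding P.X_def M.X_def P2.X_def M2.X_def by (intro posdef_inv P.pd M.pd P2.pd M2.pd)+
  have gr: "0 \<le> ?S gr"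
  proof -
    have "0 \<le> ?S (\<lambda>b c. trace (M.X z ** M.S1 c z ** M.X z ** M.S1 b z) * ?q b c)"
      by (rule trace_gram_nonneg[OF pdX(2) P.pd M.sym1])
    moreover have "0 \<le> ?S (\<lambda>b c. trace (P2.X z ** P2.S1 c z ** P2.X z ** P2.S1 b z) * ?q b c)"
      by (rule trace_gram_nonneg[OF pdX(3) P.pd P2.sym1])
    moreover have "0 \<le> ?S (\<lambda>b c. trace (M2.X z ** M2.S1 c z ** M2.X z ** M2.S1 b z) * ?q b c)"
      by (rule trace_gram_nonneg[OF pdX(4) P.pd M2.sym1])
    ultimately show ?thesis
      unfolding gr_def distrib_right sum.distrib by linarith
  qed
  have g: "0 \<le> ?S g"
    unfolding g_def by (rule trace_gram_nonneg[OF pdX(1) P.pd P.sym1])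
  have sw: "?S sw \<le> ?S g"
    unfolding g_def sw_def P.X_def by (rule trace_swap_le[OF P.pd P.sym1])
  have c1: "0 \<le> (k - 4 * \<tau>) * ?S (\<lambda>b c. penal2 F N b c z * ?q b c)"
    using \<tau> penal2_convex[OF posdef_nonneg[OF P.pd], of F N z y z] by (intro mult_nonneg_nonneg) auto
  have c2: "0 \<le> ?S (\<lambda>b c. y b \<bullet> (P.S2 b c z *v y c))"
    using penal2_convex[of "mat 1" F N z y] by (simp add: P.S2_def scaleR_matrix_vector_assoc[symmetric])
  have d: "?S (\<lambda>b c. (b \<bullet> c) * ?q b c) = (\<Sum>b\<in>Basis. ?q b b)"
  proof (intro sum.cong refl)
    fix b :: 'a assume b: "b \<in> Basis"
    have "(\<Sum>c\<in>Basis. (b \<bullet> c) * ?q b c) = (\<Sum>c\<in>Basis. if c = b then ?q b b else 0)"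
      using b by (intro sum.cong refl) (auto simp: inner_Basis)
    then show "(\<Sum>c\<in>Basis. (b \<bullet> c) * ?q b c) = ?q b b" using b by simp
  qed
  have "- l2 b c z * ?q b c + y b \<bullet> (P.S2 b c z *v y c) - sw b c =
     (k - 4 * \<tau>) * (penal2 F N b c z * ?q b c) + (b \<bullet> c) * ?q b c + 4 * gr b c + 4 * g b c
      + y b \<bullet> (P.S2 b c z *v y c) - sw b c" for b c
    by (simp add: l2_def P.p2_def M.p2_def P2.p2_def M2.p2_def \<tau>_def gr_def g_def algebra_simps)
  then have "?S (\<lambda>b c. - l2 b c z * ?q b c + y b \<bullet> (P.S2 b c z *v y c) - sw b c) =
     (k - 4 * \<tau>) * ?S (\<lambda>b c. penal2 F N b c z * ?q b c) + ?S (\<lambda>b c. (b \<bullet> c) * ?q b c) + 4 * ?S gr + 4 * ?S g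
      + ?S (\<lambda>b c. y b \<bullet> (P.S2 b c z *v y c)) - ?S sw"
    by (simp only: sum.distrib sum_subtractf sum_distrib_left)
  also have "\<dots> \<ge> (\<Sum>b\<in>Basis. ?q b b)"
    unfolding d using c1 c2 gr g sw by linarith
  finally show "(\<Sum>b\<in>Basis. ?q b b) \<le> ?S (\<lambda>b c. - l2 b c z * ?q b c + y b \<bullet> (P.S2 b c z *v y c)
      - (P.S1 c z *v y b) \<bullet> (matrix_inv (P.S z) *v (P.S1 b z *v y c)))"
    by (simp only: sw_def)
qed (rule P.pd P.dS P.dS1 dl dl1 P.sym1 P.sym2 P.cS P.cS1 P.cS2)+

lemma W_eq: "W z = (exp (- k * penal F N z) * exp (- (z \<bullet> z) / 2) *
    (det (P.S z) * det (M.S z) * det (P2.S z) * det (M2.S z)) ^ 4) *\<^sub>R matrix_inv (P.S z)"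
proof -
  have e: "exp (4 * ln d) = d ^ 4" if "0 < d" for d :: real
    using exp_of_nat_mult[of 4 "ln d"] that by simp
  have "exp (l z) = exp (- k * penal F N z) * exp (- (z \<bullet> z) / 2) *
    (exp (4 * P.p z) * exp (4 * M.p z) * exp (4 * P2.p z) * exp (4 * M2.p z))"
    unfolding l_def by (simp add: exp_add[symmetric] algebra_simps)
  also have "\<dots> = exp (- k * penal F N z) * exp (- (z \<bullet> z) / 2) *
    (det (P.S z) * det (M.S z) * det (P2.S z) * det (M2.S z)) ^ 4"
    unfolding P.p_def M.p_def P2.p_def M2.p_def
    by (simp add: e posdef_det_pos P.pd M.pd P2.pd M2.pd power_mult_distrib)
  finally show ?thesis by (simp add: W_def X_def)
qed

lemma Brascamp_Lieb_box:
  fixes x :: "'a \<Rightarrow> real^'m"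
  assumes "0 < L"
  defines "c \<equiv> \<lambda>z. \<Sum>b\<in>Basis. (z \<bullet> b) *\<^sub>R x b" and "B \<equiv> {z. \<forall>b\<in>Basis. \<bar>z \<bullet> b\<bar> \<le> L}"
  shows "0 \<le> (\<integral>z. indicator B z *\<^sub>R (W z *v c z) \<partial>lborel) \<bullet>
      (matrix_inv (\<integral>z. indicator B z *\<^sub>R W z \<partial>lborel) *v (\<integral>z. indicator B z *\<^sub>R (W z *v c z) \<partial>lborel))
    - (\<integral>z. indicator B z *\<^sub>R (c z \<bullet> (W z *v c z) - (\<Sum>b\<in>Basis. x b \<bullet> (W z *v x b))) \<partial>lborel)"
proof -
  have n: "nakano W (\<lambda>b z. exp (l z) *\<^sub>R V1 b z) (\<lambda>b d z. exp (l z) *\<^sub>R V2 b d z)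
    (\<lambda>z. W z *v c z) (\<lambda>b z. W z *v x b + (exp (l z) *\<^sub>R V1 b z) *v c z)
    (\<lambda>z. c z \<bullet> (W z *v c z) - (\<Sum>b\<in>Basis. x b \<bullet> (W z *v x b)))"
    unfolding c_def by (rule nakano_affine)
  interpret n: nakano W "\<lambda>b z. exp (l z) *\<^sub>R V1 b z" "\<lambda>b d z. exp (l z) *\<^sub>R V2 b d z"
    "\<lambda>z. W z *v c z" "\<lambda>b z. W z *v x b + (exp (l z) *\<^sub>R V1 b z) *v c z"
    "\<lambda>z. c z \<bullet> (W z *v c z) - (\<Sum>b\<in>Basis. x b \<bullet> (W z *v x b))" by (rule n)
  show ?thesis
    using nakano_box_int[OF n \<open>0 < L\<close> finite_Basis order_refl, of 0]
    unfolding box_int_Basis[OF n.cG] box_int_Basis[OF n.cH] box_int_Basis[OF n.cK] B_def .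
qed

end

section \<open>Operator norm and determinant bounds\<close>

lemma op_norm_vec: "norm (A *v x) \<le> op_norm A * norm x"
  unfolding op_norm_def by (rule onorm) (rule matrix_vector_mul_bounded_linear)

lemma op_norm_le: "(\<And>x. norm (A *v x) \<le> b * norm x) \<Longrightarrow> op_norm A \<le> b"
  unfolding op_norm_def by (rule onorm_le)

lemma op_norm_nonneg: "0 \<le> op_norm A"
  unfolding op_norm_def by (rule onorm_pos_le) (rule matrix_vector_mul_bounded_linear)

lemma op_norm_uminus: "op_norm (- A) = op_norm A"
  by (simp add: op_norm_def onorm_neg matrix_vector_mult_uminus[abs_def])

lemma op_norm_zero: "op_norm (0 :: real^'m^'m) = 0"
  using op_norm_le[of "0 :: real^'m^'m" 0] op_norm_nonneg[of "0 :: real^'m^'m"] by (simp add: order_antisym)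

lemma op_norm_diff_le: "op_norm A - op_norm B \<le> (\<Sum>i\<in>UNIV. \<Sum>j\<in>UNIV. \<bar>(A - B) $ i $ j\<bar>)"
proof -
  have "op_norm (B + (A - B)) \<le> op_norm B + op_norm (A - B)"
    unfolding op_norm_def matrix_vector_mult_add_rdistrib[abs_def]
    by (intro onorm_triangle matrix_vector_mul_bounded_linear)
  moreover have "op_norm (A - B) \<le> (\<Sum>i\<in>UNIV. \<Sum>j\<in>UNIV. \<bar>(A - B) $ i $ j\<bar>)"
    unfolding op_norm_def by (rule onorm_le_matrix_component_sum)
  ultimately show ?thesis by simp
qed

lemma tendsto_op_norm [tendsto_intros]:
  fixes f :: "'a \<Rightarrow> real^'m^'m"
  assumes "(f \<longlongrightarrow> A) F"
  shows "((\<lambda>x. op_norm (f x)) \<longlongrightarrow> op_norm A) F"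
proof -
  have "((\<lambda>x. \<Sum>i\<in>UNIV. \<Sum>j\<in>UNIV. \<bar>(f x - A) $ i $ j\<bar>) \<longlongrightarrow> (\<Sum>i\<in>UNIV. \<Sum>j\<in>(UNIV::'m set). \<bar>(A - A) $ i $ j\<bar>)) F"
    by (intro tendsto_intros assms)
  then have z: "((\<lambda>x. \<Sum>i\<in>UNIV. \<Sum>j\<in>UNIV. \<bar>(f x - A) $ i $ j\<bar>) \<longlongrightarrow> 0) F" by simp
  have "\<bar>op_norm (f x) - op_norm A\<bar> \<le> (\<Sum>i\<in>UNIV. \<Sum>j\<in>UNIV. \<bar>(f x - A) $ i $ j\<bar>)" for x
    using op_norm_diff_le[of "f x" A] op_norm_diff_le[of A "f x"] by (simp add: abs_minus_commute abs_le_iff)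
  then have "((\<lambda>x. op_norm (f x) - op_norm A) \<longlongrightarrow> 0) F"
    by (intro Lim_null_comparison[OF _ z]) auto
  then show ?thesis by (simp add: LIM_zero_iff)
qed

lemma continuous_on_op_norm [continuous_intros]:
  fixes f :: "'a::topological_space \<Rightarrow> real^'m^'m"
  shows "continuous_on S f \<Longrightarrow> continuous_on S (\<lambda>x. op_norm (f x))"
  unfolding continuous_on_def by (auto intro!: tendsto_op_norm)

lemma op_norm_scaled_one: "op_norm (t *\<^sub>R (mat 1 :: real^'m^'m)) = \<bar>t\<bar>"
proof (rule order_antisym)
  show "op_norm (t *\<^sub>R (mat 1 :: real^'m^'m)) \<le> \<bar>t\<bar>"
    by (rule op_norm_le) (simp add: scaleR_matrix_vector_assoc[symmetric])
  show "\<bar>t\<bar> \<le> op_norm (t *\<^sub>R (mat 1 :: real^'m^'m))"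
    using op_norm_vec[of "t *\<^sub>R (mat 1 :: real^'m^'m)" "axis undefined 1"]
    by (simp add: scaleR_matrix_vector_assoc[symmetric])
qed

lemma sphere_attains_op_norm:
  fixes A :: "real^'m^'m"
  obtains u where "norm u = 1" "norm (A *v u) = op_norm A"
proof -
  have ne: "sphere (0::real^'m) 1 \<noteq> {}" using norm_axis_1[of undefined] by (metis empty_iff mem_sphere_0)
  have "\<exists>u\<in>sphere 0 1. \<forall>x\<in>sphere 0 1. norm (A *v x) \<le> norm (A *v u)"
    by (intro continuous_attains_sup ne) (auto intro!: continuous_intros)
  then obtain u where u: "norm u = 1" and le: "\<And>x. norm x = 1 \<Longrightarrow> norm (A *v x) \<le> norm (A *v u)" by auto
  have "norm (A *v x) \<le> norm (A *v u) * norm x" for x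
  proof (cases "x = 0")
    case False
    have "norm (A *v (x /\<^sub>R norm x)) \<le> norm (A *v u)" by (rule le) (use False in simp)
    then show ?thesis using False by (simp add: matrix_vector_mult_scaleR field_simps)
  qed simp
  then have "op_norm A \<le> norm (A *v u)" by (rule op_norm_le)
  moreover have "norm (A *v u) \<le> op_norm A" using op_norm_vec[of A u] u by simp
  ultimately show ?thesis using that u by (meson order_antisym)
qed

text \<open>At a unit vector \<open>u\<close> attaining the norm, equality in Cauchy-Schwarz forces \<open>A (A u) = u\<close>.\<close>

lemma det_zero_of_op_norm_1:
  fixes A :: "real^'m^'m"
  assumes sym: "transpose A = A" and n: "op_norm A = 1"
  shows "det (mat 1 + A) * det (mat 1 - A) = 0"
proof -
  obtain u where u: "norm u = 1" "norm (A *v u) = 1" using sphere_attains_op_norm[of A] n by metis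
  let ?w = "A *v (A *v u)"
  have "u \<bullet> ?w = (A *v u) \<bullet> (A *v u)" using inner_matrix_sym[OF sym, of u "A *v u"] by simp
  also have "\<dots> = 1" using u by (simp add: dot_square_norm)
  finally have uw: "u \<bullet> ?w = 1" .
  have "norm ?w \<le> 1" using op_norm_vec[of A "A *v u"] n u by simp
  then have "?w \<bullet> ?w \<le> 1" by (simp add: dot_square_norm power_le_one)
  then have "(?w - u) \<bullet> (?w - u) \<le> 0"
    using uw u by (simp add: inner_diff inner_commute[of ?w u] dot_square_norm[of u])
  then have w: "?w = u" by (metis eq_iff_diff_eq_0 inner_ge_zero inner_eq_zero_iff order_antisym)
  have "((mat 1 + A) ** (mat 1 - A)) *v u = 0"
    by (simp add: matrix_vector_mul_assoc[symmetric] algebra_simps w)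
  moreover have "u \<noteq> 0" using u by auto
  ultimately have "\<not> invertible ((mat 1 + A) ** (mat 1 - A))"
    by (metis matrix_inv_vec(2) matrix_vector_mult_0_right)
  then show ?thesis by (simp add: invertible_det_nz det_mul)
qed

lemma posdef_one_plus:
  fixes A :: "real^'m^'m"
  assumes "transpose A = A" "op_norm A < 1"
  shows "posdef (mat 1 + A)"
  unfolding posdef_def
proof (intro conjI allI impI)
  show "transpose (mat 1 + A) = mat 1 + A"
    using bounded_linear_transpose[where 'm='m and 'k='m] by (simp add: linear_simps assms)
  fix x :: "real^'m" assume x: "x \<noteq> 0"
  have "- (x \<bullet> (A *v x)) \<le> norm x * norm (A *v x)"
    using Cauchy_Schwarz_ineq2[of x "A *v x"] by linarith
  also have "\<dots> \<le> norm x * (op_norm A * norm x)" by (intro mult_left_mono op_norm_vec) auto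
  also have "\<dots> < norm x * (1 * norm x)" using x assms by (intro mult_strict_left_mono mult_strict_right_mono) auto
  finally show "0 < x \<bullet> ((mat 1 + A) *v x)"
    by (simp add: matrix_vector_mult_add_rdistrib inner_add_right dot_square_norm power2_eq_square)
qed

lemma posdef_one_minus:
  fixes A :: "real^'m^'m"
  assumes "transpose A = A" "op_norm A < 1"
  shows "posdef (mat 1 - A)"
  using posdef_one_plus[of "- A"] assms bounded_linear_transpose[where 'm='m and 'k='m]
  by (simp add: op_norm_uminus linear_simps)

lemma entry_le_norm: "\<bar>A $ i $ j\<bar> \<le> norm (A *v axis j 1)" for A :: "real^'m^'m"
  using component_le_norm_cart[of "A *v axis j 1" i] by (simp add: matrix_vector_mult_basis column_def)

lemma det_bound:
  fixes A :: "real^'m^'m"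
  assumes "\<And>i j. \<bar>A $ i $ j\<bar> \<le> r"
  shows "\<bar>det A\<bar> \<le> fact CARD('m) * r ^ CARD('m)"
proof -
  have "\<bar>det A\<bar> \<le> (\<Sum>p\<in>{p. p permutes (UNIV::'m set)}. \<bar>of_int (sign p) * (\<Prod>i\<in>UNIV. A $ i $ p i)\<bar>)"
    unfolding det_def by (rule sum_abs)
  also have "\<dots> \<le> (\<Sum>p\<in>{p. p permutes (UNIV::'m set)}. r ^ CARD('m))"
  proof (intro sum_mono)
    fix p
    have "\<bar>of_int (sign p) * (\<Prod>i\<in>UNIV. A $ i $ p i)\<bar> = (\<Prod>i\<in>UNIV. \<bar>A $ i $ p i\<bar>)"
      by (simp add: abs_mult abs_prod sign_def)
    also have "\<dots> \<le> (\<Prod>i\<in>(UNIV::'m set). r)" by (intro prod_mono) (auto intro: assms)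
    finally show "\<bar>of_int (sign p) * (\<Prod>i\<in>UNIV. A $ i $ p i)\<bar> \<le> r ^ CARD('m)" by simp
  qed
  also have "\<dots> = fact CARD('m) * r ^ CARD('m)" by (simp add: card_permutations)
  finally show ?thesis .
qed

text \<open>The product is an entry of the adjugate, so the bound is uniform up to singular
  matrices. \<open>1 \<le> r\<close> accounts for the unit vector that Cramer's rule puts into one
  column.\<close>

lemma det_inv_bound:
  fixes A :: "real^'m^'m"
  assumes "\<And>i j. \<bar>A $ i $ j\<bar> \<le> r" "1 \<le> r" "det A \<noteq> 0"
  shows "\<bar>det A * matrix_inv A $ k $ l\<bar> \<le> fact CARD('m) * r ^ CARD('m)"
  unfolding matrix_inv_entry[OF assms(3)]
  by (rule det_bound) (use assms in \<open>auto simp: axis_def\<close>)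

lemma norm_matrix_le: "norm A \<le> (\<Sum>i\<in>UNIV. \<Sum>j\<in>UNIV. \<bar>A $ i $ j\<bar>)" for A :: "real^'m^'k"
proof -
  have "norm A \<le> (\<Sum>i\<in>UNIV. norm (A $ i))"
    unfolding norm_vec_def[of A] by (rule L2_set_le_sum) simp
  also have "\<dots> \<le> (\<Sum>i\<in>UNIV. \<Sum>j\<in>UNIV. \<bar>A $ i $ j\<bar>)" by (intro sum_mono norm_le_l1_cart)
  finally show ?thesis .
qed

section \<open>Growth of the approximants\<close>

context penalized begin

lemma S_entry: "\<bar>S z $ i $ j\<bar> \<le> 2 * (1 + penal F N z)"
proof -
  obtain f where f: "f \<in> F" and n: "\<And>x. norm (C z *v x) \<le> \<bar>z \<bullet> f\<bar> * norm x" using dom[of z] by blast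
  have "\<bar>C z $ i $ j\<bar> \<le> \<bar>z \<bullet> f\<bar>"
    using entry_le_norm[of "C z" i j] n[of "axis j 1"] by simp
  also have "\<dots> \<le> 1 + penal F N z"
  proof (cases "\<bar>z \<bullet> f\<bar> \<le> 1")
    case True
    then show ?thesis using penal_nonneg[of F N z] by simp
  next
    case False
    then have "\<bar>z \<bullet> f\<bar> ^ 1 \<le> \<bar>z \<bullet> f\<bar> ^ (2*N+2)" by (intro power_increasing) auto
    then show ?thesis using penal_ge[OF finF f, of z N] by simp
  qed
  finally show ?thesis
    using penal_nonneg[of F N z] by (auto simp: S_def mat_def abs_le_iff)
qed

lemma det_S_bound: "\<bar>det (S z)\<bar> \<le> fact CARD('m) * (2 * (1 + penal F N z)) ^ CARD('m)"
  by (rule det_bound) (rule S_entry)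

end

context approximant begin

text \<open>One copy of \<open>det (P.S z)\<close> turns the inverse into the adjugate. Then
  everything is polynomial in \<open>1 + penal\<close>, of degree
  \<open>8 * CARD('m) + 8 * CARD('k)\<close>: fourth powers of two determinants of each size. This
  degree is traded for the same multiple of the penalty in the exponent.\<close>

lemma W_norm: "norm (W z) \<le> real CARD('m) ^ 2 * (fact CARD('m) ^ 8 * fact CARD('k) ^ 8 * 2 ^ (8 * CARD('m) + 8 * CARD('k)))
   * exp (- (z \<bullet> z) / 2) * exp (- (k - real (8 * CARD('m) + 8 * CARD('k))) * penal F N z)"
proof -
  let ?r = "2 * (1 + penal F N z)"
  define \<psi> where "\<psi> = penal F N z"
  define D where "D = fact CARD('m) * ?r ^ CARD('m)"
  define D2 where "D2 = fact CARD('k) * ?r ^ CARD('k)"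
  define q where "q = 8 * CARD('m) + 8 * CARD('k)"
  have r: "1 \<le> ?r" using penal_nonneg[of F N z] by simp
  have D: "0 \<le> D" "0 \<le> D2" using r by (auto simp: D_def D2_def)
  have d: "\<bar>det (P.S z)\<bar> \<le> D" "\<bar>det (M.S z)\<bar> \<le> D" "\<bar>det (P2.S z)\<bar> \<le> D2" "\<bar>det (M2.S z)\<bar> \<le> D2"
    unfolding D_def D2_def by (rule P.det_S_bound M.det_S_bound P2.det_S_bound M2.det_S_bound)+
  have entry: "\<bar>W z $ i $ j\<bar> \<le> exp (- k * \<psi>) * exp (- (z \<bullet> z) / 2) * (D ^ 8 * D2 ^ 8)" for i j
  proof -
    have ne: "det (P.S z) \<noteq> 0" using posdef_det_pos[OF P.pd, of z] by simp
    have a: "\<bar>det (P.S z) * matrix_inv (P.S z) $ i $ j\<bar> \<le> D"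
      unfolding D_def by (rule det_inv_bound[OF P.S_entry r ne])
    have "W z $ i $ j = exp (- k * \<psi>) * exp (- (z \<bullet> z) / 2) *
       ((det (P.S z) * matrix_inv (P.S z) $ i $ j) * det (P.S z) ^ 3 * det (M.S z) ^ 4 * (det (P2.S z) ^ 4 * det (M2.S z) ^ 4))"
      by (simp add: W_eq \<psi>_def power_mult_distrib eval_nat_numeral mult_ac)
    then have "\<bar>W z $ i $ j\<bar> = exp (- k * \<psi>) * exp (- (z \<bullet> z) / 2) *
       (\<bar>det (P.S z) * matrix_inv (P.S z) $ i $ j\<bar> * \<bar>det (P.S z)\<bar> ^ 3 * \<bar>det (M.S z)\<bar> ^ 4 * (\<bar>det (P2.S z)\<bar> ^ 4 * \<bar>det (M2.S z)\<bar> ^ 4))"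
      by (simp add: abs_mult power_abs)
    also have "\<dots> \<le> exp (- k * \<psi>) * exp (- (z \<bullet> z) / 2) * (D * D ^ 3 * D ^ 4 * (D2 ^ 4 * D2 ^ 4))"
      using D by (intro mult_left_mono mult_mono power_mono a d) auto
    also have "D * D ^ 3 * D ^ 4 * (D2 ^ 4 * D2 ^ 4) = D ^ 8 * D2 ^ 8"
      by (simp add: eval_nat_numeral mult_ac)
    finally show ?thesis .
  qed
  have "norm (W z) \<le> (\<Sum>i\<in>(UNIV::'m set). \<Sum>j\<in>(UNIV::'m set). exp (- k * \<psi>) * exp (- (z \<bullet> z) / 2) * (D ^ 8 * D2 ^ 8))"
    by (rule order_trans[OF norm_matrix_le]) (intro sum_mono entry)
  also have "\<dots> = real CARD('m) ^ 2 * exp (- k * \<psi>) * exp (- (z \<bullet> z) / 2) * (D ^ 8 * D2 ^ 8)"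
    by (simp add: power2_eq_square)
  also have "D ^ 8 * D2 ^ 8 = (fact CARD('m) ^ 8 * fact CARD('k) ^ 8 * 2 ^ q) * (1 + \<psi>) ^ q"
  proof -
    have "(x * (2 * t) ^ m) ^ 8 * (y * (2 * t) ^ n) ^ 8 = (x ^ 8 * y ^ 8 * 2 ^ (8 * m + 8 * n)) * t ^ (8 * m + 8 * n)"
      for x y t :: real and m n :: nat
      by (simp add: power_mult_distrib power_mult[symmetric] power_add mult_ac)
    then show ?thesis unfolding D_def D2_def q_def \<psi>_def .
  qed
  also have "real CARD('m) ^ 2 * exp (- k * \<psi>) * exp (- (z \<bullet> z) / 2) * ((fact CARD('m) ^ 8 * fact CARD('k) ^ 8 * 2 ^ q) * (1 + \<psi>) ^ q)
     \<le> real CARD('m) ^ 2 * exp (- k * \<psi>) * exp (- (z \<bullet> z) / 2) * ((fact CARD('m) ^ 8 * fact CARD('k) ^ 8 * 2 ^ q) * exp (real q * \<psi>))"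
  proof (intro mult_left_mono)
    have "(1 + \<psi>) ^ q \<le> exp \<psi> ^ q" using penal_nonneg[of F N z] by (intro power_mono) (auto simp: \<psi>_def)
    then show "(1 + \<psi>) ^ q \<le> exp (real q * \<psi>)" by (simp add: exp_of_nat_mult)
  qed auto
  also have "\<dots> = real CARD('m) ^ 2 * (fact CARD('m) ^ 8 * fact CARD('k) ^ 8 * 2 ^ q)
   * exp (- (z \<bullet> z) / 2) * (exp (- k * \<psi>) * exp (real q * \<psi>))" by (simp add: mult_ac)
  also have "exp (- k * \<psi>) * exp (real q * \<psi>) = exp (- (k - real q) * \<psi>)"
    by (simp add: exp_add[symmetric] algebra_simps)
  finally show ?thesis unfolding q_def \<psi>_def .
qed

end

section \<open>Finitely many functionals that determine the operator norm\<close>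

text \<open>The operator norm of \<open>C z\<close> is the largest value of w . (C z u) over unit
  vectors, and each such value is linear in \<open>z\<close>. An \<epsilon>/4-net of the sphere
  loses a factor of at most 1 - \<epsilon>/2, which the factor 1 + \<epsilon> built into the
  functionals makes good because \<epsilon> is at most 1.\<close>

lemma finite_net:
  fixes C :: "'a::euclidean_space \<Rightarrow> real^'m^'m"
  assumes lin: "linear C" and \<epsilon>: "0 < \<epsilon>" "\<epsilon> \<le> 1"
  shows "\<exists>F. finite F \<and> (\<forall>z. \<exists>f\<in>F. \<forall>x. norm (C z *v x) \<le> \<bar>z \<bullet> f\<bar> * norm x) \<and>
     (\<forall>z. \<forall>f\<in>F. \<bar>z \<bullet> f\<bar> \<le> (1 + \<epsilon>) * op_norm (C z))"
proof -
  have "\<exists>Y. finite Y \<and> Y \<subseteq> sphere (0::real^'m) 1 \<and> sphere 0 1 \<subseteq> (\<Union>y\<in>Y. ball y (\<epsilon>/4))"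
    using \<epsilon> by (intro seq_compact_imp_totally_bounded[rule_format] compact_imp_seq_compact) auto
  then obtain Y :: "(real^'m) set" where Y: "finite Y" "Y \<subseteq> sphere 0 1" "sphere 0 1 \<subseteq> (\<Union>y\<in>Y. ball y (\<epsilon>/4))"
    by blast
  have near: "\<exists>y\<in>Y. norm (x - y) \<le> \<epsilon>/4" if "norm x = 1" for x
    using Y(3) that by (force simp: subset_iff dist_norm norm_minus_commute)
  have Yne: "Y \<noteq> {}" using near[of "axis undefined 1"] by auto
  \<comment> \<open>The Riesz vector of \<open>z\<close> \<mapsto> (1 + \<epsilon>) w . (C z u) for
    the pair \<open>p = (w, u)\<close>.\<close>
  define g where "g p = (1 + \<epsilon>) *\<^sub>R (\<Sum>b\<in>Basis. (fst p \<bullet> (C b *v snd p)) *\<^sub>R b)" for p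
  have g: "z \<bullet> g p = (1 + \<epsilon>) * (fst p \<bullet> (C z *v snd p))" for z p
  proof -
    have "fst p \<bullet> (C z *v snd p) = fst p \<bullet> (C (\<Sum>b\<in>Basis. (z \<bullet> b) *\<^sub>R b) *v snd p)"
      by (simp add: euclidean_representation)
    also have "\<dots> = (\<Sum>b\<in>Basis. (z \<bullet> b) * (fst p \<bullet> (C b *v snd p)))"
      by (simp add: linear_sum[OF lin] linear_scale[OF lin] inner_sum_right
          linear_sum[OF bounded_linear.linear[OF bounded_bilinear.bounded_linear_left[OF bounded_bilinear_matrix_vector]]]
          scaleR_matrix_vector_assoc[symmetric])
    finally show ?thesis by (simp add: g_def inner_sum_right mult_ac)
  qed
  define F where "F = g ` (Y \<times> Y)"
  have up: "\<bar>z \<bullet> f\<bar> \<le> (1 + \<epsilon>) * op_norm (C z)" if "f \<in> F" for z f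
  proof -
    obtain p where p: "p \<in> Y \<times> Y" "f = g p" using \<open>f \<in> F\<close> by (auto simp: F_def)
    have n: "norm (fst p) = 1" "norm (snd p) = 1" using p Y by auto
    have "\<bar>fst p \<bullet> (C z *v snd p)\<bar> \<le> norm (fst p) * norm (C z *v snd p)" by (rule Cauchy_Schwarz_ineq2)
    also have "\<dots> \<le> op_norm (C z)" using op_norm_vec[of "C z" "snd p"] n by simp
    finally show ?thesis using \<epsilon> by (simp add: p g abs_mult)
  qed
  have low: "\<exists>f\<in>F. op_norm (C z) \<le> \<bar>z \<bullet> f\<bar>" for z
  proof -
    define \<kappa> where "\<kappa> = op_norm (C z)"
    have \<kappa>: "0 \<le> \<kappa>" by (simp add: \<kappa>_def op_norm_nonneg)
    obtain u where u: "norm u = 1" "norm (C z *v u) = \<kappa>" using sphere_attains_op_norm[of "C z"] \<kappa>_def by metis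
    show ?thesis
    proof (cases "\<kappa> = 0")
      case True
      then show ?thesis using Yne by (auto simp: F_def \<kappa>_def)
    next
      case False
      define w where "w = (C z *v u) /\<^sub>R \<kappa>"
      have w: "norm w = 1" "w \<bullet> (C z *v u) = \<kappa>"
        using u False \<kappa> by (simp_all add: w_def dot_square_norm power2_eq_square)
      obtain u' where u': "u' \<in> Y" "norm (u - u') \<le> \<epsilon>/4" using near u by blast
      obtain w' where w': "w' \<in> Y" "norm (w - w') \<le> \<epsilon>/4" using near w by blast
      have nw': "norm w' = 1" using w' Y by auto
      \<comment> \<open>Replacing the extremal pair by its neighbours in the net is done one vector
        at a time, at the cost \<kappa> \<epsilon>/4 each.\<close>
      have "\<kappa> = w' \<bullet> (C z *v u') + w' \<bullet> (C z *v (u - u')) + (w - w') \<bullet> (C z *v u)"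
        using w by (simp add: algebra_simps inner_diff)
      also have "w' \<bullet> (C z *v (u - u')) \<le> norm w' * norm (C z *v (u - u'))" by (rule norm_cauchy_schwarz)
      also have "\<dots> \<le> \<kappa> * norm (u - u')" using op_norm_vec[of "C z" "u - u'"] nw' by (simp add: \<kappa>_def)
      also have "\<dots> \<le> \<kappa> * (\<epsilon>/4)" using \<kappa> u' by (intro mult_left_mono) auto
      also have "(w - w') \<bullet> (C z *v u) \<le> norm (w - w') * norm (C z *v u)" by (rule norm_cauchy_schwarz)
      also have "\<dots> \<le> (\<epsilon>/4) * \<kappa>" using mult_right_mono[OF w'(2) \<kappa>] u by simp
      finally have "\<kappa> * (1 - \<epsilon>/2) \<le> w' \<bullet> (C z *v u')" by (simp add: algebra_simps)
      then have "(1 + \<epsilon>) * (\<kappa> * (1 - \<epsilon>/2)) \<le> z \<bullet> g (w', u')" using \<epsilon> by (simp add: g)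
      moreover have "\<kappa> * 1 \<le> \<kappa> * ((1 + \<epsilon>) * (1 - \<epsilon>/2))"
      proof (intro mult_left_mono \<kappa>)
        have "\<epsilon> * \<epsilon> \<le> \<epsilon>" using \<epsilon> by (simp add: mult_left_le)
        then show "1 \<le> (1 + \<epsilon>) * (1 - \<epsilon>/2)" by (simp add: algebra_simps)
      qed
      moreover have "(1 + \<epsilon>) * (\<kappa> * (1 - \<epsilon>/2)) = \<kappa> * ((1 + \<epsilon>) * (1 - \<epsilon>/2))" by (simp only: mult_ac)
      ultimately have "\<kappa> \<le> \<bar>z \<bullet> g (w', u')\<bar>" by linarith
      then show ?thesis using w' u' by (auto simp: F_def \<kappa>_def intro!: bexI[of _ "g (w', u')"])
    qed
  qed
  have "\<exists>f\<in>F. \<forall>x. norm (C z *v x) \<le> \<bar>z \<bullet> f\<bar> * norm x" for z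
  proof -
    obtain f where f: "f \<in> F" "op_norm (C z) \<le> \<bar>z \<bullet> f\<bar>" using low by blast
    have "norm (C z *v x) \<le> \<bar>z \<bullet> f\<bar> * norm x" for x
      by (rule order_trans[OF op_norm_vec]) (use f in \<open>simp add: mult_right_mono\<close>)
    then show ?thesis using f by blast
  qed
  then show ?thesis using up Y by (intro exI[of _ F]) (auto simp: F_def)
qed

text \<open>The quarter in place of the half in the exponent leaves room to absorb the quadratic
  growth in \<open>gauss_poly_bound\<close>.\<close>

lemma integrable_gaussian: "integrable lborel (\<lambda>z::'a::euclidean_space. exp (- (z \<bullet> z) / 4))"
proof -
  interpret product_sigma_finite "\<lambda>b::'a. lborel :: real measure" by standard
  have "integrable lborel (\<lambda>x. exp (- x\<^sup>2 / 4) :: real)"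
  proof -
    have "integrable lborel (\<lambda>x. (sqrt (2 * pi * 2)) * normal_density 0 (sqrt 2) x)"
      by (intro integrable_mult_right integrable_normal_density) simp
    then show ?thesis by (simp add: normal_density_def)
  qed
  then have i: "integrable (\<Pi>\<^sub>M b\<in>(Basis::'a set). lborel) (\<lambda>x. \<Prod>b\<in>Basis. exp (- (x b)\<^sup>2 / 4) :: real)"
    by (intro product_integrable_prod) auto
  have e: "exp (- ((\<Sum>b\<in>Basis. x b *\<^sub>R b) \<bullet> (\<Sum>b\<in>(Basis::'a set). x b *\<^sub>R b)) / 4) = (\<Prod>b\<in>Basis. exp (- (x b)\<^sup>2 / 4) :: real)" for x
  proof -
    have sb: "(\<Sum>b\<in>Basis. x b *\<^sub>R b) \<bullet> c = x c" if "c \<in> Basis" for c :: 'a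
      using that by (simp add: inner_sum_left inner_Basis if_distrib cong: if_cong)
    have "(\<Sum>b\<in>Basis. x b *\<^sub>R b) \<bullet> (\<Sum>b\<in>(Basis::'a set). x b *\<^sub>R b) = (\<Sum>b\<in>Basis. (x b)\<^sup>2)"
      by (simp add: inner_sum_right sb power2_eq_square)
    then show ?thesis by (simp add: exp_sum[symmetric] sum_negf sum_divide_distrib)
  qed
  show ?thesis
    unfolding lborel_eq[where 'a='a]
  proof (subst integrable_distr_eq)
    show "integrable (\<Pi>\<^sub>M b\<in>Basis. lborel)
        (\<lambda>x. exp (- ((\<Sum>b\<in>Basis. x b *\<^sub>R b) \<bullet> (\<Sum>b\<in>(Basis::'a set). x b *\<^sub>R b)) / 4) :: real)"
      unfolding e by (rule i)
  qed auto
qed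

section \<open>The Brascamp-Lieb inequality for the truncated weight\<close>

definition wdet :: "real^'m^'m \<Rightarrow> real^'k^'k \<Rightarrow> real" where
  "wdet A B = (det (mat 1 + A) * det (mat 1 - A) * det (mat 1 + B) * det (mat 1 - B)) ^ 4"

definition trunc_w :: "real^'m^'m \<Rightarrow> real^'k^'k \<Rightarrow> real" where
  "trunc_w A B = (if op_norm A < 1 \<and> op_norm B < 1 then wdet A B else 0)"

definition trunc_Q :: "real^'m^'m \<Rightarrow> real^'k^'k \<Rightarrow> real^'m^'m" where
  "trunc_Q A B = trunc_w A B *\<^sub>R matrix_inv (mat 1 + A)"

text \<open>The weight \<open>W\<close> of the locale \<open>approximant\<close> in closed form; as
  a function of \<open>F\<close>, \<open>N\<close> and \<open>k\<close> it can be indexed by a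
  sequence of instances.\<close>

definition apx where
  "apx F N C C2 k z = (exp (- k * penal F N z) * exp (- (z \<bullet> z) / 2) *
    (det ((1 + penal F N z) *\<^sub>R mat 1 + C z) * det ((1 + penal F N z) *\<^sub>R mat 1 - C z) *
     det ((1 + penal F N z) *\<^sub>R mat 1 + C2 z) * det ((1 + penal F N z) *\<^sub>R mat 1 - C2 z)) ^ 4) *\<^sub>R
    matrix_inv ((1 + penal F N z) *\<^sub>R mat 1 + C z)"

lemma (in approximant) W_apx: "W = apx F N C C2 k"
  by (rule ext) (simp add: W_eq apx_def P.S_def M.S_def P2.S_def M2.S_def)

lemma (in approximant) continuous_W: "continuous_on UNIV W"
  unfolding W_def by (intro continuous_intros cX cl)

section \<open>Approximation of the truncated weight\<close>

text \<open>The resolvent is attached to \<open>C\<close>, while \<open>C2\<close> enters through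
  the weight only. The weight is symmetric in the two, so the instances obtained by exchanging them
  share the normalisation.\<close>

locale sym_pair =
  fixes C :: "'a::euclidean_space \<Rightarrow> real^'m^'m" and C2 :: "'a \<Rightarrow> real^'k^'k"
  assumes linC: "linear C" and symC: "\<And>z. transpose (C z) = C z"
    and linC2: "linear C2" and symC2: "\<And>z. transpose (C2 z) = C2 z"
begin

definition "\<Omega> = {z. op_norm (C z) < 1 \<and> op_norm (C2 z) < 1}"
definition "wt z = exp (- (z \<bullet> z) / 2) * trunc_w (C z) (C2 z)"
definition "G z = exp (- (z \<bullet> z) / 2) *\<^sub>R trunc_Q (C z) (C2 z)"

lemma contC: "continuous_on S C" "continuous_on S C2"
  using linC linC2 by (auto intro: linear_continuous_on linear_conv_bounded_linear[THEN iffD1])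

lemma open_\<Omega>: "open \<Omega>"
proof -
  have "open ({z. op_norm (C z) < 1} \<inter> {z. op_norm (C2 z) < 1})"
    by (intro open_Int open_Collect_less continuous_intros contC)
  then show ?thesis by (simp add: \<Omega>_def Collect_conj_eq)
qed

lemma zero_\<Omega>: "0 \<in> \<Omega>"
  by (simp add: \<Omega>_def linear_0[OF linC] linear_0[OF linC2] op_norm_zero)

lemma wdet_pos: "z \<in> \<Omega> \<Longrightarrow> 0 < wdet (C z) (C2 z)"
  using posdef_det_pos[OF posdef_one_plus[OF symC, of z]] posdef_det_pos[OF posdef_one_minus[OF symC, of z]]
    posdef_det_pos[OF posdef_one_plus[OF symC2, of z]] posdef_det_pos[OF posdef_one_minus[OF symC2, of z]]
  unfolding wdet_def \<Omega>_def by (intro zero_less_power mult_pos_pos) auto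

lemma wt_eq: "wt z = (if z \<in> \<Omega> then exp (- (z \<bullet> z) / 2) * wdet (C z) (C2 z) else 0)"
  by (simp add: wt_def trunc_w_def \<Omega>_def)

lemma G_eq: "G z = wt z *\<^sub>R matrix_inv (mat 1 + C z)"
  by (simp add: G_def wt_def trunc_Q_def)

lemma wt_nonneg: "0 \<le> wt z" and wt_pos: "z \<in> \<Omega> \<Longrightarrow> 0 < wt z"
  using wdet_pos[of z] by (auto simp: wt_eq less_imp_le)

lemma pdP: "z \<in> \<Omega> \<Longrightarrow> posdef (mat 1 + C z)"
  by (rule posdef_one_plus[OF symC]) (simp add: \<Omega>_def)

lemma G_nonneg: "0 \<le> x \<bullet> (G z *v x)"
  using wt_nonneg[of z] posdef_nonneg[OF posdef_inv[OF pdP], of z x]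
  by (cases "z \<in> \<Omega>") (simp_all add: G_eq scaleR_matrix_vector_assoc[symmetric] wt_eq)

lemma G_pos: "z \<in> \<Omega> \<Longrightarrow> x \<noteq> 0 \<Longrightarrow> 0 < x \<bullet> (G z *v x)"
  using wt_pos[of z] posdef_inv[OF pdP, of z]
  by (simp add: G_eq scaleR_matrix_vector_assoc[symmetric] posdef_def)

lemma G_sym: "transpose (G z) = G z"
  using posdef_inv[OF pdP, of z]
  by (cases "z \<in> \<Omega>") (simp_all add: G_eq transpose_scalar posdef_def wt_eq transpose_def vec_eq_iff)

text \<open>Nets \<open>F n\<close> for both norms with accuracy \<open>1/(n+2)\<close>, and exponents so large that the
  penalty, even multiplied by its coefficient, vanishes in the limit inside \<open>\<Omega>\<close>.\<close>

definition "\<kappa> = 16 * real (CARD('m) + CARD('k))"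

lemma approximation_data:
  "\<exists>F N. finite F \<and> penalized F C \<and> penalized F C2 \<and> n \<le> N \<and>
     (\<forall>z. op_norm (C z) \<le> 1 - 1 / real (n+2) \<longrightarrow> op_norm (C2 z) \<le> 1 - 1 / real (n+2) \<longrightarrow>
        \<kappa> * real (2*N+2) * penal F N z \<le> 1 / real (n+2)) \<and>
     (\<forall>z. z \<notin> \<Omega> \<longrightarrow> 1 \<le> penal F N z)"
proof -
  define \<epsilon> where "\<epsilon> = 1 / real (n+2)"
  have \<epsilon>: "0 < \<epsilon>" "\<epsilon> \<le> 1" by (auto simp: \<epsilon>_def)
  obtain F1 where F1: "finite F1" "\<And>z. \<exists>f\<in>F1. \<forall>x. norm (C z *v x) \<le> \<bar>z \<bullet> f\<bar> * norm x"
      "\<And>z f. f \<in> F1 \<Longrightarrow> \<bar>z \<bullet> f\<bar> \<le> (1 + \<epsilon>) * op_norm (C z)"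
    using finite_net[OF linC \<epsilon>] by blast
  obtain F2 where F2: "finite F2" "\<And>z. \<exists>f\<in>F2. \<forall>x. norm (C2 z *v x) \<le> \<bar>z \<bullet> f\<bar> * norm x"
      "\<And>z f. f \<in> F2 \<Longrightarrow> \<bar>z \<bullet> f\<bar> \<le> (1 + \<epsilon>) * op_norm (C2 z)"
    using finite_net[OF linC2 \<epsilon>] by blast
  define F where "F = F1 \<union> F2"
  have fin: "finite F" by (simp add: F_def F1 F2)
  have d1: "\<exists>f\<in>F. \<forall>x. norm (C z *v x) \<le> \<bar>z \<bullet> f\<bar> * norm x" for z using F1(2)[of z] by (auto simp: F_def)
  have d2: "\<exists>f\<in>F. \<forall>x. norm (C2 z *v x) \<le> \<bar>z \<bullet> f\<bar> * norm x" for z using F2(2)[of z] by (auto simp: F_def)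
  \<comment> \<open>\<theta> = (1 + \<epsilon>)(1 - \<epsilon>) bounds all functionals where both
    norms are at most 1 - \<epsilon>. The coefficient of the penalty grows linearly in the exponent
    and the powers of \<theta> decay geometrically.\<close>
  define \<theta> where "\<theta> = 1 - \<epsilon>\<^sup>2"
  have \<theta>: "0 \<le> \<theta>" "\<theta> < 1" using \<epsilon> by (auto simp: \<theta>_def power_le_one)
  have "(\<lambda>j. real j * \<theta> ^ j) \<longlonglongrightarrow> 0" using powser_times_n_limit_0[of \<theta>] \<theta> by simp
  then have "(\<lambda>j. (\<kappa> * real (card F)) * (real j * \<theta> ^ j)) \<longlonglongrightarrow> (\<kappa> * real (card F)) * 0"
    by (rule tendsto_mult_left)
  then have "\<forall>\<^sub>F j in sequentially. (\<kappa> * real (card F)) * (real j * \<theta> ^ j) < \<epsilon>"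
    using \<epsilon> by (intro order_tendstoD) auto
  then obtain j0 where j0: "\<And>j. j0 \<le> j \<Longrightarrow> (\<kappa> * real (card F)) * (real j * \<theta> ^ j) < \<epsilon>"
    by (auto simp: eventually_sequentially)
  define N where "N = max n j0"
  have small: "\<kappa> * real (2*N+2) * penal F N z \<le> \<epsilon>" if z: "op_norm (C z) \<le> 1 - \<epsilon>" "op_norm (C2 z) \<le> 1 - \<epsilon>" for z
  proof -
    have "\<bar>z \<bullet> f\<bar> \<le> \<theta>" if "f \<in> F" for f
    proof -
      have "\<bar>z \<bullet> f\<bar> \<le> (1 + \<epsilon>) * op_norm (C z) \<or> \<bar>z \<bullet> f\<bar> \<le> (1 + \<epsilon>) * op_norm (C2 z)"
        using that F1(3) F2(3) by (auto simp: F_def)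
      moreover have "(1 + \<epsilon>) * op_norm (C z) \<le> (1 + \<epsilon>) * (1 - \<epsilon>)" "(1 + \<epsilon>) * op_norm (C2 z) \<le> (1 + \<epsilon>) * (1 - \<epsilon>)"
        using z \<epsilon> by (auto intro!: mult_left_mono)
      moreover have "(1 + \<epsilon>) * (1 - \<epsilon>) = \<theta>" by (simp add: \<theta>_def power2_eq_square algebra_simps)
      ultimately show ?thesis by linarith
    qed
    then have "(z \<bullet> f) ^ (2*N+2) \<le> \<theta> ^ (2*N+2)" if "f \<in> F" for f
      using that power_mono[of "\<bar>z \<bullet> f\<bar>" \<theta> "2*N+2"] by (simp add: power_even_abs del: power_Suc)
    then have "penal F N z \<le> (\<Sum>f\<in>F. \<theta> ^ (2*N+2))"
      unfolding penal_def by (intro sum_mono) auto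
    then have "\<kappa> * real (2*N+2) * penal F N z \<le> \<kappa> * real (2*N+2) * (real (card F) * \<theta> ^ (2*N+2))"
      by (intro mult_left_mono) (auto simp: \<kappa>_def)
    also have "\<dots> = (\<kappa> * real (card F)) * (real (2*N+2) * \<theta> ^ (2*N+2))" by (simp only: mult_ac)
    also have "\<dots> < \<epsilon>" by (rule j0) (simp add: N_def)
    finally show ?thesis by simp
  qed
  have big: "1 \<le> penal F N z" if z: "z \<notin> \<Omega>" for z
  proof -
    obtain f where f: "f \<in> F" "1 \<le> \<bar>z \<bullet> f\<bar>"
    proof -
      obtain f where f: "f \<in> F" "\<forall>x. norm (C z *v x) \<le> \<bar>z \<bullet> f\<bar> * norm x" using d1 by blast
      obtain f' where f': "f' \<in> F" "\<forall>x. norm (C2 z *v x) \<le> \<bar>z \<bullet> f'\<bar> * norm x" using d2 by blast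
      have "op_norm (C z) \<le> \<bar>z \<bullet> f\<bar>" "op_norm (C2 z) \<le> \<bar>z \<bullet> f'\<bar>"
        using f f' by (auto intro!: op_norm_le)
      then have "1 \<le> \<bar>z \<bullet> f\<bar> \<or> 1 \<le> \<bar>z \<bullet> f'\<bar>" using z by (auto simp: \<Omega>_def)
      then show ?thesis using that f f' by blast
    qed
    have "1 \<le> \<bar>z \<bullet> f\<bar> ^ (2*N+2)" by (rule one_le_power[OF f(2)])
    then show ?thesis using penal_ge[OF fin f(1), of z N] by linarith
  qed
  have "penalized F C" "penalized F C2"
    using fin linC linC2 symC symC2 d1 d2 by (auto simp: penalized_def)
  then show ?thesis
    using fin small big unfolding \<epsilon>_def by (intro exI[of _ F] exI[of _ N]) (auto simp: N_def)
qed

text \<open>Off \<Omega> the penalty is at least 1 and its effective coefficient at least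
  \<open>n\<close>, which forces decay to 0. Inside \<Omega> the point eventually has both norms
  below \<open>1 - 1 / real (n+2)\<close>, where the penalty tends to 0 even when multiplied by
  \<open>k n\<close>. The Gaussian bound is uniform in \<open>n\<close>, as dominated convergence
  will require.\<close>

lemma approximating_sequence:
  obtains W :: "nat \<Rightarrow> 'a \<Rightarrow> real^'m^'m" and K :: real where
    "\<And>n. continuous_on UNIV (W n)" "0 \<le> K" "\<And>n z. norm (W n z) \<le> K * exp (- (z \<bullet> z) / 2)"
    "\<And>z. (\<lambda>n. W n z) \<longlonglongrightarrow> G z"
    "\<And>n L x. 0 < L \<Longrightarrow> 0 \<le> (\<integral>z. indicator {z. \<forall>b\<in>Basis. \<bar>z \<bullet> b\<bar> \<le> L} z *\<^sub>R (W n z *v (\<Sum>b\<in>Basis. (z \<bullet> b) *\<^sub>R x b)) \<partial>lborel) \<bullet>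
      (matrix_inv (\<integral>z. indicator {z. \<forall>b\<in>Basis. \<bar>z \<bullet> b\<bar> \<le> L} z *\<^sub>R W n z \<partial>lborel) *v
        (\<integral>z. indicator {z. \<forall>b\<in>Basis. \<bar>z \<bullet> b\<bar> \<le> L} z *\<^sub>R (W n z *v (\<Sum>b\<in>Basis. (z \<bullet> b) *\<^sub>R x b)) \<partial>lborel))
    - (\<integral>z. indicator {z. \<forall>b\<in>Basis. \<bar>z \<bullet> b\<bar> \<le> L} z *\<^sub>R ((\<Sum>b\<in>Basis. (z \<bullet> b) *\<^sub>R x b) \<bullet> (W n z *v (\<Sum>b\<in>Basis. (z \<bullet> b) *\<^sub>R x b))
        - (\<Sum>b\<in>Basis. x b \<bullet> (W n z *v x b))) \<partial>lborel)"
proof -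
  define P where "P n F N \<longleftrightarrow> finite F \<and> penalized F C \<and> penalized F C2 \<and> n \<le> N \<and>
     (\<forall>z. op_norm (C z) \<le> 1 - 1 / real (n+2) \<longrightarrow> op_norm (C2 z) \<le> 1 - 1 / real (n+2) \<longrightarrow>
        \<kappa> * real (2*N+2) * penal F N z \<le> 1 / real (n+2)) \<and>
     (\<forall>z. z \<notin> \<Omega> \<longrightarrow> 1 \<le> penal F N z)" for n F N
  have "\<forall>n. \<exists>F N. P n F N" unfolding P_def using approximation_data by blast
  then obtain F where "\<forall>n. \<exists>N. P n (F n) N" using choice[of "\<lambda>n F. \<exists>N. P n F N"] by blast
  then obtain N where P: "\<forall>n. P n (F n) (N n)" using choice[of "\<lambda>n N. P n (F n) N"] by blast
  note FN = P[rule_format, unfolded P_def]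
  define k where "k n = \<kappa> * real (2 * N n + 2)" for n
  define q where "q = real (8 * CARD('m) + 8 * CARD('k))"
  have \<kappa>1: "1 \<le> \<kappa>"
  proof -
    have "1 \<le> CARD('m) + CARD('k)" using zero_less_card_finite[where 'a='m] by linarith
    then have "real 1 \<le> real (CARD('m) + CARD('k))" by (rule of_nat_mono)
    then show ?thesis unfolding \<kappa>_def by simp
  qed
  \<comment> \<open>\<open>q\<close> is the part of the penalty spent in \<open>W_norm\<close> on
    the growth of the determinants.\<close>
  have kq: "real n \<le> k n - q" for n
  proof -
    have "1 * real n \<le> \<kappa> * real n" using \<kappa>1 by (rule mult_right_mono) simp
    moreover have "q \<le> \<kappa>" by (simp add: q_def \<kappa>_def)
    ultimately have "q + real n \<le> \<kappa> * 1 + \<kappa> * real n" by simp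
    also have "\<dots> = \<kappa> * (1 + real n)" by (simp add: algebra_simps)
    also have "\<dots> \<le> k n" unfolding k_def using \<kappa>1 FN[of n] by (intro mult_left_mono) auto
    finally show ?thesis by simp
  qed
  have ap: "approximant (F n) (N n) C C2 (k n)" for n
  proof -
    interpret P: penalized "F n" "N n" C using FN by blast
    interpret P2: penalized "F n" "N n" C2 using FN by blast
    show ?thesis
    proof
      show "4 * (2 * (real (2 * N n + 2) * real CARD('m)) + 2 * (real (2 * N n + 2) * real CARD('k))) \<le> k n"
        by (simp add: k_def \<kappa>_def algebra_simps)
    qed
  qed
  define U where "U n = apx (F n) (N n) C C2 (k n)" for n
  define K where "K = real CARD('m) ^ 2 * (fact CARD('m) ^ 8 * fact CARD('k) ^ 8 * 2 ^ (8 * CARD('m) + 8 * CARD('k)))"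
  have K: "0 \<le> K" by (simp add: K_def)
  have cont: "continuous_on UNIV (U n)" for n
  proof -
    interpret approximant "F n" "N n" C C2 "k n" by (rule ap)
    show ?thesis using continuous_W by (simp add: U_def W_apx)
  qed
  have Un: "norm (U n z) \<le> K * exp (- (z \<bullet> z) / 2) * exp (- (k n - q) * penal (F n) (N n) z)" for n z
  proof -
    interpret approximant "F n" "N n" C C2 "k n" by (rule ap)
    show ?thesis using W_norm[of z] unfolding W_apx U_def K_def q_def .
  qed
  have bound: "norm (U n z) \<le> K * exp (- (z \<bullet> z) / 2)" for n z
  proof -
    have "exp (- (k n - q) * penal (F n) (N n) z) \<le> 1"
      using kq[of n] penal_nonneg[of "F n" "N n" z] by (simp add: mult_nonpos_nonneg)
    then have "K * exp (- (z \<bullet> z) / 2) * exp (- (k n - q) * penal (F n) (N n) z) \<le> K * exp (- (z \<bullet> z) / 2) * 1"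
      using K by (intro mult_left_mono) auto
    with Un[of n z] show ?thesis by simp
  qed
  have lim: "(\<lambda>n. U n z) \<longlonglongrightarrow> G z" for z
  proof (cases "z \<in> \<Omega>")
    case False
    have b: "norm (U n z) \<le> K * exp (- (z \<bullet> z) / 2) * exp (- real n)" for n
    proof -
      have "real n * 1 \<le> (k n - q) * penal (F n) (N n) z"
        using kq[of n] FN[of n] False by (intro mult_mono) auto
      then have "exp (- (k n - q) * penal (F n) (N n) z) \<le> exp (- real n)"
        by (simp only: exp_le_cancel_iff mult_minus_left neg_le_iff_le mult_1_right)
      then have "K * exp (- (z \<bullet> z) / 2) * exp (- (k n - q) * penal (F n) (N n) z) \<le> K * exp (- (z \<bullet> z) / 2) * exp (- real n)"
        using K by (intro mult_left_mono) auto
      with Un[of n z] show ?thesis by linarith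
    qed
    have "(\<lambda>n. K * exp (- (z \<bullet> z) / 2) * exp (- real n)) \<longlonglongrightarrow> K * exp (- (z \<bullet> z) / 2) * 0"
    proof -
      have "filterlim (\<lambda>n. - real n) at_bot sequentially"
        by (simp add: filterlim_uminus_at_bot filterlim_real_sequentially)
      from filterlim_compose[OF exp_at_bot this] show ?thesis by (rule tendsto_mult_left)
    qed
    then have t: "(\<lambda>n. K * exp (- (z \<bullet> z) / 2) * exp (- real n)) \<longlonglongrightarrow> 0" by (simp only: mult_zero_right)
    have "(\<lambda>n. U n z) \<longlonglongrightarrow> 0"
      by (rule Lim_null_comparison[OF always_eventually[OF allI[OF b]] t])
    then show ?thesis using False by (simp add: G_eq wt_eq)
  next
    case True
    \<comment> \<open>The distance of the larger norm from 1; once \<open>1 / real (n+2)\<close> is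
      below it, the smallness clause of \<open>P\<close> applies at \<open>z\<close>.\<close>
    define \<delta> where "\<delta> = 1 - max (op_norm (C z)) (op_norm (C2 z))"
    have \<delta>: "0 < \<delta>" using True by (auto simp: \<delta>_def \<Omega>_def)
    have inv0: "(\<lambda>n. 1 / real (n+2)) \<longlonglongrightarrow> 0"
      using LIMSEQ_ignore_initial_segment[OF lim_1_over_n, of 2] by simp
    have ev: "\<forall>\<^sub>F n in sequentially. 1 / real (n+2) < \<delta>"
      using inv0 \<delta> by (rule order_tendstoD)
    have ev2: "\<forall>\<^sub>F n in sequentially. norm (k n * penal (F n) (N n) z) \<le> 1 / real (n+2)"
      using ev
    proof eventually_elim
      case (elim n)
      have "op_norm (C z) \<le> 1 - 1 / real (n+2)" "op_norm (C2 z) \<le> 1 - 1 / real (n+2)"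
        using elim unfolding \<delta>_def by linarith+
      then have "k n * penal (F n) (N n) z \<le> 1 / real (n+2)" using FN[of n] by (simp add: k_def)
      moreover have "0 \<le> k n * penal (F n) (N n) z"
        using penal_nonneg[of "F n" "N n" z] \<kappa>1 by (simp add: k_def)
      ultimately show ?case by simp
    qed
    have kp: "(\<lambda>n. k n * penal (F n) (N n) z) \<longlonglongrightarrow> 0"
      by (rule Lim_null_comparison[OF ev2 inv0])
    have b: "norm (penal (F n) (N n) z) \<le> k n * penal (F n) (N n) z" for n
    proof -
      have "1 * 1 \<le> k n" unfolding k_def using \<kappa>1 by (intro mult_mono) auto
      then have "1 * penal (F n) (N n) z \<le> k n * penal (F n) (N n) z"
        using penal_nonneg by (intro mult_right_mono) auto
      then show "norm (penal (F n) (N n) z) \<le> k n * penal (F n) (N n) z"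
        using penal_nonneg[of "F n" "N n" z] by simp
    qed
    have p0: "(\<lambda>n. penal (F n) (N n) z) \<longlonglongrightarrow> 0"
      by (rule Lim_null_comparison[OF always_eventually[OF allI[OF b]] kp])
    have "(\<lambda>n. (exp (- (k n * penal (F n) (N n) z)) * exp (- (z \<bullet> z) / 2) *
       (det ((1 + penal (F n) (N n) z) *\<^sub>R mat 1 + C z) * det ((1 + penal (F n) (N n) z) *\<^sub>R mat 1 - C z) *
        det ((1 + penal (F n) (N n) z) *\<^sub>R mat 1 + C2 z) * det ((1 + penal (F n) (N n) z) *\<^sub>R mat 1 - C2 z)) ^ 4) *\<^sub>R
         matrix_inv ((1 + penal (F n) (N n) z) *\<^sub>R mat 1 + C z)) \<longlonglongrightarrow>
      (exp (- 0) * exp (- (z \<bullet> z) / 2) *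
       (det ((1 + 0) *\<^sub>R mat 1 + C z) * det ((1 + 0) *\<^sub>R mat 1 - C z) *
        det ((1 + 0) *\<^sub>R mat 1 + C2 z) * det ((1 + 0) *\<^sub>R mat 1 - C2 z)) ^ 4) *\<^sub>R
         matrix_inv ((1 + 0) *\<^sub>R mat 1 + C z)"
      using posdef_invertible[OF pdP[OF True]]
      by (intro tendsto_scaleR tendsto_mult tendsto_exp tendsto_minus kp tendsto_const tendsto_power tendsto_det
          tendsto_matrix_inv tendsto_add tendsto_diff p0) simp
    then show ?thesis
      using True by (simp add: U_def apx_def G_eq wt_eq wdet_def)
  qed
  show ?thesis
  proof (rule that[OF cont K bound lim])
    fix n :: nat and L :: real and x :: "'a \<Rightarrow> real^'m"
    assume L: "0 < L"
    interpret approximant "F n" "N n" C C2 "k n" by (rule ap)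
    note Brascamp_Lieb_box[OF L, of x, unfolded W_apx, folded U_def]
    then show "0 \<le> (\<integral>z. indicator {z. \<forall>b\<in>Basis. \<bar>z \<bullet> b\<bar> \<le> L} z *\<^sub>R (U n z *v (\<Sum>b\<in>Basis. (z \<bullet> b) *\<^sub>R x b)) \<partial>lborel) \<bullet>
      (matrix_inv (\<integral>z. indicator {z. \<forall>b\<in>Basis. \<bar>z \<bullet> b\<bar> \<le> L} z *\<^sub>R U n z \<partial>lborel) *v
        (\<integral>z. indicator {z. \<forall>b\<in>Basis. \<bar>z \<bullet> b\<bar> \<le> L} z *\<^sub>R (U n z *v (\<Sum>b\<in>Basis. (z \<bullet> b) *\<^sub>R x b)) \<partial>lborel))
    - (\<integral>z. indicator {z. \<forall>b\<in>Basis. \<bar>z \<bullet> b\<bar> \<le> L} z *\<^sub>R ((\<Sum>b\<in>Basis. (z \<bullet> b) *\<^sub>R x b) \<bullet> (U n z *v (\<Sum>b\<in>Basis. (z \<bullet> b) *\<^sub>R x b))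
        - (\<Sum>b\<in>Basis. x b \<bullet> (U n z *v x b))) \<partial>lborel)" .
  qed
qed

end

section \<open>Continuity and bounds of the truncated weight\<close>

text \<open>The fourth power of \<open>pdet\<close> is \<open>wdet\<close>. It is continuous
  everywhere and vanishes as soon as one of two symmetric matrices has norm 1, so a bound by a
  multiple of its modulus controls the truncated functions at the edge of the truncation.\<close>

definition pdet :: "real^'m^'m \<Rightarrow> real^'k^'k \<Rightarrow> real" where
  "pdet A B = det (mat 1 + A) * det (mat 1 - A) * det (mat 1 + B) * det (mat 1 - B)"

definition dbound :: "'m::finite itself \<Rightarrow> real" where
  "dbound _ = fact CARD('m) * 2 ^ CARD('m)"

lemma dbound_nonneg: "0 \<le> dbound t"
  by (simp add: dbound_def)

lemma one_pm_entry:
  fixes A :: "real^'m^'m"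
  assumes "op_norm A \<le> 1"
  shows "\<bar>(mat 1 + A) $ i $ j\<bar> \<le> 2" "\<bar>(mat 1 - A) $ i $ j\<bar> \<le> 2"
  using entry_le_norm[of A i j] op_norm_vec[of A "axis j 1"] assms
  by (auto simp: mat_def abs_le_iff)

lemma det_one_pm_bound:
  fixes A :: "real^'m^'m"
  assumes "op_norm A \<le> 1"
  shows "\<bar>det (mat 1 + A)\<bar> \<le> dbound TYPE('m)" "\<bar>det (mat 1 - A)\<bar> \<le> dbound TYPE('m)"
  unfolding dbound_def by (intro det_bound one_pm_entry assms)+

lemma pdet_bound:
  fixes A :: "real^'m^'m" and B :: "real^'k^'k"
  assumes "op_norm A \<le> 1" "op_norm B \<le> 1"
  shows "\<bar>pdet A B\<bar> \<le> dbound TYPE('m) ^ 2 * dbound TYPE('k) ^ 2"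
proof -
  have "\<bar>pdet A B\<bar> \<le> dbound TYPE('m) * dbound TYPE('m) * dbound TYPE('k) * dbound TYPE('k)"
    unfolding pdet_def abs_mult
    by (intro mult_mono det_one_pm_bound assms) (auto simp: dbound_nonneg)
  then show ?thesis by (simp add: power2_eq_square mult_ac)
qed

lemma trunc_w_bound:
  fixes A :: "real^'m^'m" and B :: "real^'k^'k"
  shows "\<bar>trunc_w A B\<bar> \<le> (dbound TYPE('m) ^ 2 * dbound TYPE('k) ^ 2) ^ 3 * \<bar>pdet A B\<bar>"
proof (cases "op_norm A < 1 \<and> op_norm B < 1")
  case True
  have "\<bar>pdet A B\<bar> ^ 3 * \<bar>pdet A B\<bar> \<le> (dbound TYPE('m) ^ 2 * dbound TYPE('k) ^ 2) ^ 3 * \<bar>pdet A B\<bar>"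
    using True by (intro mult_right_mono power_mono pdet_bound) auto
  moreover have "trunc_w A B = pdet A B ^ 4" using True by (simp add: trunc_w_def wdet_def pdet_def)
  moreover have "\<bar>t ^ 4\<bar> = \<bar>t\<bar> ^ 3 * \<bar>t\<bar>" for t :: real
    by (simp only: power4_eq_xxxx power3_eq_cube abs_mult)
  ultimately show ?thesis by metis
qed (auto simp: trunc_w_def intro!: mult_nonneg_nonneg dbound_nonneg)

definition Qbound :: "'m::finite itself \<Rightarrow> 'k::finite itself \<Rightarrow> real" where
  "Qbound t u = real CARD('m) ^ 2 * (dbound t * (dbound t * dbound u * dbound u) * (dbound t ^ 2 * dbound u ^ 2) ^ 2)"

text \<open>Of the four copies of \<open>pdet\<close>, one gives its factor
  \<open>det (mat 1 + A)\<close> to the inverse and so produces the adjugate, two are bounded by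
  constants, and the last is kept.\<close>

lemma trunc_Q_bound:
  fixes A :: "real^'m^'m" and B :: "real^'k^'k"
  assumes "transpose A = A" "transpose B = B"
  shows "norm (trunc_Q A B) \<le> Qbound TYPE('m) TYPE('k) * \<bar>pdet A B\<bar>"
proof (cases "op_norm A < 1 \<and> op_norm B < 1")
  case True
  let ?m = "dbound TYPE('m)" and ?k = "dbound TYPE('k)"
  let ?I = "matrix_inv (mat 1 + A)"
  have n: "op_norm A \<le> 1" "op_norm B \<le> 1" using True by auto
  have ne: "det (mat 1 + A) \<noteq> 0" using posdef_det_pos[OF posdef_one_plus[OF assms(1)]] True by simp
  have e: "\<bar>trunc_Q A B $ i $ j\<bar> \<le> ?m * (?m * ?k * ?k) * (?m ^ 2 * ?k ^ 2) ^ 2 * \<bar>pdet A B\<bar>" for i j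
  proof -
    have "trunc_Q A B $ i $ j = (det (mat 1 + A) * ?I $ i $ j) *
        (det (mat 1 - A) * det (mat 1 + B) * det (mat 1 - B)) * pdet A B ^ 2 * pdet A B"
      using True by (simp add: trunc_Q_def trunc_w_def wdet_def pdet_def power_mult_distrib eval_nat_numeral mult_ac)
    then have "\<bar>trunc_Q A B $ i $ j\<bar> = \<bar>det (mat 1 + A) * ?I $ i $ j\<bar> *
        (\<bar>det (mat 1 - A)\<bar> * \<bar>det (mat 1 + B)\<bar> * \<bar>det (mat 1 - B)\<bar>) * \<bar>pdet A B\<bar> ^ 2 * \<bar>pdet A B\<bar>"
      by (simp add: abs_mult power_abs)
    also have "\<dots> \<le> ?m * (?m * ?k * ?k) * (?m ^ 2 * ?k ^ 2) ^ 2 * \<bar>pdet A B\<bar>"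
      using det_inv_bound[OF one_pm_entry(1)[OF n(1)] _ ne, of i j]
      by (intro mult_mono power_mono det_one_pm_bound pdet_bound n)
        (auto simp: dbound_nonneg dbound_def[symmetric] intro!: mult_nonneg_nonneg simp: dbound_def)
    finally show ?thesis .
  qed
  have "norm (trunc_Q A B) \<le> (\<Sum>i\<in>(UNIV::'m set). \<Sum>j\<in>(UNIV::'m set). ?m * (?m * ?k * ?k) * (?m ^ 2 * ?k ^ 2) ^ 2 * \<bar>pdet A B\<bar>)"
    by (rule order_trans[OF norm_matrix_le]) (intro sum_mono e)
  then show ?thesis by (simp add: Qbound_def power2_eq_square mult_ac)
qed (auto simp: trunc_Q_def trunc_w_def Qbound_def intro!: mult_nonneg_nonneg dbound_nonneg)

lemma tendsto_pdet:
  assumes "(f \<longlongrightarrow> A) F" "(g \<longlongrightarrow> B) F"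
  shows "((\<lambda>x. pdet (f x) (g x)) \<longlongrightarrow> pdet A B) F"
  unfolding pdet_def by (intro tendsto_intros assms)

text \<open>Outside the open region there are two cases. If \<open>pdet A B = 0\<close>, the bounds
  by \<open>pdet\<close> force the limit 0. Otherwise neither norm equals 1, so one of them exceeds
  1, and the truncated functions are eventually 0.\<close>

lemma tendsto_trunc:
  fixes f :: "'a \<Rightarrow> real^'m^'m" and g :: "'a \<Rightarrow> real^'k^'k"
  assumes f: "(f \<longlongrightarrow> A) F" and g: "(g \<longlongrightarrow> B) F"
    and sym: "\<And>x. transpose (f x) = f x" "\<And>x. transpose (g x) = g x" "transpose A = A" "transpose B = B"
  shows "((\<lambda>x. trunc_w (f x) (g x)) \<longlongrightarrow> trunc_w A B) F" "((\<lambda>x. trunc_Q (f x) (g x)) \<longlongrightarrow> trunc_Q A B) F"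
proof -
  note nf = tendsto_op_norm[OF f] and ng = tendsto_op_norm[OF g]
  have "((\<lambda>x. trunc_w (f x) (g x)) \<longlongrightarrow> trunc_w A B) F \<and> ((\<lambda>x. trunc_Q (f x) (g x)) \<longlongrightarrow> trunc_Q A B) F"
  proof (cases "op_norm A < 1 \<and> op_norm B < 1")
    case True
    have ev: "\<forall>\<^sub>F x in F. wdet (f x) (g x) = trunc_w (f x) (g x)"
      using order_tendstoD(2)[OF nf, of 1] order_tendstoD(2)[OF ng, of 1] True
      by (auto elim: eventually_elim2 simp: trunc_w_def)
    have "((\<lambda>x. wdet (f x) (g x)) \<longlongrightarrow> wdet A B) F" unfolding wdet_def by (intro tendsto_intros f g)
    then have 1: "((\<lambda>x. trunc_w (f x) (g x)) \<longlongrightarrow> trunc_w A B) F"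
      using Lim_transform_eventually[OF _ ev] True by (simp add: trunc_w_def)
    then show ?thesis unfolding trunc_Q_def
      using posdef_invertible[OF posdef_one_plus[OF sym(3)]] True
      by (auto intro!: tendsto_scaleR tendsto_matrix_inv tendsto_add tendsto_const f)
  next
    case False
    then have 0: "trunc_w A B = 0" "trunc_Q A B = 0" by (auto simp: trunc_w_def trunc_Q_def)
    show ?thesis
    proof (cases "pdet A B = 0")
      case True
      have z: "((\<lambda>x. c * \<bar>pdet (f x) (g x)\<bar>) \<longlongrightarrow> 0) F" for c
        using tendsto_mult_left[OF tendsto_rabs[OF tendsto_pdet[OF f g]], of c] True by simp
      have w: "norm (trunc_w (f x) (g x)) \<le> (dbound TYPE('m) ^ 2 * dbound TYPE('k) ^ 2) ^ 3 * \<bar>pdet (f x) (g x)\<bar>" for x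
        using trunc_w_bound by simp
      show ?thesis unfolding 0
        using Lim_null_comparison[OF always_eventually[OF allI[OF trunc_Q_bound[OF sym(1,2)]]] z]
          Lim_null_comparison[OF always_eventually[OF allI[OF w]] z] by simp
    next
      case ne: False
      have "op_norm A \<noteq> 1" using det_zero_of_op_norm_1[OF sym(3)] ne by (auto simp: pdet_def)
      moreover have "op_norm B \<noteq> 1" using det_zero_of_op_norm_1[OF sym(4)] ne by (auto simp: pdet_def)
      ultimately have "1 < op_norm A \<or> 1 < op_norm B" using False by linarith
      then have ev: "\<forall>\<^sub>F x in F. 1 < op_norm (f x) \<or> 1 < op_norm (g x)"
        using order_tendstoD(1)[OF nf, of 1] order_tendstoD(1)[OF ng, of 1] by (auto elim: eventually_mono)
      have "\<forall>\<^sub>F x in F. 0 = trunc_w (f x) (g x)" "\<forall>\<^sub>F x in F. 0 = trunc_Q (f x) (g x)"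
        using ev by (auto elim!: eventually_mono simp: trunc_w_def trunc_Q_def)
      then show ?thesis unfolding 0 by (auto intro: Lim_transform_eventually[OF tendsto_const])
    qed
  qed
  then show "((\<lambda>x. trunc_w (f x) (g x)) \<longlongrightarrow> trunc_w A B) F" "((\<lambda>x. trunc_Q (f x) (g x)) \<longlongrightarrow> trunc_Q A B) F" by auto
qed

lemma trunc_bounded:
  fixes A :: "real^'m^'m" and B :: "real^'k^'k"
  assumes "transpose A = A" "transpose B = B"
  shows "\<bar>trunc_w A B\<bar> \<le> (dbound TYPE('m) ^ 2 * dbound TYPE('k) ^ 2) ^ 4"
    "norm (trunc_Q A B) \<le> Qbound TYPE('m) TYPE('k) * (dbound TYPE('m) ^ 2 * dbound TYPE('k) ^ 2)"
proof -
  let ?d = "dbound TYPE('m) ^ 2 * dbound TYPE('k) ^ 2"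
  have Q: "0 \<le> Qbound TYPE('m) TYPE('k)" by (simp add: Qbound_def dbound_nonneg)
  have "\<bar>trunc_w A B\<bar> \<le> ?d ^ 4 \<and> norm (trunc_Q A B) \<le> Qbound TYPE('m) TYPE('k) * ?d"
  proof (cases "op_norm A < 1 \<and> op_norm B < 1")
    case True
    then have p: "\<bar>pdet A B\<bar> \<le> ?d" by (intro pdet_bound) auto
    have "?d ^ 3 * \<bar>pdet A B\<bar> \<le> ?d ^ 3 * ?d" by (intro mult_left_mono p) auto
    also have "\<dots> = ?d ^ 4" by (simp add: eval_nat_numeral)
    finally have "\<bar>trunc_w A B\<bar> \<le> ?d ^ 4" using trunc_w_bound[of A B] by linarith
    moreover have "norm (trunc_Q A B) \<le> Qbound TYPE('m) TYPE('k) * ?d"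
      by (rule order_trans[OF trunc_Q_bound[OF assms] mult_left_mono[OF p Q]])
    ultimately show ?thesis ..
  qed (use Q in \<open>auto simp: trunc_w_def trunc_Q_def\<close>)
  then show "\<bar>trunc_w A B\<bar> \<le> ?d ^ 4" "norm (trunc_Q A B) \<le> Qbound TYPE('m) TYPE('k) * ?d" by auto
qed

section \<open>Reflection, integrability and the passage to the limit\<close>

lemma lborel_uminus: "distr lborel borel uminus = (lborel :: 'a::euclidean_space measure)"
  using lborel_affine[of "- 1 :: real" "0 :: 'a", symmetric] by (simp add: density_1)

lemma integral_uminus:
  fixes f :: "'a::euclidean_space \<Rightarrow> 'b::{banach, second_countable_topology}"
  assumes "f \<in> borel_measurable borel"
  shows "(\<integral>z. f (- z) \<partial>lborel) = (\<integral>z. f z \<partial>lborel)"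
  by (subst (2) lborel_uminus[symmetric], subst integral_distr) (use assms in auto)

lemma integral_odd:
  fixes f :: "'a::euclidean_space \<Rightarrow> 'b::{banach, second_countable_topology}"
  assumes "f \<in> borel_measurable borel" "\<And>z. f (- z) = - f z"
  shows "(\<integral>z. f z \<partial>lborel) = 0"
proof -
  have "(\<integral>z. f z \<partial>lborel) = - (\<integral>z. f z \<partial>lborel)"
    using integral_uminus[OF assms(1)] by (simp add: assms(2))
  then have "(2::real) *\<^sub>R (\<integral>z. f z \<partial>lborel) = 0"
    by (simp add: scaleR_2 eq_neg_iff_add_eq_0)
  then show ?thesis by simp
qed

lemma gauss_poly_bound: "(1 + z \<bullet> z) * exp (- (z \<bullet> z) / 2) \<le> 4 * exp (- (z \<bullet> z) / 4)"
  for z :: "'a::euclidean_space"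
proof -
  have "1 + z \<bullet> z \<le> 4 * exp (z \<bullet> z / 4)" using exp_ge_add_one_self[of "z \<bullet> z / 4"] by linarith
  then have "(1 + z \<bullet> z) * exp (- (z \<bullet> z) / 2) \<le> (4 * exp (z \<bullet> z / 4)) * exp (- (z \<bullet> z) / 2)"
    by (intro mult_right_mono) auto
  also have "\<dots> = 4 * exp (- (z \<bullet> z) / 4)" by (simp add: mult.assoc exp_add[symmetric])
  finally show ?thesis .
qed

lemma integrable_poly_gauss: "integrable lborel (\<lambda>z::'a::euclidean_space. (1 + z \<bullet> z) * exp (- (z \<bullet> z) / 2))"
proof (rule Bochner_Integration.integrable_bound[OF integrable_mult_right[OF integrable_gaussian, of 4]])
  show "AE z::'a in lborel. norm ((1 + z \<bullet> z) * exp (- (z \<bullet> z) / 2)) \<le> norm (4 * exp (- (z \<bullet> z) / 4))"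
    using gauss_poly_bound by (intro AE_I2) simp
qed measurable

lemma integrable_gauss_dom:
  fixes f :: "'a::euclidean_space \<Rightarrow> 'b::{banach, second_countable_topology}"
  assumes "f \<in> borel_measurable borel" "\<And>z. norm (f z) \<le> D * ((1 + z \<bullet> z) * exp (- (z \<bullet> z) / 2))"
  shows "integrable lborel f"
proof (rule Bochner_Integration.integrable_bound[OF integrable_mult_right[OF integrable_poly_gauss, of D]])
  show "AE z in lborel. norm (f z) \<le> norm (D * ((1 + z \<bullet> z) * exp (- (z \<bullet> z) / 2)))"
    using assms(2) by (intro AE_I2) (smt (verit) real_norm_def)
qed (use assms in simp)

context sym_pair begin

lemma continuous_wt: "continuous_on UNIV wt" and continuous_G: "continuous_on UNIV G"
proof -
  have "C \<midarrow>z\<rightarrow> C z" "C2 \<midarrow>z\<rightarrow> C2 z" for z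
    using contC[of UNIV] by (auto simp: continuous_on_def)
  note t = tendsto_trunc[OF this symC symC2 symC symC2]
  show "continuous_on UNIV wt" "continuous_on UNIV G"
    unfolding wt_def G_def continuous_on_def by (auto intro!: tendsto_intros t)
qed

lemma measurable_wt [measurable]: "wt \<in> borel_measurable borel"
  by (rule borel_measurable_continuous_onI[OF continuous_wt])
lemma measurable_G [measurable]: "G \<in> borel_measurable borel"
  by (rule borel_measurable_continuous_onI[OF continuous_G])

lemma wt_uminus: "wt (- z) = wt z"
  by (simp add: wt_def trunc_w_def wdet_def linear_neg[OF linC] linear_neg[OF linC2] op_norm_uminus mult_ac)

lemma ge_gauss: "exp (- (z \<bullet> z) / 2) \<le> (1 + z \<bullet> z) * exp (- (z \<bullet> z) / 2)"
  by (simp add: algebra_simps)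

lemma wt_bound: "\<exists>D\<ge>0. \<forall>z. wt z \<le> D * exp (- (z \<bullet> z) / 2)"
  using trunc_bounded(1)[OF symC symC2] wt_nonneg
  by (intro exI[of _ "(dbound TYPE('m) ^ 2 * dbound TYPE('k) ^ 2) ^ 4"])
    (auto simp: wt_def abs_le_iff mult.commute intro!: mult_left_mono)

lemma G_bound: "\<exists>D\<ge>0. \<forall>z. norm (G z) \<le> D * exp (- (z \<bullet> z) / 2)"
proof -
  define D where "D = Qbound TYPE('m) TYPE('k) * (dbound TYPE('m) ^ 2 * dbound TYPE('k) ^ 2)"
  have "0 \<le> D" by (simp add: D_def Qbound_def dbound_nonneg)
  moreover have "norm (G z) \<le> D * exp (- (z \<bullet> z) / 2)" for z
    using mult_left_mono[OF trunc_bounded(2)[OF symC symC2, of z z, folded D_def], of "exp (- (z \<bullet> z) / 2)"]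
    by (simp add: G_def mult.commute)
  ultimately show ?thesis by blast
qed

lemma linear_growth:
  fixes c :: "'a \<Rightarrow> 'c::real_normed_vector"
  assumes "linear c"
  obtains R where "0 \<le> R" "\<And>z. norm (c z) \<le> R * norm z"
  using bounded_linear.nonneg_bounded[OF assms[unfolded linear_conv_bounded_linear]] by (auto simp: mult.commute)

lemma norm_le_gauss: "norm z \<le> 1 + z \<bullet> z" "1 \<le> 1 + z \<bullet> z" "norm z * norm z \<le> 1 + z \<bullet> z"
proof -
  have "0 \<le> (norm z - 1/2)\<^sup>2" by simp
  then show "norm z \<le> 1 + z \<bullet> z" by (simp add: power2_eq_square dot_square_norm algebra_simps)
qed (auto simp: dot_square_norm power2_eq_square)

lemma integrable_wt: "integrable lborel wt"
proof -
  obtain D where D: "0 \<le> D" "\<And>z. wt z \<le> D * exp (- (z \<bullet> z) / 2)" using wt_bound by blast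
  show ?thesis
  proof (rule integrable_gauss_dom)
    show "norm (wt z) \<le> D * ((1 + z \<bullet> z) * exp (- (z \<bullet> z) / 2))" for z
      using D(2)[of z] wt_nonneg[of z] mult_left_mono[OF ge_gauss[of z] D(1)] by simp
  qed simp
qed

lemma integrable_G: "integrable lborel G"
proof -
  obtain D where D: "0 \<le> D" "\<And>z. norm (G z) \<le> D * exp (- (z \<bullet> z) / 2)" using G_bound by blast
  show ?thesis
  proof (rule integrable_gauss_dom)
    show "norm (G z) \<le> D * ((1 + z \<bullet> z) * exp (- (z \<bullet> z) / 2))" for z
      using D(2)[of z] mult_left_mono[OF ge_gauss[of z] D(1)] by simp
  qed simp
qed

definition "Z = (\<integral>z. wt z \<partial>lborel)"
definition "M = (\<integral>z. G z \<partial>lborel)"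

lemma not_AE_outside: "\<not> (AE z in lborel. z \<notin> \<Omega>)"
proof
  assume "AE z in lborel. z \<notin> \<Omega>"
  then have "AE z in lebesgue. z \<in> - \<Omega>" by (simp add: AE_completion)
  then have "0 \<in> - \<Omega>"
    using mem_closed_if_AE_lebesgue[of "- \<Omega>" 0] open_\<Omega> by (simp add: closed_Compl)
  then show False using zero_\<Omega> by simp
qed

lemma integral_pos_on_\<Omega>:
  fixes f :: "'a \<Rightarrow> real"
  assumes "integrable lborel f" "\<And>z. 0 \<le> f z" "\<And>z. z \<in> \<Omega> \<Longrightarrow> 0 < f z"
  shows "0 < (\<integral>z. f z \<partial>lborel)"
proof -
  have "(\<integral>z. f z \<partial>lborel) \<noteq> 0"
  proof
    assume "(\<integral>z. f z \<partial>lborel) = 0"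
    then have "AE z in lborel. f z = 0"
      using integral_nonneg_eq_0_iff_AE[OF assms(1)] assms(2) by simp
    then have "AE z in lborel. z \<notin> \<Omega>"
      by eventually_elim (use assms(3) in force)
    then show False using not_AE_outside by simp
  qed
  moreover have "0 \<le> (\<integral>z. f z \<partial>lborel)" by (intro integral_nonneg_AE) (simp add: assms(2))
  ultimately show ?thesis by linarith
qed

lemma Z_pos: "0 < Z"
  unfolding Z_def by (rule integral_pos_on_\<Omega>[OF integrable_wt wt_nonneg wt_pos])

lemma blv: "bounded_linear (\<lambda>A::real^'m^'m. A *v x)"
  by (rule bounded_bilinear.bounded_linear_left[OF bounded_bilinear_matrix_vector])

lemma blvv: "bounded_linear (\<lambda>A::real^'m^'m. y \<bullet> (A *v x))"
  by (rule bounded_linear_compose[OF bounded_linear_inner_right blv])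

lemma M_quad: "y \<bullet> (M *v x) = (\<integral>z. y \<bullet> (G z *v x) \<partial>lborel)"
  unfolding M_def using integral_bounded_linear[OF blvv integrable_G] by simp

lemma integrable_quad: "integrable lborel (\<lambda>z. y \<bullet> (G z *v x))"
  by (rule integrable_bounded_linear[OF blvv integrable_G])

lemma M_posdef: "posdef M"
  unfolding posdef_def
proof (intro conjI allI impI)
  show "transpose M = M"
    by (rule symmetric_matrixI) (simp add: M_quad inner_matrix_sym[OF G_sym])
  show "0 < x \<bullet> (M *v x)" if "x \<noteq> 0" for x
    unfolding M_quad by (rule integral_pos_on_\<Omega>[OF integrable_quad G_nonneg G_pos]) (use that in auto)
qed

text \<open>Cube and approximant grow with the same index, so a single limit suffices. As
  \<open>c\<close> is linear, all integrands are dominated by multiples of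
  \<open>(1 + z \<bullet> z) * exp (- (z \<bullet> z) / 2)\<close>. The inverse of the integrated
  weight converges because its limit \<open>M\<close> is positive definite.\<close>

theorem Brascamp_Lieb:
  fixes x :: "'a \<Rightarrow> real^'m"
  defines "c \<equiv> \<lambda>z. \<Sum>b\<in>Basis. (z \<bullet> b) *\<^sub>R x b"
  shows "(\<integral>z. c z \<bullet> (G z *v c z) \<partial>lborel) - (\<Sum>b\<in>Basis. x b \<bullet> (M *v x b)) \<le>
     (\<integral>z. G z *v c z \<partial>lborel) \<bullet> (matrix_inv M *v (\<integral>z. G z *v c z \<partial>lborel))"
    and "integrable lborel (\<lambda>z. c z \<bullet> (G z *v c z))" and "integrable lborel (\<lambda>z. G z *v c z)"
proof -
  obtain W :: "nat \<Rightarrow> 'a \<Rightarrow> real^'m^'m" and K :: real where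
    cW: "\<And>n. continuous_on UNIV (W n)" and K: "0 \<le> K" and bW: "\<And>n z. norm (W n z) \<le> K * exp (- (z \<bullet> z) / 2)"
    and limW: "\<And>z. (\<lambda>n. W n z) \<longlonglongrightarrow> G z"
    and BL: "\<And>n L x. 0 < L \<Longrightarrow> 0 \<le> (\<integral>z. indicator {z. \<forall>b\<in>Basis. \<bar>z \<bullet> b\<bar> \<le> L} z *\<^sub>R (W n z *v (\<Sum>b\<in>Basis. (z \<bullet> b) *\<^sub>R x b)) \<partial>lborel) \<bullet>
      (matrix_inv (\<integral>z. indicator {z. \<forall>b\<in>Basis. \<bar>z \<bullet> b\<bar> \<le> L} z *\<^sub>R W n z \<partial>lborel) *v
        (\<integral>z. indicator {z. \<forall>b\<in>Basis. \<bar>z \<bullet> b\<bar> \<le> L} z *\<^sub>R (W n z *v (\<Sum>b\<in>Basis. (z \<bullet> b) *\<^sub>R x b)) \<partial>lborel))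
    - (\<integral>z. indicator {z. \<forall>b\<in>Basis. \<bar>z \<bullet> b\<bar> \<le> L} z *\<^sub>R ((\<Sum>b\<in>Basis. (z \<bullet> b) *\<^sub>R x b) \<bullet> (W n z *v (\<Sum>b\<in>Basis. (z \<bullet> b) *\<^sub>R x b))
        - (\<Sum>b\<in>Basis. x b \<bullet> (W n z *v x b))) \<partial>lborel)"
    by (rule approximating_sequence) (rule that)
  have cc: "continuous_on UNIV c" unfolding c_def by (intro continuous_intros)
  have lc: "linear c" unfolding c_def
    by (intro linearI) (simp_all add: inner_add_left scaleR_add_left sum.distrib scaleR_sum_right)
  obtain R where R: "0 \<le> R" "\<And>z. norm (c z) \<le> R * norm z"
    by (rule linear_growth[OF lc]) (rule that)
  obtain K0 where K0: "0 \<le> K0" "\<And>(A::real^'m^'m) v. norm (A *v v) \<le> norm A * norm v * K0"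
    using bounded_bilinear.nonneg_bounded[OF bounded_bilinear_matrix_vector[where 'm='m and 'k='m]] by blast
  let ?e = "\<lambda>z::'a. exp (- (z \<bullet> z) / 2)" and ?w = "\<lambda>z::'a. (1 + z \<bullet> z) * exp (- (z \<bullet> z) / 2)"
  define B where "B n = {z::'a. \<forall>b\<in>Basis. \<bar>z \<bullet> b\<bar> \<le> real n + 1}" for n
  have mB [measurable]: "B n \<in> sets borel" for n unfolding B_def by measurable
  have mW [measurable]: "W n \<in> borel_measurable borel" for n by (rule borel_measurable_continuous_onI[OF cW])
  have indB: "(\<lambda>n. indicator (B n) z :: real) \<longlonglongrightarrow> 1" for z
  proof (rule tendsto_eventually)
    obtain n0 :: nat where n0: "norm z \<le> real n0" using real_arch_simple by blast
    show "\<forall>\<^sub>F n in sequentially. indicator (B n) z = (1::real)"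
      using eventually_ge_at_top[of n0]
    proof eventually_elim
      case (elim n)
      have "\<bar>z \<bullet> b\<bar> \<le> real n + 1" if "b \<in> Basis" for b
        using Basis_le_norm[OF that, of z] n0 elim by simp
      then show ?case by (simp add: B_def)
    qed
  qed
  have norm_c: "K * ?e z * norm (c z) * K0 \<le> K * R * K0 * ?w z" "K * ?e z * norm (c z) * K0 * norm (c z) \<le> K * R * R * K0 * ?w z" for z
  proof -
    have "K * ?e z * norm (c z) * K0 \<le> K * ?e z * (R * (1 + z \<bullet> z)) * K0"
      using K K0 R by (intro mult_right_mono mult_left_mono order_trans[OF R(2)] norm_le_gauss) auto
    then show "K * ?e z * norm (c z) * K0 \<le> K * R * K0 * ?w z" by (simp add: mult_ac)
    have "norm (c z) * norm (c z) \<le> (R * norm z) * (R * norm z)" using R by (intro mult_mono) auto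
    also have "\<dots> = R * R * (norm z * norm z)" by simp
    also have "\<dots> \<le> R * R * (1 + z \<bullet> z)" using R by (intro mult_left_mono norm_le_gauss) auto
    finally have "K * ?e z * K0 * (norm (c z) * norm (c z)) \<le> K * ?e z * K0 * (R * R * (1 + z \<bullet> z))"
      using K K0 by (intro mult_left_mono) auto
    then show "K * ?e z * norm (c z) * K0 * norm (c z) \<le> K * R * R * K0 * ?w z" by (simp add: mult_ac)
  qed
  have W1: "norm (indicator (B n) z *\<^sub>R W n z) \<le> K * ?w z" for n z
    using bW[of n z] mult_left_mono[OF ge_gauss[of z] K] K by (auto simp: indicator_def)
  have W2': "norm (W n z *v c z) \<le> K * ?e z * norm (c z) * K0" for n z
    by (rule order_trans[OF K0(2)]) (use bW[of n z] K0 in \<open>intro mult_right_mono, auto\<close>)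
  have W2: "norm (indicator (B n) z *\<^sub>R (W n z *v c z)) \<le> K * R * K0 * ?w z" for n z
    using W2'[of n z] norm_c(1)[of z] R K K0 by (auto simp: indicator_def)
  have W3': "\<bar>c z \<bullet> (W n z *v c z)\<bar> \<le> K * R * R * K0 * ?w z" for n z
  proof -
    have "\<bar>c z \<bullet> (W n z *v c z)\<bar> \<le> norm (c z) * norm (W n z *v c z)" by (rule Cauchy_Schwarz_ineq2)
    also have "\<dots> \<le> norm (c z) * (K * ?e z * norm (c z) * K0)" by (intro mult_left_mono W2') auto
    finally show ?thesis using norm_c(2)[of z] by (simp add: mult_ac)
  qed
  have W4': "\<bar>x b \<bullet> (W n z *v x b)\<bar> \<le> (K * K0 * (norm (x b) * norm (x b))) * ?w z" for n z b
  proof -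
    have "\<bar>x b \<bullet> (W n z *v x b)\<bar> \<le> norm (x b) * norm (W n z *v x b)" by (rule Cauchy_Schwarz_ineq2)
    also have "\<dots> \<le> norm (x b) * (norm (W n z) * norm (x b) * K0)" by (intro mult_left_mono K0) auto
    also have "\<dots> = (norm (x b) * norm (x b) * K0) * norm (W n z)" by (simp only: mult_ac)
    also have "\<dots> \<le> (norm (x b) * norm (x b) * K0) * (K * ?w z)"
      using K0 bW[of n z] mult_left_mono[OF ge_gauss[of z] K] by (intro mult_left_mono) auto
    finally show ?thesis by (simp add: mult_ac)
  qed
  define D3 where "D3 = K * R * R * K0 + (\<Sum>b\<in>Basis. K * K0 * (norm (x b) * norm (x b)))"
  let ?k = "\<lambda>A z. c z \<bullet> (A *v c z) - (\<Sum>b\<in>Basis. x b \<bullet> (A *v x b))"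
  have W3: "norm (indicator (B n) z *\<^sub>R ?k (W n z) z) \<le> D3 * ?w z" for n z
  proof -
    have "\<bar>?k (W n z) z\<bar> \<le> \<bar>c z \<bullet> (W n z *v c z)\<bar> + (\<Sum>b\<in>Basis. \<bar>x b \<bullet> (W n z *v x b)\<bar>)"
      using abs_triangle_ineq4[of "c z \<bullet> (W n z *v c z)" "\<Sum>b\<in>Basis. x b \<bullet> (W n z *v x b)"]
        sum_abs[of "\<lambda>b. x b \<bullet> (W n z *v x b)" Basis] by linarith
    also have "\<dots> \<le> K * R * R * K0 * ?w z + (\<Sum>b\<in>Basis. K * K0 * (norm (x b) * norm (x b)) * ?w z)"
      by (intro add_mono W3' sum_mono W4')
    also have "\<dots> = D3 * ?w z" by (simp add: D3_def distrib_right sum_distrib_right)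
    finally have "\<bar>?k (W n z) z\<bar> \<le> D3 * ?w z" .
    moreover have "0 \<le> D3 * ?w z" using calculation by linarith
    ultimately show ?thesis by (auto simp: indicator_def)
  qed
  have mc [measurable]: "c \<in> borel_measurable borel" by (rule borel_measurable_continuous_onI[OF cc])
  have mcW: "(\<lambda>z. W n z *v c z) \<in> borel_measurable borel" for n
    by (rule borel_measurable_continuous_onI) (intro continuous_intros cW cc)
  have mcG: "(\<lambda>z. G z *v c z) \<in> borel_measurable borel"
    by (rule borel_measurable_continuous_onI) (intro continuous_intros continuous_G cc)
  have mkW: "(\<lambda>z. ?k (W n z) z) \<in> borel_measurable borel" for n
    by (rule borel_measurable_continuous_onI) (intro continuous_intros cW cc)
  have mkG: "(\<lambda>z. ?k (G z) z) \<in> borel_measurable borel"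
    by (rule borel_measurable_continuous_onI) (intro continuous_intros continuous_G cc)
  note iw = integrable_mult_right[OF integrable_poly_gauss]
  have l1: "(\<lambda>n. indicator (B n) z *\<^sub>R W n z) \<longlonglongrightarrow> G z" for z
    using tendsto_scaleR[OF indB limW] by simp
  have l2: "(\<lambda>n. indicator (B n) z *\<^sub>R (W n z *v c z)) \<longlonglongrightarrow> G z *v c z" for z
    using tendsto_scaleR[OF indB tendsto_mult_vec[OF limW tendsto_const]] by simp
  have l3: "(\<lambda>n. indicator (B n) z *\<^sub>R ?k (W n z) z) \<longlonglongrightarrow> ?k (G z) z" for z
  proof -
    have "(\<lambda>n. indicator (B n) z *\<^sub>R ?k (W n z) z) \<longlonglongrightarrow> 1 *\<^sub>R ?k (G z) z"
      by (intro tendsto_scaleR indB tendsto_diff tendsto_inner tendsto_sum tendsto_mult_vec limW tendsto_const)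
    then show ?thesis by simp
  qed
  have i1: "(\<lambda>n. \<integral>z. indicator (B n) z *\<^sub>R W n z \<partial>lborel) \<longlonglongrightarrow> M"
    unfolding M_def
    by (rule integral_dominated_convergence[OF _ _ iw[of K]]) (use l1 W1 in auto)
  have i2: "(\<lambda>n. \<integral>z. indicator (B n) z *\<^sub>R (W n z *v c z) \<partial>lborel) \<longlonglongrightarrow> (\<integral>z. G z *v c z \<partial>lborel)"
    by (rule integral_dominated_convergence[OF _ _ iw[of "K * R * K0"]]) (use l2 W2 mcW mcG in auto)
  have mk3: "(\<lambda>z. indicator (B n) z *\<^sub>R ?k (W n z) z) \<in> borel_measurable lborel" for n
    using borel_measurable_scaleR[OF borel_measurable_indicator[OF mB] mkW, of n n] by simp
  have mk2: "(\<lambda>z. indicator (B n) z *\<^sub>R (W n z *v c z)) \<in> borel_measurable lborel" for n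
    using borel_measurable_scaleR[OF borel_measurable_indicator[OF mB] mcW, of n n] by simp
  note dom3 = AE_I2[OF l3] AE_I2[OF W3]
  have i3: "(\<lambda>n. \<integral>z. indicator (B n) z *\<^sub>R ?k (W n z) z \<partial>lborel) \<longlonglongrightarrow> (\<integral>z. ?k (G z) z \<partial>lborel)"
    by (rule integral_dominated_convergence[OF _ mk3 iw[of D3] dom3]) (use mkG in simp)
  have j3: "integrable lborel (\<lambda>z. ?k (G z) z)"
    by (rule integrable_dominated_convergence[OF _ mk3 iw[of D3] dom3]) (use mkG in simp)
  show j2: "integrable lborel (\<lambda>z. G z *v c z)"
    by (rule integrable_dominated_convergence[OF _ mk2 iw[of "K * R * K0"] AE_I2[OF l2] AE_I2[OF W2]]) (use mcG in simp)
  have js: "integrable lborel (\<lambda>z. \<Sum>b\<in>Basis. x b \<bullet> (G z *v x b))"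
    by (intro Bochner_Integration.integrable_sum integrable_quad)
  from Bochner_Integration.integrable_add[OF j3 js] show j4: "integrable lborel (\<lambda>z. c z \<bullet> (G z *v c z))" by simp
  have "(\<lambda>n. (\<integral>z. indicator (B n) z *\<^sub>R (W n z *v c z) \<partial>lborel) \<bullet>
      (matrix_inv (\<integral>z. indicator (B n) z *\<^sub>R W n z \<partial>lborel) *v (\<integral>z. indicator (B n) z *\<^sub>R (W n z *v c z) \<partial>lborel))
      - (\<integral>z. indicator (B n) z *\<^sub>R ?k (W n z) z \<partial>lborel)) \<longlonglongrightarrow>
    (\<integral>z. G z *v c z \<partial>lborel) \<bullet> (matrix_inv M *v (\<integral>z. G z *v c z \<partial>lborel)) - (\<integral>z. ?k (G z) z \<partial>lborel)"
    by (intro tendsto_diff tendsto_inner i2 tendsto_mult_vec tendsto_matrix_inv i1 i3 posdef_invertible M_posdef)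
  moreover have "0 \<le> (\<integral>z. indicator (B n) z *\<^sub>R (W n z *v c z) \<partial>lborel) \<bullet>
      (matrix_inv (\<integral>z. indicator (B n) z *\<^sub>R W n z \<partial>lborel) *v (\<integral>z. indicator (B n) z *\<^sub>R (W n z *v c z) \<partial>lborel))
      - (\<integral>z. indicator (B n) z *\<^sub>R ?k (W n z) z \<partial>lborel)" for n
    using BL[of "real n + 1" n x] unfolding B_def c_def by simp
  ultimately have "0 \<le> (\<integral>z. G z *v c z \<partial>lborel) \<bullet> (matrix_inv M *v (\<integral>z. G z *v c z \<partial>lborel)) - (\<integral>z. ?k (G z) z \<partial>lborel)"
    by (intro LIMSEQ_le_const) auto
  moreover have "(\<integral>z. ?k (G z) z \<partial>lborel) = (\<integral>z. c z \<bullet> (G z *v c z) \<partial>lborel) - (\<Sum>b\<in>Basis. x b \<bullet> (M *v x b))"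
    using j4 js by (simp add: Bochner_Integration.integral_diff Bochner_Integration.integral_sum integrable_quad M_quad)
  ultimately show "(\<integral>z. c z \<bullet> (G z *v c z) \<partial>lborel) - (\<Sum>b\<in>Basis. x b \<bullet> (M *v x b)) \<le>
     (\<integral>z. G z *v c z \<partial>lborel) \<bullet> (matrix_inv M *v (\<integral>z. G z *v c z \<partial>lborel))" by linarith
qed

end

section \<open>Dyson inequality for the mean resolvent\<close>

context sym_pair begin

lemma G_C: "G z *v (C z *v v) = wt z *\<^sub>R v - G z *v v"
proof (cases "z \<in> \<Omega>")
  case True
  have "matrix_inv (mat 1 + C z) *v ((mat 1 + C z) *v v) = v" by (rule posdef_inv_vec[OF pdP[OF True]])
  then show ?thesis
    by (simp add: G_eq scaleR_matrix_vector_assoc[symmetric] matrix_vector_mult_add_rdistrib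
        matrix_vector_right_distrib scaleR_diff_right[symmetric] eq_diff_eq add.commute)
qed (simp add: G_eq wt_eq)

lemma C_G: "C z *v (G z *v v) = wt z *\<^sub>R v - G z *v v"
proof (cases "z \<in> \<Omega>")
  case True
  have "(mat 1 + C z) *v (matrix_inv (mat 1 + C z) *v v) = v" by (rule posdef_inv_vec[OF pdP[OF True]])
  then show ?thesis
    by (simp add: G_eq scaleR_matrix_vector_assoc[symmetric] matrix_vector_mult_add_rdistrib matrix_vector_mult_scaleR
        scaleR_diff_right[symmetric] eq_diff_eq add.commute)
qed (simp add: G_eq wt_eq)

lemma inner_C: "x \<bullet> (C z *v y) = (C z *v x) \<bullet> y"
  by (metis inner_matrix_sym[OF symC] inner_commute)

lemma
  fixes f :: "'a \<Rightarrow> real"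
  assumes f: "linear f"
  shows integrable_wt_linear: "integrable lborel (\<lambda>z. wt z * f z)"
    and integral_wt_linear: "(\<integral>z. wt z * f z \<partial>lborel) = 0"
proof -
  have cf: "continuous_on UNIV f" using f by (intro linear_continuous_on linear_conv_bounded_linear[THEN iffD1])
  have m: "(\<lambda>z. wt z * f z) \<in> borel_measurable borel"
    by (rule borel_measurable_continuous_onI) (intro continuous_intros continuous_wt cf)
  obtain R where R: "0 \<le> R" "\<And>z. norm (f z) \<le> R * norm z" by (rule linear_growth[OF f]) (rule that)
  obtain D where D: "0 \<le> D" "\<And>z. wt z \<le> D * exp (- (z \<bullet> z) / 2)" using wt_bound by blast
  show "integrable lborel (\<lambda>z. wt z * f z)"
  proof (rule integrable_gauss_dom[OF m])
    fix z
    have "norm (f z) \<le> R * (1 + z \<bullet> z)"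
      by (rule order_trans[OF R(2) mult_left_mono[OF norm_le_gauss(1) R(1)]])
    then have "wt z * norm (f z) \<le> (D * exp (- (z \<bullet> z) / 2)) * (R * (1 + z \<bullet> z))"
      by (intro mult_mono D) (use D R wt_nonneg in auto)
    then show "norm (wt z * f z) \<le> D * R * ((1 + z \<bullet> z) * exp (- (z \<bullet> z) / 2))"
      using wt_nonneg[of z] by (simp add: abs_mult mult_ac)
  qed
  show "(\<integral>z. wt z * f z \<partial>lborel) = 0"
    by (rule integral_odd[OF m]) (simp add: wt_uminus linear_neg[OF f])
qed

lemma M_le: "x \<bullet> (M *v x) \<le> op_norm M * (x \<bullet> x)"
proof -
  have "x \<bullet> (M *v x) \<le> norm x * norm (M *v x)" by (rule norm_cauchy_schwarz)
  also have "\<dots> \<le> norm x * (op_norm M * norm x)" by (intro mult_left_mono op_norm_vec) auto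
  finally show ?thesis by (simp add: dot_square_norm power2_eq_square mult_ac)
qed

lemma C_repr: "(\<Sum>b\<in>Basis. (z \<bullet> b) *\<^sub>R (C b *v y)) = C z *v y"
proof -
  have "linear (\<lambda>z. C z *v y)"
    by (intro linearI) (simp_all add: linear_add[OF linC] linear_scale[OF linC] matrix_vector_mult_add_rdistrib
        scaleR_matrix_vector_assoc[symmetric])
  note l = this
  have "C z *v y = C (\<Sum>b\<in>Basis. (z \<bullet> b) *\<^sub>R b) *v y" by (simp add: euclidean_representation)
  then show ?thesis by (simp add: linear_sum[OF l] linear_scale[OF l])
qed

lemma linear_quad_C: "linear (\<lambda>z. y \<bullet> (C z *v x))"
  by (intro linearI) (simp_all add: linear_add[OF linC] linear_scale[OF linC] matrix_vector_mult_add_rdistrib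
        scaleR_matrix_vector_assoc[symmetric] inner_add_right)

text \<open>Using the resolvent identity on both sides gives C G C = w C - w I + G. The term linear
  in \<open>C\<close> integrates to 0, since the weight is even.\<close>

lemma integral_CGC:
  "integrable lborel (\<lambda>z. (C z *v y) \<bullet> (G z *v (C z *v y)))"
  "(\<integral>z. (C z *v y) \<bullet> (G z *v (C z *v y)) \<partial>lborel) = y \<bullet> (M *v y) - Z * (y \<bullet> y)"
proof -
  have e: "(C z *v y) \<bullet> (G z *v (C z *v y)) = wt z * (y \<bullet> (C z *v y)) - wt z * (y \<bullet> y) + y \<bullet> (G z *v y)" for z
  proof -
    have "(C z *v y) \<bullet> (G z *v (C z *v y)) = wt z * (y \<bullet> (C z *v y)) - (C z *v y) \<bullet> (G z *v y)"
      by (simp add: G_C inner_diff_right inner_commute)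
    also have "(C z *v y) \<bullet> (G z *v y) = wt z * (y \<bullet> y) - y \<bullet> (G z *v y)"
      by (simp add: inner_C[symmetric] C_G inner_diff_right)
    finally show ?thesis by simp
  qed
  note i = integrable_wt_linear[OF linear_quad_C[of y y]] integrable_wt integrable_quad[of y y]
  show "integrable lborel (\<lambda>z. (C z *v y) \<bullet> (G z *v (C z *v y)))"
    unfolding e using i by simp
  show "(\<integral>z. (C z *v y) \<bullet> (G z *v (C z *v y)) \<partial>lborel) = y \<bullet> (M *v y) - Z * (y \<bullet> y)"
    unfolding e using i integral_wt_linear[OF linear_quad_C[of y y]]
    by (simp add: Bochner_Integration.integral_add Bochner_Integration.integral_diff M_quad Z_def)
qed

text \<open>With \<open>\<Pi> = M / Z\<close>, the mean resolvent, the Brascamp-Lieb inequality for \<open>c z = C z y\<close> reads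
  \<open>I - \<Pi>\<inverse> \<le> (1/16) \<parallel>\<Pi>\<parallel> I\<close>.\<close>

lemma Dyson_inequality:
  assumes small: "\<And>y. (\<Sum>b\<in>Basis. (C b *v y) \<bullet> (C b *v y)) \<le> (1/16) * (y \<bullet> y)"
  shows "(Z - op_norm M / 16) * op_norm M \<le> Z\<^sup>2"
proof -
  have key: "(Z - op_norm M / 16) * (y \<bullet> y) \<le> Z\<^sup>2 * (y \<bullet> (matrix_inv M *v y))" for y
  proof -
    note iM = posdef_inv_vec[OF M_posdef]
    have q: "(\<integral>z. G z *v (C z *v y) \<partial>lborel) = Z *\<^sub>R y - M *v y"
    proof -
      have "(\<integral>z. wt z *\<^sub>R y \<partial>lborel) = Z *\<^sub>R y" using integrable_wt by (simp add: Z_def)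
      moreover have "(\<integral>z. G z *v y \<partial>lborel) = M *v y"
        unfolding M_def by (rule integral_bounded_linear[OF blv integrable_G])
      moreover have "integrable lborel (\<lambda>z. wt z *\<^sub>R y)" using integrable_wt by simp
      moreover have "integrable lborel (\<lambda>z. G z *v y)" by (rule integrable_bounded_linear[OF blv integrable_G])
      ultimately show ?thesis unfolding G_C by (simp add: Bochner_Integration.integral_diff)
    qed
    have "(\<integral>z. (C z *v y) \<bullet> (G z *v (C z *v y)) \<partial>lborel) - (\<Sum>b\<in>Basis. (C b *v y) \<bullet> (M *v (C b *v y)))
      \<le> (Z *\<^sub>R y - M *v y) \<bullet> (matrix_inv M *v (Z *\<^sub>R y - M *v y))"
      using Brascamp_Lieb(1)[of "\<lambda>b. C b *v y"] unfolding C_repr q .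
    moreover have "(\<Sum>b\<in>Basis. (C b *v y) \<bullet> (M *v (C b *v y))) \<le> op_norm M * ((1/16) * (y \<bullet> y))"
    proof -
      have "(\<Sum>b\<in>Basis. (C b *v y) \<bullet> (M *v (C b *v y))) \<le> (\<Sum>b\<in>Basis. op_norm M * ((C b *v y) \<bullet> (C b *v y)))"
        by (intro sum_mono M_le)
      also have "\<dots> \<le> op_norm M * ((1/16) * (y \<bullet> y))"
        unfolding sum_distrib_left[symmetric] by (intro mult_left_mono small op_norm_nonneg)
      finally show ?thesis .
    qed
    moreover have "(Z *\<^sub>R y - M *v y) \<bullet> (matrix_inv M *v (Z *\<^sub>R y - M *v y)) =
       Z\<^sup>2 * (y \<bullet> (matrix_inv M *v y)) - 2 * (Z * (y \<bullet> y)) + y \<bullet> (M *v y)"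
    proof -
      have "(M *v y) \<bullet> (matrix_inv M *v y) = y \<bullet> y"
        using posdef_sym[OF M_posdef, of "matrix_inv M *v y" y] by (simp add: iM inner_commute)
      then show ?thesis
        by (simp add: matrix_vector_mult_diff_distrib matrix_vector_mult_scaleR iM inner_diff power2_eq_square
            inner_commute[of "M *v y" y] right_diff_distrib mult.assoc mult.commute[of "y \<bullet> y" Z])
    qed
    ultimately show ?thesis unfolding integral_CGC(2) by (simp add: algebra_simps)
  qed
  \<comment> \<open>Testing \<open>key\<close> at \<open>M *v w\<close> removes the inverse; for an
    extremal unit vector \<open>w\<close> the left side becomes the square of the norm and the right
    side is at most \<open>Z\<^sup>2\<close> times the norm.\<close>
  obtain w where w: "norm w = 1" "norm (M *v w) = op_norm M" by (rule sphere_attains_op_norm)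
  have "(Z - op_norm M / 16) * ((M *v w) \<bullet> (M *v w)) \<le> Z\<^sup>2 * ((M *v w) \<bullet> w)"
    using key[of "M *v w"] by (simp add: posdef_inv_vec[OF M_posdef])
  also have "\<dots> \<le> Z\<^sup>2 * op_norm M"
    using norm_cauchy_schwarz[of "M *v w" w] w by (intro mult_left_mono) auto
  finally have "(Z - op_norm M / 16) * op_norm M * op_norm M \<le> Z\<^sup>2 * op_norm M"
    by (simp add: dot_square_norm w power2_eq_square mult_ac)
  moreover have "0 < op_norm M"
  proof -
    have "M *v w \<noteq> 0" using M_posdef w(1) unfolding posdef_def by (metis inner_zero_right less_irrefl norm_zero zero_neq_one)
    then show ?thesis using w(2) by (metis zero_less_norm_iff)
  qed
  ultimately show ?thesis by simp
qed

section \<open>Scaling both matrices by \<open>r\<close>\<close>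

lemma sym_pair_scale: "sym_pair (\<lambda>z. r *\<^sub>R C z) (\<lambda>z. r *\<^sub>R C2 z)"
  by standard (auto intro!: linearI simp: linear_add[OF linC] linear_scale[OF linC] linear_add[OF linC2]
      linear_scale[OF linC2] scaleR_add_right symC symC2 transpose_scalar)

definition "Mr r = sym_pair.M (\<lambda>z. r *\<^sub>R C z) (\<lambda>z. r *\<^sub>R C2 z)"
definition "Zr r = sym_pair.Z (\<lambda>z. r *\<^sub>R C z) (\<lambda>z. r *\<^sub>R C2 z)"

text \<open>Dominated convergence along sequences: \<open>tendsto_trunc\<close> provides the
  pointwise limit even where a scaled matrix crosses norm 1, and the bounds of
  \<open>trunc_bounded\<close> do not depend on \<open>r\<close>.\<close>

lemma continuous_Mr: "continuous_on UNIV Mr" and continuous_Zr: "continuous_on UNIV Zr"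
proof -
  have g: "integrable lborel (\<lambda>z::'a. D * exp (- (z \<bullet> z) / 2))" for D :: real
  proof (rule integrable_gauss_dom)
    show "norm (D * exp (- (z \<bullet> z) / 2)) \<le> \<bar>D\<bar> * ((1 + z \<bullet> z) * exp (- (z \<bullet> z) / 2))" for z :: 'a
      using mult_left_mono[OF ge_gauss[of z], of "\<bar>D\<bar>"] by (simp add: abs_mult)
  qed measurable
  have t: "(\<lambda>n. trunc_w (u n *\<^sub>R C z) (u n *\<^sub>R C2 z)) \<longlonglongrightarrow> trunc_w (r *\<^sub>R C z) (r *\<^sub>R C2 z)"
    "(\<lambda>n. trunc_Q (u n *\<^sub>R C z) (u n *\<^sub>R C2 z)) \<longlonglongrightarrow> trunc_Q (r *\<^sub>R C z) (r *\<^sub>R C2 z)"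
    if "u \<longlonglongrightarrow> r" for u r z
    by (intro tendsto_trunc tendsto_intros that; simp add: transpose_scalar symC symC2)+
  have b: "\<bar>trunc_w (r *\<^sub>R C z) (r *\<^sub>R C2 z)\<bar> \<le> (dbound TYPE('m) ^ 2 * dbound TYPE('k) ^ 2) ^ 4"
    "norm (trunc_Q (r *\<^sub>R C z) (r *\<^sub>R C2 z)) \<le> Qbound TYPE('m) TYPE('k) * (dbound TYPE('m) ^ 2 * dbound TYPE('k) ^ 2)" for r z
    by (intro trunc_bounded; simp add: transpose_scalar symC symC2)+
  show "continuous_on UNIV Mr"
  proof (rule continuous_on_sequentiallyI)
    fix u and r :: real assume u: "u \<longlonglongrightarrow> r"
    show "(\<lambda>n. Mr (u n)) \<longlonglongrightarrow> Mr r"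
      unfolding Mr_def sym_pair.M_def[OF sym_pair_scale]
    proof (rule integral_dominated_convergence[OF _ _ g[of "Qbound TYPE('m) TYPE('k) * (dbound TYPE('m) ^ 2 * dbound TYPE('k) ^ 2)"]])
      show "AE z in lborel. (\<lambda>n. sym_pair.G (\<lambda>z. u n *\<^sub>R C z) (\<lambda>z. u n *\<^sub>R C2 z) z) \<longlonglongrightarrow>
          sym_pair.G (\<lambda>z. r *\<^sub>R C z) (\<lambda>z. r *\<^sub>R C2 z) z"
        unfolding sym_pair.G_def[OF sym_pair_scale] by (intro AE_I2 tendsto_scaleR tendsto_const t u)
      show "AE z in lborel. norm (sym_pair.G (\<lambda>z. u n *\<^sub>R C z) (\<lambda>z. u n *\<^sub>R C2 z) z) \<le>
         Qbound TYPE('m) TYPE('k) * (dbound TYPE('m) ^ 2 * dbound TYPE('k) ^ 2) * exp (- (z \<bullet> z) / 2)" for n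
        unfolding sym_pair.G_def[OF sym_pair_scale]
      proof (intro AE_I2)
        fix z
        show "norm (exp (- (z \<bullet> z) / 2) *\<^sub>R trunc_Q (u n *\<^sub>R C z) (u n *\<^sub>R C2 z)) \<le>
         Qbound TYPE('m) TYPE('k) * (dbound TYPE('m) ^ 2 * dbound TYPE('k) ^ 2) * exp (- (z \<bullet> z) / 2)"
          using mult_right_mono[OF b(2)[of "u n" z], of "exp (- (z \<bullet> z) / 2)"] by (simp add: mult.commute)
      qed
    qed (use sym_pair.measurable_G[OF sym_pair_scale] in auto)
  qed
  show "continuous_on UNIV Zr"
  proof (rule continuous_on_sequentiallyI)
    fix u and r :: real assume u: "u \<longlonglongrightarrow> r"
    show "(\<lambda>n. Zr (u n)) \<longlonglongrightarrow> Zr r"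
      unfolding Zr_def sym_pair.Z_def[OF sym_pair_scale]
    proof (rule integral_dominated_convergence[OF _ _ g[of "(dbound TYPE('m) ^ 2 * dbound TYPE('k) ^ 2) ^ 4"]])
      show "AE z in lborel. (\<lambda>n. sym_pair.wt (\<lambda>z. u n *\<^sub>R C z) (\<lambda>z. u n *\<^sub>R C2 z) z) \<longlonglongrightarrow>
          sym_pair.wt (\<lambda>z. r *\<^sub>R C z) (\<lambda>z. r *\<^sub>R C2 z) z"
        unfolding sym_pair.wt_def[OF sym_pair_scale] by (intro AE_I2 tendsto_mult tendsto_const t u)
      show "AE z in lborel. norm (sym_pair.wt (\<lambda>z. u n *\<^sub>R C z) (\<lambda>z. u n *\<^sub>R C2 z) z) \<le>
         (dbound TYPE('m) ^ 2 * dbound TYPE('k) ^ 2) ^ 4 * exp (- (z \<bullet> z) / 2)" for n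
        unfolding sym_pair.wt_def[OF sym_pair_scale]
      proof (intro AE_I2)
        fix z
        show "norm (exp (- (z \<bullet> z) / 2) * trunc_w (u n *\<^sub>R C z) (u n *\<^sub>R C2 z)) \<le>
         (dbound TYPE('m) ^ 2 * dbound TYPE('k) ^ 2) ^ 4 * exp (- (z \<bullet> z) / 2)"
          using mult_right_mono[OF b(1)[of "u n" z], of "exp (- (z \<bullet> z) / 2)"] by (simp add: mult.commute abs_mult)
      qed
    qed (use sym_pair.measurable_wt[OF sym_pair_scale] in auto)
  qed
qed

text \<open>At \<open>r = 0\<close> the resolvent is the identity, hence the mean resolvent is the
  identity as well.\<close>

lemma Mr_0: "op_norm (Mr 0) = Zr 0"
proof -
  interpret O: sym_pair "\<lambda>z. 0 *\<^sub>R C z" "\<lambda>z. 0 *\<^sub>R C2 z" by (rule sym_pair_scale)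
  have i1: "matrix_inv (mat 1) = (mat 1 :: real^'m^'m)" by (rule matrix_inv_unique) simp
  have G: "O.G = (\<lambda>z. O.wt z *\<^sub>R mat 1)"
    by (rule ext, unfold O.G_def O.wt_def trunc_Q_def) (simp add: i1)
  have "O.M = O.Z *\<^sub>R mat 1"
    unfolding O.M_def O.Z_def G by (rule integral_scaleR_left) (rule O.integrable_wt)
  then show ?thesis
    using O.Z_pos op_norm_scaled_one[of O.Z, where 'm='m] unfolding Mr_def Zr_def by (metis abs_of_pos)
qed

text \<open>The Dyson inequality excludes the value \<open>11/10\<close> of \<open>\<parallel>\<Pi>\<parallel>\<close>; continuity in the scaling \<open>r\<close>, starting from
  the value \<open>1\<close> at \<open>r = 0\<close>, selects the branch below it.\<close>

lemma op_norm_M_le: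
  assumes small: "\<And>y. (\<Sum>b\<in>Basis. (C b *v y) \<bullet> (C b *v y)) \<le> (1/16) * (y \<bullet> y)"
  shows "op_norm M \<le> (11/10) * Z"
proof (rule ccontr)
  assume n: "\<not> ?thesis"
  have Zp: "0 < Zr r" for r unfolding Zr_def by (rule sym_pair.Z_pos[OF sym_pair_scale])
  define f where "f r = op_norm (Mr r) / Zr r" for r
  have "continuous_on UNIV f"
    unfolding f_def using Zp by (intro continuous_intros continuous_Mr continuous_Zr) (metis less_irrefl)
  then have cf: "continuous_on {0..1} f" by (rule continuous_on_subset) simp
  have f0: "f 0 \<le> 11/10" using Zp[of 0] by (simp add: f_def Mr_0)
  have f1: "11/10 \<le> f 1" using n Zp[of 1] by (simp add: f_def Mr_def Zr_def field_simps)
  obtain r where r: "0 \<le> r" "r \<le> 1" "f r = 11/10" using IVT'[OF f0 f1 _ cf] by auto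
  interpret R: sym_pair "\<lambda>z. r *\<^sub>R C z" "\<lambda>z. r *\<^sub>R C2 z" by (rule sym_pair_scale)
  have "(R.Z - op_norm R.M / 16) * op_norm R.M \<le> R.Z\<^sup>2"
  proof (rule R.Dyson_inequality)
    fix y
    have "(\<Sum>b\<in>Basis. ((r *\<^sub>R C b) *v y) \<bullet> ((r *\<^sub>R C b) *v y)) = r\<^sup>2 * (\<Sum>b\<in>Basis. (C b *v y) \<bullet> (C b *v y))"
      by (simp add: scaleR_matrix_vector_assoc[symmetric] sum_distrib_left power2_eq_square mult.assoc)
    also have "\<dots> \<le> 1 * (\<Sum>b\<in>Basis. (C b *v y) \<bullet> (C b *v y))"
      using r by (intro mult_right_mono sum_nonneg) (auto simp: power_le_one)
    finally show "(\<Sum>b\<in>Basis. ((r *\<^sub>R C b) *v y) \<bullet> ((r *\<^sub>R C b) *v y)) \<le> (1/16) * (y \<bullet> y)" using small[of y] by simp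
  qed
  moreover have "op_norm R.M = (11/10) * R.Z" using r(3) Zp[of r] by (simp add: f_def Mr_def Zr_def field_simps)
  \<comment> \<open>(1 - 11/160) * 11/10 = 1639/1600 exceeds 1, because 11/10 lies strictly between
    the roots 8 - 4 sqrt 3 and 8 + 4 sqrt 3.\<close>
  ultimately have "(1 - (11/10)/16) * (11/10) * R.Z\<^sup>2 \<le> R.Z\<^sup>2" by (simp add: power2_eq_square algebra_simps)
  then show False using R.Z_pos by (simp add: power2_eq_square)
qed

text \<open>\<open>G\<close> is not even, so \<open>q\<close>, the integral of \<open>G c\<close>,
  need not vanish; the term y . q with \<open>y\<close> the solution of \<open>M y = q\<close> must
  be absorbed. By the resolvent identity and the evenness of the weight, y . q = - \<integral> (C y)
  . G c. Cauchy-Schwarz for \<open>G\<close> brings in \<open>\<beta>\<close> and \<integral> (C y)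
  . G (C y) = y . q - Z (y . y), and the latter is at most (y . q) / 11 by
  \<open>op_norm_M_le\<close>. So y . q is at most \<beta>/11, and the Brascamp-Lieb inequality
  leaves (10/11) \<beta> bounded by (11/10) Z / 16.\<close>

lemma variance_bound:
  fixes x :: "'a \<Rightarrow> real^'m"
  assumes small: "\<And>y. (\<Sum>b\<in>Basis. (C b *v y) \<bullet> (C b *v y)) \<le> (1/16) * (y \<bullet> y)"
    and x: "(\<Sum>b\<in>Basis. x b \<bullet> x b) \<le> 1/16"
  defines "c \<equiv> \<lambda>z. \<Sum>b\<in>Basis. (z \<bullet> b) *\<^sub>R x b"
  shows "(\<integral>z. c z \<bullet> (G z *v c z) \<partial>lborel) \<le> (121/1600) * Z"
proof -
  note BL = Brascamp_Lieb[of x, folded c_def]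
  define q where "q = (\<integral>z. G z *v (\<Sum>b\<in>Basis. (z \<bullet> b) *\<^sub>R x b) \<partial>lborel)"
  define y where "y = matrix_inv M *v q"
  define \<beta> where "\<beta> = (\<integral>z. c z \<bullet> (G z *v c z) \<partial>lborel)"
  have My: "M *v y = q" by (simp add: y_def posdef_inv_vec[OF M_posdef])
  have ic: "integrable lborel (\<lambda>z. G z *v c z)" and icc: "integrable lborel (\<lambda>z. c z \<bullet> (G z *v c z))"
    using Brascamp_Lieb(2,3)[of x] by (simp_all add: c_def)
  have qc: "q = (\<integral>z. G z *v c z \<partial>lborel)" by (simp add: q_def c_def)
  have lin: "linear (\<lambda>z. y \<bullet> c z)" unfolding c_def
    by (intro linearI) (simp_all add: inner_add_left scaleR_add_left sum.distrib inner_add_right inner_sum_right sum_distrib_left mult.assoc)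
  have e: "y \<bullet> (G z *v c z) = wt z * (y \<bullet> c z) - (C z *v y) \<bullet> (G z *v c z)" for z
    by (simp add: inner_C[symmetric] C_G inner_diff_right)
  have iy: "integrable lborel (\<lambda>z. y \<bullet> (G z *v c z))" using ic by simp
  have iC: "integrable lborel (\<lambda>z. (C z *v y) \<bullet> (G z *v c z))"
    using Bochner_Integration.integrable_diff[OF integrable_wt_linear[OF lin] iy] by (simp add: e)
  have "y \<bullet> q = (\<integral>z. y \<bullet> (G z *v c z) \<partial>lborel)" unfolding qc using ic by simp
  also have "\<dots> = - (\<integral>z. (C z *v y) \<bullet> (G z *v c z) \<partial>lborel)"
    unfolding e using integrable_wt_linear[OF lin] iC integral_wt_linear[OF lin] by simp
  finally have yq: "y \<bullet> q = - (\<integral>z. (C z *v y) \<bullet> (G z *v c z) \<partial>lborel)" .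
  have "- (\<integral>z. (C z *v y) \<bullet> (G z *v c z) \<partial>lborel) \<le>
     (\<integral>z. (11/2) * ((C z *v y) \<bullet> (G z *v (C z *v y))) + (1/22) * (c z \<bullet> (G z *v c z)) \<partial>lborel)"
    unfolding integral_minus[symmetric]
  proof (rule integral_mono)
    fix z
    \<comment> \<open>The weight 11 balances the two squares: the first one uses up exactly half of
      y . q, and \<beta>/22 matches the other half.\<close>
    have "0 \<le> (11 *\<^sub>R (C z *v y) + c z) \<bullet> (G z *v (11 *\<^sub>R (C z *v y) + c z))" by (rule G_nonneg)
    also have "\<dots> = 121 * ((C z *v y) \<bullet> (G z *v (C z *v y))) + 22 * ((C z *v y) \<bullet> (G z *v c z)) + c z \<bullet> (G z *v c z)"
      using inner_matrix_sym[OF G_sym, of "c z" z "C z *v y"]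
      by (simp add: matrix_vector_right_distrib matrix_vector_mult_scaleR inner_add)
    finally show "- ((C z *v y) \<bullet> (G z *v c z)) \<le> (11/2) * ((C z *v y) \<bullet> (G z *v (C z *v y))) + (1/22) * (c z \<bullet> (G z *v c z))"
      by simp
  qed (use iC integral_CGC(1)[of y] icc in auto)
  also have "\<dots> = (11/2) * (y \<bullet> q - Z * (y \<bullet> y)) + (1/22) * \<beta>"
    using integral_CGC[of y] icc by (simp add: My \<beta>_def)
  finally have 1: "y \<bullet> q \<le> (11/2) * (y \<bullet> q - Z * (y \<bullet> y)) + (1/22) * \<beta>" unfolding yq[symmetric] .
  note opM = op_norm_M_le[OF small]
  have "y \<bullet> q \<le> op_norm M * (y \<bullet> y)" using M_le[of y] by (simp add: My)
  also have "\<dots> \<le> (11/10) * Z * (y \<bullet> y)" by (intro mult_right_mono opM) auto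
  finally have 2: "y \<bullet> q \<le> (11/10) * Z * (y \<bullet> y)" .
  have "(\<Sum>b\<in>Basis. x b \<bullet> (M *v x b)) \<le> (\<Sum>b\<in>Basis. op_norm M * (x b \<bullet> x b))"
    by (intro sum_mono M_le)
  also have "\<dots> \<le> op_norm M * (1/16)"
    unfolding sum_distrib_left[symmetric] by (intro mult_left_mono x op_norm_nonneg)
  also have "\<dots> \<le> (11/10) * Z * (1/16)" by (intro mult_right_mono opM) auto
  finally have 3: "(\<Sum>b\<in>Basis. x b \<bullet> (M *v x b)) \<le> (11/10) * Z * (1/16)" .
  have 4: "\<beta> - (\<Sum>b\<in>Basis. x b \<bullet> (M *v x b)) \<le> y \<bullet> q"
    using Brascamp_Lieb(1)[of x] unfolding q_def[symmetric] y_def[symmetric]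
    by (simp add: \<beta>_def c_def inner_commute)
  have "\<beta> \<le> (121/1600) * Z" using 1 2 3 4 by (simp add: algebra_simps)
  then show ?thesis by (simp only: \<beta>_def)
qed

end

section \<open>The Schur complement estimate\<close>

text \<open>On the open set of invertible matrices the inverse is continuous. On singular matrices
  the defining predicate is identically false, so the choice operator returns one and the same
  matrix \<open>c0\<close>.\<close>

lemma measurable_matrix_inv: "(matrix_inv :: real^'m^'m \<Rightarrow> real^'m^'m) \<in> borel_measurable borel"
proof -
  define U where "U = {A::real^'m^'m. det A \<noteq> 0}"
  have "closed {A::real^'m^'m. det A = 0}" by (intro closed_Collect_eq continuous_intros)
  moreover have "U = - {A. det A = 0}" by (auto simp: U_def)
  ultimately have U: "U \<in> sets borel" by (simp add: borel_comp borel_closed)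
  define c0 where "c0 = (SOME A'::real^'m^'m. False)"
  have c0: "matrix_inv A = c0" if "A \<notin> U" for A
  proof -
    have "\<And>A'. \<not> (A ** A' = mat 1 \<and> A' ** A = mat 1)"
      using that invertible_det_nz[of A] unfolding U_def invertible_def by blast
    then have "(\<lambda>A'. A ** A' = mat 1 \<and> A' ** A = mat 1) = (\<lambda>_. False)" by blast
    then show ?thesis by (simp only: matrix_inv_def c0_def)
  qed
  have "(\<lambda>A. indicator U A *\<^sub>R matrix_inv A) \<in> borel_measurable borel"
    by (intro borel_measurable_continuous_on_indicator[OF U] continuous_intros)
      (simp add: U_def invertible_det_nz)
  moreover have "(\<lambda>A. indicator (- U) A *\<^sub>R c0) \<in> borel_measurable borel"
    using U by (intro borel_measurable_scaleR borel_measurable_indicator borel_measurable_const) (rule borel_comp)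
  ultimately have "(\<lambda>A. indicator U A *\<^sub>R matrix_inv A + indicator (- U) A *\<^sub>R c0) \<in> borel_measurable borel"
    by (rule borel_measurable_add)
  moreover have "(\<lambda>A. indicator U A *\<^sub>R matrix_inv A + indicator (- U) A *\<^sub>R c0) = matrix_inv"
    by (rule ext) (simp add: indicator_def c0)
  ultimately show ?thesis by simp
qed

lemma sum_Basis_axis: "(\<Sum>b\<in>Basis. f b) = (\<Sum>i\<in>UNIV. f (axis i (1::real)))"
  for f :: "real^'n \<Rightarrow> 'b::comm_monoid_add"
proof -
  have B: "Basis = range (\<lambda>i. axis i (1::real) :: real^'n)" by (auto simp: Basis_vec_def)
  have "inj (\<lambda>i. axis i (1::real) :: real^'n)" by (auto simp: inj_on_def axis_eq_axis)
  then show ?thesis unfolding B by (subst sum.reindex) simp_all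
qed

text \<open>Only the factor with denominator \<open>1 - \<bar>a\<bar>\<close> is reduced by more than its numerator \<open>x\<close>; as long as the
  factor is positive, the excess \<open>x / (1 - \<bar>a\<bar>) - 2 x\<close> is at most \<open>2 \<bar>a\<bar> - 1\<close> or negative, and half of
  \<open>1 / (1 - a\<^sup>2) - 1\<close> pays for it.\<close>

lemma product_lower_bound:
  fixes a x y :: real
  assumes a: "\<bar>a\<bar> < 1" and x: "0 \<le> x" and y: "0 \<le> y"
  shows "1 - (2 * (x + y) + (1 / (1 - a\<^sup>2) - 1) / 2) \<le> max (1 - x / (1 + a)) 0 * max (1 - y / (1 - a)) 0"
proof -
  \<comment> \<open>Here \<open>t\<close> is the modulus of \<open>a\<close>; changing the sign of
    \<open>a\<close> exchanges the roles of \<open>x\<close> and \<open>y\<close>.\<close>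
  have main: "1 - (2 * (x + y) + (1 / (1 - t\<^sup>2) - 1) / 2) \<le> max (1 - x / (1 - t)) 0 * max (1 - y / (1 + t)) 0"
    if t: "0 \<le> t" "t < 1" and x: "0 \<le> x" and y: "0 \<le> y" for t x y :: real
  proof -
    define r where "r = 1 / (1 - t\<^sup>2) - 1"
    have t2: "t\<^sup>2 < 1" using t by (simp add: power_less_one_iff)
    have r: "r = t\<^sup>2 / (1 - t\<^sup>2)" using t2 by (simp add: r_def field_simps)
    have r0: "0 \<le> r" unfolding r using t2 by simp
    have cub: "0 \<le> 4 * t ^ 3 - t\<^sup>2 - 4 * t + 2"
    proof -
      \<comment> \<open>The cubic has its minimum over nonnegative \<open>t\<close> at 2/3, with
        value 2/27; the factorised polynomial is the cubic minus that value.\<close>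
      have "0 \<le> (t - 2/3)\<^sup>2 * (4 * t + 13/3)" using t by (intro mult_nonneg_nonneg) auto
      also have "\<dots> \<le> 4 * t ^ 3 - t\<^sup>2 - 4 * t + 2"
        by (simp add: power2_eq_square power3_eq_cube algebra_simps)
      finally show ?thesis .
    qed
    have rt: "2 * t - 1 \<le> r / 2"
    proof -
      have "(4 * t - 2) * (1 - t\<^sup>2) \<le> t\<^sup>2" using cub by (simp add: power2_eq_square power3_eq_cube algebra_simps)
      then have "4 * t - 2 \<le> r" unfolding r using t2 by (simp add: pos_le_divide_eq)
      then show ?thesis by simp
    qed
    show ?thesis
    \<comment> \<open>If the factor with denominator \<open>1 - t\<close> is zero, then 1 - 2 x is
      at most 2 t - 1, and \<open>rt\<close> makes the left-hand side nonpositive.\<close>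
    proof (cases "1 - t \<le> x")
      case True
      then have "1 - (2 * (x + y) + r / 2) \<le> 0" using rt y by simp
      also have "0 \<le> max (1 - x / (1 - t)) 0 * max (1 - y / (1 + t)) 0" by simp
      finally show ?thesis by (simp add: r_def)
    next
      case False
      have x1: "x / (1 - t) \<le> 2 * x + r / 2"
      proof -
        have "x / (1 - t) - 2 * x = x * ((2 * t - 1) / (1 - t))" using t by (simp add: field_simps)
        also have "\<dots> \<le> r / 2"
        proof (cases "2 * t - 1 \<le> 0")
          case True
          then have "x * ((2 * t - 1) / (1 - t)) \<le> 0"
            using x t by (intro mult_nonneg_nonpos) (auto simp: divide_nonpos_pos)
          then show ?thesis using r0 by linarith
        next
          case f: False
          have "x * ((2 * t - 1) / (1 - t)) \<le> (1 - t) * ((2 * t - 1) / (1 - t))"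
            using False f t by (intro mult_right_mono) auto
          also have "\<dots> = 2 * t - 1" using t by simp
          finally show ?thesis using rt by linarith
        qed
        finally show ?thesis by linarith
      qed
      have y1: "y / (1 + t) \<le> y" using y t by (simp add: divide_le_eq mult_le_cancel_left1)
      have p: "0 \<le> 1 - x / (1 - t)" "0 \<le> x / (1 - t)" using False t x by (auto simp: field_simps)
      have "1 - (2 * (x + y) + r / 2) \<le> 1 - x / (1 - t) - y / (1 + t)" using add_mono[OF x1 y1] y by (simp add: algebra_simps)
      also have "\<dots> \<le> (1 - x / (1 - t)) * max (1 - y / (1 + t)) 0"
      proof (cases "y / (1 + t) \<le> 1")
        case True
        have "0 \<le> x / (1 - t) * (y / (1 + t))" using p t y by (intro mult_nonneg_nonneg) auto
        then show ?thesis using True by (simp add: algebra_simps)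
      qed (use p in auto)
      finally show ?thesis using p by (simp add: r_def)
    qed
  qed
  show ?thesis
  proof (cases "0 \<le> a")
    case True
    show ?thesis using main[of a y x] True a x y by (simp add: add.commute mult.commute)
  next
    case False
    show ?thesis using main[of "- a" x y] False a x y by simp
  qed
qed

text \<open>The tangent line of the fourth power; integrated against the unnormalised weight at
  \<open>t = 3/5\<close> it plays the part of Jensen's inequality.\<close>

lemma pow4_tangent: "t ^ 4 + 4 * t ^ 3 * (s - t) \<le> s ^ 4" if "0 \<le> t" for s t :: real
proof -
  have "0 \<le> (s - t)\<^sup>2 * ((s + t)\<^sup>2 + 2 * t\<^sup>2)" by (intro mult_nonneg_nonneg) auto
  also have "\<dots> = s ^ 4 - (t ^ 4 + 4 * t ^ 3 * (s - t))" by (simp add: eval_nat_numeral algebra_simps)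
  finally show ?thesis by simp
qed

text \<open>Crude bounds suffice: \<open>Lam\<close> lies between 1 and 2, the sum of a positive
  number and its reciprocal is at least 2, so the base lies between 3/8 and 3/4; and the square of
  3/4 is below 3/5.\<close>

lemma c_Schur_le: "c_Schur \<le> (3/5) ^ 4"
proof -
  have s: "(3/2) \<le> sqrt 3" "sqrt 3 \<le> 7/4"
    by (rule real_le_rsqrt, simp add: power2_eq_square) (rule real_le_lsqrt, simp_all add: power2_eq_square)
  then have L: "1 \<le> Lam" "Lam \<le> 2" by (simp_all add: Lam_def)
  have L2: "1 \<le> Lam\<^sup>2" "Lam\<^sup>2 \<le> 4" using L power_mono[of Lam 2 2] by (auto simp: one_le_power)
  have "2 \<le> m + 1 / m" if "1 \<le> m" for m :: real
  proof -
    have "0 \<le> (m - 1)\<^sup>2 / m" using that by simp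
    also have "\<dots> = m + 1 / m - 2" using that by (simp add: field_simps power2_eq_square)
    finally show ?thesis by simp
  qed
  then have lo: "2 \<le> Lam\<^sup>2 + 1 / Lam\<^sup>2" using L2(1) by blast
  have "1 / Lam\<^sup>2 \<le> 1" using L2 by (simp add: divide_le_eq)
  then have hi: "Lam\<^sup>2 + 1 / Lam\<^sup>2 \<le> 5" using L2 by linarith
  have "\<bar>1 - (1/8) * (Lam\<^sup>2 + 1 / Lam\<^sup>2)\<bar> \<le> 3/4" using lo hi by (auto simp: abs_le_iff)
  then have "\<bar>1 - (1/8) * (Lam\<^sup>2 + 1 / Lam\<^sup>2)\<bar> ^ 8 \<le> (3/4) ^ 8" by (rule power_mono) simp
  then have "c_Schur \<le> (3/4) ^ 8" by (simp add: c_Schur_def power_even_abs)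
  also have "(3/4) ^ 8 \<le> (3/5 :: real) ^ 4" by (simp add: eval_nat_numeral)
  finally show ?thesis .
qed

section \<open>The Gaussian measure and the blocks of the matrices\<close>

lemma std_gaussian_eq:
  "std_gaussian = density lborel (\<lambda>g::real^'n. ennreal ((1 / sqrt (2 * pi)) ^ CARD('n) * exp (- (g \<bullet> g) / 2)))"
proof -
  have "(\<Prod>i\<in>UNIV. std_normal_density (g $ i)) = (1 / sqrt (2 * pi)) ^ CARD('n) * exp (- (g \<bullet> g) / 2)" for g :: "real^'n"
  proof -
    have "(\<Prod>i\<in>UNIV. std_normal_density (g $ i)) = (\<Prod>i\<in>(UNIV :: 'n set). 1 / sqrt (2 * pi)) * (\<Prod>i\<in>UNIV. exp (- (g $ i)\<^sup>2 / 2))"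
      by (simp add: std_normal_density_def prod_dividef power_one_over)
    also have "(\<Prod>i\<in>UNIV. exp (- (g $ i)\<^sup>2 / 2)) = exp (- (g \<bullet> g) / 2)"
      by (simp add: exp_sum[symmetric] inner_vec_def power2_eq_square sum_negf sum_divide_distrib)
    finally show ?thesis by simp
  qed
  then show ?thesis by (simp add: std_gaussian_def)
qed

lemma linear_lin:
  "linear (lin_a a)" "linear (lin_b u)" "linear (lin_C D)"
  by (auto intro!: linearI simp: lin_a_def lin_b_def lin_C_def sum.distrib algebra_simps sum_distrib_left
      scaleR_sum_right scaleR_add_left scaleR_add_right)

lemma lin_axis:
  "lin_a a (axis i 1) = (1/4) * a i" "lin_b u (axis i 1) = (1/4) *\<^sub>R u i" "lin_C D (axis i 1) = (1/4) *\<^sub>R D i"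
proof -
  have "(\<Sum>j\<in>UNIV. axis i 1 $ j * a j) = (\<Sum>j\<in>UNIV. if j = i then a i else 0)" by (intro sum.cong) (auto simp: axis_def)
  then show "lin_a a (axis i 1) = (1/4) * a i" by (simp add: lin_a_def)
  have "(\<Sum>j\<in>UNIV. axis i 1 $ j *\<^sub>R u j) = (\<Sum>j\<in>UNIV. if j = i then u i else 0)" by (intro sum.cong) (auto simp: axis_def)
  then show "lin_b u (axis i 1) = (1/4) *\<^sub>R u i" by (simp add: lin_b_def)
  have "(\<Sum>j\<in>UNIV. axis i 1 $ j *\<^sub>R D j) = (\<Sum>j\<in>UNIV. if j = i then D i else 0)" by (intro sum.cong) (auto simp: axis_def)
  then show "lin_C D (axis i 1) = (1/4) *\<^sub>R D i" by (simp add: lin_C_def)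
qed

text \<open>The first bound is the diagonal entry at \<open>v\<close> of the hypothesis, the second its compression to the
  orthogonal complement of \<open>v\<close>.\<close>

lemma block_bounds:
  fixes A :: "'n::finite \<Rightarrow> real^'d^'d" and v :: "real^'d" and e :: "'m::finite \<Rightarrow> real^'d"
  assumes sym: "\<And>i. transpose (A i) = A i"
    and le: "(\<Sum>i\<in>UNIV. A i ** A i) \<preceq>\<^sub>L mat 1"
    and v: "norm v = 1" and e: "onb_of_complement v e"
  shows "(\<Sum>i\<in>UNIV. (block_a v (A i))\<^sup>2 + block_u v e (A i) \<bullet> block_u v e (A i)) \<le> 1"
    and "(\<Sum>i\<in>UNIV. (block_D e (A i) *v y) \<bullet> (block_D e (A i) *v y)) \<le> y \<bullet> y"
    and "transpose (block_D e (A i)) = block_D e (A i)"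
proof -
  have ee: "e j \<bullet> e k = (if j = k then 1 else 0)" for j k using e by (simp add: onb_of_complement_def)
  have ve: "v \<bullet> e j = 0" for j
  proof -
    have "e j \<in> {v}\<^sup>\<bottom>" using e span_base[of "e j" "range e"] by (auto simp: onb_of_complement_def)
    then show ?thesis by (simp add: orthogonal_comp_def orthogonal_def)
  qed
  have vv: "v \<bullet> v = 1" using v by (simp add: dot_square_norm)
  have A2: "(\<Sum>i\<in>UNIV. (A i *v w) \<bullet> (A i *v w)) \<le> w \<bullet> w" for w
  proof -
    have "0 \<le> w \<bullet> ((mat 1 - (\<Sum>i\<in>UNIV. A i ** A i)) *v w)" using le by (simp add: loewner_le_def pos_semidef_def)
    also have "\<dots> = w \<bullet> w - (\<Sum>i\<in>UNIV. w \<bullet> (A i *v (A i *v w)))"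
      by (simp add: matrix_vector_mult_diff_rdistrib inner_diff_right inner_sum_right matrix_vector_mul_assoc
          linear_sum[OF bounded_linear.linear[OF bounded_bilinear.bounded_linear_left[OF bounded_bilinear_matrix_vector]]])
    also have "(\<Sum>i\<in>UNIV. w \<bullet> (A i *v (A i *v w))) = (\<Sum>i\<in>UNIV. (A i *v w) \<bullet> (A i *v w))"
      by (intro sum.cong refl) (rule inner_matrix_sym[OF sym])
    finally show ?thesis by simp
  qed
  \<comment> \<open>Bessel's inequality for the orthonormal system of \<open>v\<close> and the
    \<open>e j\<close>; \<open>q\<close> is the component in the span of the
    \<open>e j\<close>.\<close>
  have bessel: "(v \<bullet> w)\<^sup>2 + (\<Sum>j\<in>UNIV. (e j \<bullet> w)\<^sup>2) \<le> w \<bullet> w" for w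
  proof -
    define q where "q = (\<Sum>j\<in>UNIV. (e j \<bullet> w) *\<^sub>R e j)"
    have qq: "q \<bullet> q = (\<Sum>j\<in>UNIV. (e j \<bullet> w)\<^sup>2)"
      by (simp add: q_def inner_sum_left inner_sum_right ee power2_eq_square if_distrib cong: if_cong)
    have qw: "q \<bullet> w = (\<Sum>j\<in>UNIV. (e j \<bullet> w)\<^sup>2)" by (simp add: q_def inner_sum_left power2_eq_square)
    have vq: "v \<bullet> q = 0" by (simp add: q_def inner_sum_right ve)
    have "0 \<le> (w - (v \<bullet> w) *\<^sub>R v - q) \<bullet> (w - (v \<bullet> w) *\<^sub>R v - q)" by simp
    also have "\<dots> = w \<bullet> w - (v \<bullet> w)\<^sup>2 - (\<Sum>j\<in>UNIV. (e j \<bullet> w)\<^sup>2)"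
      using qq qw vq vv by (simp add: inner_diff inner_commute[of w v] inner_commute[of w q] inner_commute[of q v] power2_eq_square)
    finally show ?thesis by simp
  qed
  have "(\<Sum>i\<in>UNIV. (block_a v (A i))\<^sup>2 + block_u v e (A i) \<bullet> block_u v e (A i)) \<le> (\<Sum>i\<in>UNIV. (A i *v v) \<bullet> (A i *v v))"
    by (intro sum_mono) (use bessel in \<open>simp add: block_a_def block_u_def inner_vec_def power2_eq_square\<close>)
  then show "(\<Sum>i\<in>UNIV. (block_a v (A i))\<^sup>2 + block_u v e (A i) \<bullet> block_u v e (A i)) \<le> 1"
    using A2[of v] vv by linarith
  \<comment> \<open>The isometric image of \<open>y\<close> in the orthogonal complement of
    \<open>v\<close>; the block \<open>D\<close> acts on \<open>y\<close> as the compression of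
    \<open>A i\<close> acts on \<open>w\<close>.\<close>
  define w where "w = (\<Sum>j\<in>UNIV. y $ j *\<^sub>R e j)"
  have ww: "w \<bullet> w = y \<bullet> y"
  proof -
    have "w \<bullet> w = (\<Sum>j\<in>UNIV. \<Sum>k\<in>UNIV. if j = k then y $ j * y $ k else 0)"
      unfolding w_def inner_sum_left inner_sum_right by (intro sum.cong refl) (simp add: ee)
    then show ?thesis by (simp add: inner_vec_def)
  qed
  have Dy: "(block_D e (A i) *v y) $ j = e j \<bullet> (A i *v w)" for i j
    by (simp add: w_def block_D_def matrix_vector_mult_def[of "\<chi> j k. e j \<bullet> (A i *v e k)"] linear_sum[OF matrix_vector_mul_linear]
        matrix_vector_mult_scaleR inner_sum_right mult.commute)
  have "(\<Sum>i\<in>UNIV. (block_D e (A i) *v y) \<bullet> (block_D e (A i) *v y)) \<le> (\<Sum>i\<in>UNIV. (A i *v w) \<bullet> (A i *v w))"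
  proof (intro sum_mono)
    fix i
    have "(block_D e (A i) *v y) \<bullet> (block_D e (A i) *v y) = (\<Sum>j\<in>UNIV. (e j \<bullet> (A i *v w))\<^sup>2)"
      by (simp add: inner_vec_def Dy power2_eq_square)
    also have "\<dots> \<le> (v \<bullet> (A i *v w))\<^sup>2 + (\<Sum>j\<in>UNIV. (e j \<bullet> (A i *v w))\<^sup>2)" by simp
    also have "\<dots> \<le> (A i *v w) \<bullet> (A i *v w)" by (rule bessel)
    finally show "(block_D e (A i) *v y) \<bullet> (block_D e (A i) *v y) \<le> (A i *v w) \<bullet> (A i *v w)" .
  qed
  then show "(\<Sum>i\<in>UNIV. (block_D e (A i) *v y) \<bullet> (block_D e (A i) *v y)) \<le> y \<bullet> y"
    using A2[of w] ww by linarith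
  show "transpose (block_D e (A i)) = block_D e (A i)"
    by (simp add: transpose_def block_D_def vec_eq_iff inner_matrix_sym[OF sym])
qed

section \<open>The expectation under \<open>mu0\<close>\<close>

theorem theorem2p4:
  fixes A :: "'n::finite \<Rightarrow> real^'d^'d"
    and v :: "real^'d"
    and e :: "'m::finite \<Rightarrow> real^'d"
    and a :: "'n \<Rightarrow> real"
    and u :: "'n \<Rightarrow> real^'m"
    and D :: "'n \<Rightarrow> real^'m^'m"
  assumes "CARD('d) \<ge> 2"
    and "\<And>i. transpose (A i) = A i"
    and "(\<Sum>i\<in>UNIV. A i ** A i) \<preceq>\<^sub>L mat 1"
    and "norm v = 1"
    and "onb_of_complement v e"
    and "\<And>i. a i = block_a v (A i)"
    and "\<And>i. u i = block_u v e (A i)"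
    and "\<And>i. D i = block_D e (A i)"
  shows "(\<integral>g. (max (1 - xi_plus a u D g) 0)^4 * (max (1 - xi_minus a u D g) 0)^4 \<partial>(mu0 a D))
           \<ge> c_Schur"
proof -
  note bb = block_bounds[OF assms(2-5)]
  define C where "C = lin_C D"
  define al where "al = lin_a a"
  define b where "b = lin_b u"
  \<comment> \<open>As a 1 by 1 matrix the scalar has operator norm \<bar>al g\<bar>, and its two
    determinants multiply to 1 - al^2, so the pair weight reproduces \<open>w0\<close>.\<close>
  define C2 where "C2 g = al g *\<^sub>R (mat 1 :: real^1^1)" for g
  have lin: "linear C" "linear al" "linear b" by (simp_all add: C_def al_def b_def linear_lin)
  have symC: "transpose (C z) = C z" for z
  proof -
    have "transpose (\<Sum>i\<in>UNIV. z $ i *\<^sub>R D i) = (\<Sum>i\<in>UNIV. transpose (z $ i *\<^sub>R D i))"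
      by (rule linear_sum[OF bounded_linear.linear[OF bounded_linear_transpose]])
    then show ?thesis by (simp add: C_def lin_C_def transpose_scalar assms(8) bb(3))
  qed
  interpret S: sym_pair C C2
  proof (rule sym_pair.intro)
    show "linear C2" unfolding C2_def
      by (intro linearI) (simp_all add: linear_add[OF lin(2)] linear_scale[OF lin(2)] scaleR_add_left)
  qed (use lin symC in \<open>auto simp: C2_def transpose_scalar\<close>)
  interpret S2: sym_pair C2 C
    by (rule sym_pair.intro) (fact S.linC S.linC2 S.symC S.symC2)+
  have smallC: "(\<Sum>d\<in>Basis. (C d *v y) \<bullet> (C d *v y)) \<le> (1/16) * (y \<bullet> y)" for y
  proof -
    have "(\<Sum>d\<in>Basis. (C d *v y) \<bullet> (C d *v y)) = (1/16) * (\<Sum>i\<in>UNIV. (D i *v y) \<bullet> (D i *v y))"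
      by (simp add: sum_Basis_axis C_def lin_axis scaleR_matrix_vector_assoc[symmetric] sum_distrib_left)
    also have "\<dots> \<le> (1/16) * (y \<bullet> y)"
      using bb(2)[of y] by (simp add: assms(8))
    finally show ?thesis .
  qed
  have sums: "(\<Sum>i\<in>UNIV. (a i)\<^sup>2) + (\<Sum>i\<in>UNIV. u i \<bullet> u i) \<le> 1"
    using bb(1) by (simp add: assms(6,7) sum.distrib)
  have a2: "(\<Sum>i\<in>UNIV. (a i)\<^sup>2) \<le> 1" using sums sum_nonneg[of UNIV "\<lambda>i. u i \<bullet> u i"] by simp
  have u2: "(\<Sum>i\<in>UNIV. u i \<bullet> u i) \<le> 1" using sums sum_nonneg[of UNIV "\<lambda>i. (a i)\<^sup>2"] by simp
  have smallC2: "(\<Sum>d\<in>Basis. (C2 d *v y) \<bullet> (C2 d *v y)) \<le> (1/16) * (y \<bullet> y)" for y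
  proof -
    have "(\<Sum>d\<in>Basis. (C2 d *v y) \<bullet> (C2 d *v y)) = (1/16) * (y \<bullet> y) * (\<Sum>i\<in>UNIV. (a i)\<^sup>2)"
      by (simp add: sum_Basis_axis C2_def al_def lin_axis scaleR_matrix_vector_assoc[symmetric] sum_distrib_left
          power2_eq_square mult_ac)
    also have "\<dots> \<le> (1/16) * (y \<bullet> y) * 1" by (intro mult_left_mono a2) auto
    finally show ?thesis by simp
  qed
  have smallb: "(\<Sum>d\<in>Basis. b d \<bullet> b d) \<le> 1/16"
    using u2 by (simp add: sum_Basis_axis b_def lin_axis sum_distrib_left[symmetric] flip: sum_divide_distrib)
  have b_repr: "(\<Sum>d\<in>Basis. (z \<bullet> d) *\<^sub>R b d) = b z" for z
  proof -
    have "b z = b (\<Sum>d\<in>Basis. (z \<bullet> d) *\<^sub>R d)" by (simp add: euclidean_representation)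
    then show ?thesis by (simp add: linear_sum[OF lin(3)] linear_scale[OF lin(3)])
  qed
  note bG = S.variance_bound[OF smallC smallb, unfolded b_repr]
  have ibG: "integrable lborel (\<lambda>z. b z \<bullet> (S.G z *v b z))"
    using S.Brascamp_Lieb(2)[of b] unfolding b_repr .
  have cb: "continuous_on UNIV b" using lin(3) by (intro linear_continuous_on linear_conv_bounded_linear[THEN iffD1])
  have cal: "continuous_on UNIV al" using lin(2) by (intro linear_continuous_on linear_conv_bounded_linear[THEN iffD1])
  \<comment> \<open>The quadratic form of \<open>S2.G\<close> at this unit vector is the weight
    divided by \<open>1 + al\<close>.\<close>
  define e1 where "e1 = (axis 1 1 :: real^1)"
  define f1 where "f1 z = b z \<bullet> (S.G z *v b z)" for z
  define f2 where "f2 z = e1 \<bullet> (S2.G z *v e1)" for z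
  have if1: "integrable lborel f1" "integrable lborel f2"
    unfolding f1_def f2_def by (rule ibG, rule S2.integrable_quad)
  have reflect: "integrable lborel (\<lambda>z. f (- z)) \<and> (\<integral>z. f (- z) \<partial>lborel) = (\<integral>z. f z \<partial>lborel)"
    if "integrable lborel f" for f :: "real^'n \<Rightarrow> real"
  proof
    have m: "f \<in> borel_measurable borel" using that by auto
    have "integrable (distr lborel borel uminus) f" using that by (simp add: lborel_uminus)
    then show "integrable lborel (\<lambda>z. f (- z))" using m by (simp add: integrable_distr_eq)
    show "(\<integral>z. f (- z) \<partial>lborel) = (\<integral>z. f z \<partial>lborel)" by (rule integral_uminus[OF m])
  qed
  have wt2: "S2.wt z = S.wt z" for z
    by (simp add: S.wt_def S2.wt_def trunc_w_def wdet_def mult_ac conj_commute)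
  have Z2: "S2.Z = S.Z" by (simp add: S2.Z_def S.Z_def wt2)
  have I1: "(\<integral>z. f1 z \<partial>lborel) \<le> (121/1600) * S.Z" using bG by (simp add: f1_def)
  have I2: "(\<integral>z. f2 z \<partial>lborel) \<le> (11/10) * S.Z"
  proof -
    have "(\<integral>z. f2 z \<partial>lborel) \<le> op_norm S2.M * (e1 \<bullet> e1)"
      using S2.M_le[of e1] by (simp add: f2_def S2.M_quad)
    also have "e1 \<bullet> e1 = 1" by (simp add: e1_def dot_square_norm)
    finally show ?thesis using S2.op_norm_M_le[OF smallC2] by (simp add: Z2)
  qed
  \<comment> \<open>\<open>T\<close> is the weight times the loss in
    \<open>product_lower_bound\<close>. Since \<open>C\<close>, \<open>b\<close> and
    \<open>al\<close> are odd and the weight is even, \<open>f1 (- z)\<close> carries the resolvent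
    of \<open>- C\<close>, and the average of \<open>f2 z\<close> and \<open>f2 (- z)\<close> is the
    weight divided by 1 - al^2.\<close>
  define T where "T z = 2 * (f1 z + f1 (- z)) + (1/2) * ((1/2) * (f2 z + f2 (- z)) - S.wt z)" for z
  have iT: "integrable lborel T"
    unfolding T_def using if1 reflect[OF if1(1)] reflect[OF if1(2)] S.integrable_wt by simp
  \<comment> \<open>The four means of \<open>x\<close> type contribute 4 * 121/1600 and the
    resolvent of the scalar (11/10 - 1) / 2; together 0.3525, below 2/5.\<close>
  have IT: "(\<integral>z. T z \<partial>lborel) \<le> (2/5) * S.Z"
  proof -
    have "(\<integral>z. T z \<partial>lborel) = 2 * ((\<integral>z. f1 z \<partial>lborel) + (\<integral>z. f1 z \<partial>lborel))
       + (1/2) * ((1/2) * ((\<integral>z. f2 z \<partial>lborel) + (\<integral>z. f2 z \<partial>lborel)) - S.Z)"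
      unfolding T_def using if1 reflect[OF if1(1)] reflect[OF if1(2)] S.integrable_wt by (simp add: S.Z_def)
    then show ?thesis using I1 I2 S.Z_pos by argo
  qed
  define F where "F g = (max (1 - xi_plus a u D g) 0)^4 * (max (1 - xi_minus a u D g) 0)^4" for g
  have \<Omega>: "S.\<Omega> = Omega0 a D"
    by (auto simp: S.\<Omega>_def Omega0_def C2_def op_norm_scaled_one simp flip: C_def al_def)
  have wt: "S.wt g = exp (- (g \<bullet> g) / 2) * w0 a D g" for g
  proof (cases "g \<in> S.\<Omega>")
    case True
    have d1: "det (mat 1 + C2 g) = 1 + al g" "det (mat 1 - C2 g) = 1 - al g"
      by (simp_all add: C2_def det_1 mat_def)
    have "(mat 1 + C g) ** (mat 1 - C g) = mat 1 - C g ** C g"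
      by (simp add: matrix_eq matrix_vector_mul_assoc[symmetric] algebra_simps)
    then have d2: "det (mat 1 + C g) * det (mat 1 - C g) = det (mat 1 - C g ** C g)" by (metis det_mul)
    have "wdet (C g) (C2 g) = (det (mat 1 - C g ** C g) * ((1 + al g) * (1 - al g))) ^ 4"
      unfolding wdet_def d1 d2[symmetric] by (simp add: mult_ac)
    also have "(1 + al g) * (1 - al g) = 1 - (al g)\<^sup>2" by (simp add: power2_eq_square algebra_simps)
    finally show ?thesis using True \<Omega>
      by (simp add: S.wt_eq w0_def power_mult_distrib mult_ac flip: C_def al_def)
  next
    case False
    then show ?thesis using \<Omega> by (simp add: S.wt_eq w0_def)
  qed
  have xi: "xi_plus a u D g = (b g \<bullet> (matrix_inv (mat 1 + C g) *v b g)) / (1 + al g)"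
    "xi_minus a u D g = (b g \<bullet> (matrix_inv (mat 1 - C g) *v b g)) / (1 - al g)" for g
    by (simp_all add: xi_plus_def xi_minus_def flip: b_def C_def al_def)
  have pdm: "posdef (mat 1 - C z)" if "z \<in> S.\<Omega>" for z
    by (rule posdef_one_minus[OF symC]) (use that in \<open>simp add: S.\<Omega>_def\<close>)
  have alt: "\<bar>al z\<bar> < 1" if "z \<in> S.\<Omega>" for z using that by (simp add: S.\<Omega>_def C2_def op_norm_scaled_one)
  have xnn: "0 \<le> b z \<bullet> (matrix_inv (mat 1 + C z) *v b z)" "0 \<le> b z \<bullet> (matrix_inv (mat 1 - C z) *v b z)"
    if "z \<in> S.\<Omega>" for z
    using posdef_nonneg posdef_inv S.pdP[OF that] pdm[OF that] by blast+
  \<comment> \<open>The tangent of the fourth power at 3/5, with \<open>1 - s\<close> expressed by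
    \<open>T\<close>; both sides vanish off \<Omega>, which is symmetric under reflection.\<close>
  have lower: "(3/5) ^ 4 * S.wt z + 4 * (3/5) ^ 3 * ((2/5) * S.wt z - T z) \<le> S.wt z * F z" for z
  proof (cases "z \<in> S.\<Omega>")
    case False
    have "- z \<notin> S.\<Omega>" using False
      by (simp add: S.\<Omega>_def linear_neg[OF S.linC] linear_neg[OF S.linC2] op_norm_uminus)
    then have "S.wt z = 0" "T z = 0"
      using False wt2 by (simp_all add: T_def f1_def f2_def S.G_eq S2.G_eq S.wt_eq)
    then show ?thesis by simp
  next
    case True
    define x where "x = b z \<bullet> (matrix_inv (mat 1 + C z) *v b z)"
    define y where "y = b z \<bullet> (matrix_inv (mat 1 - C z) *v b z)"
    define s where "s = 1 - (2 * (x + y) + (1 / (1 - (al z)\<^sup>2) - 1) / 2)"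
    have a1: "0 < 1 + al z" "0 < 1 - al z" using alt[OF True] by (auto simp: abs_less_iff)
    have inv1: "matrix_inv (t *\<^sub>R (mat 1 :: real^1^1)) = (1 / t) *\<^sub>R mat 1" if "t \<noteq> 0" for t
      by (rule matrix_inv_unique) (use that in \<open>simp add: matrix_eq matrix_vector_mul_assoc[symmetric] scaleR_matrix_vector_assoc[symmetric]\<close>)
    have f1z: "f1 z = S.wt z * x" by (simp add: f1_def S.G_eq x_def scaleR_matrix_vector_assoc[symmetric])
    have f1m: "f1 (- z) = S.wt z * y"
      by (simp add: f1_def S.G_eq y_def scaleR_matrix_vector_assoc[symmetric] S.wt_uminus
          linear_neg[OF lin(3)] linear_neg[OF lin(1)] linear_neg[OF matrix_vector_mul_linear])
    have c2: "mat 1 + C2 z = (1 + al z) *\<^sub>R mat 1" "mat 1 + C2 (- z) = (1 - al z) *\<^sub>R mat 1"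
      by (simp_all add: C2_def linear_neg[OF lin(2)] algebra_simps)
    have f2z: "f2 z = S.wt z * (1 / (1 + al z))" "f2 (- z) = S.wt z * (1 / (1 - al z))"
      using a1 unfolding f2_def S2.G_eq wt2 c2
      by (simp_all add: inv1 scaleR_matrix_vector_assoc[symmetric] S.wt_uminus e1_def dot_square_norm)
    have half: "1 / (1 - (al z)\<^sup>2) = (1/2) * (1 / (1 + al z) + 1 / (1 - al z))"
    proof -
      have "(1 + al z) * (1 - al z) = 1 - (al z)\<^sup>2" by (simp add: power2_eq_square algebra_simps)
      then show ?thesis using a1 by (simp add: field_simps)
    qed
    have "2 * (w * x + w * y) + (1/2) * ((1/2) * (w * p + w * q) - w)
        = w * (1 - (1 - (2 * (x + y) + ((1/2) * (p + q) - 1) / 2)))" for w p q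
      by (simp add: field_simps)
    then have Tz: "T z = S.wt z * (1 - s)" unfolding T_def f1z f1m f2z s_def half .
    have L: "(3/5) ^ 4 * S.wt z + 4 * (3/5) ^ 3 * ((2/5) * S.wt z - T z) = S.wt z * ((3/5) ^ 4 + 4 * (3/5) ^ 3 * (s - 3/5))"
      unfolding Tz by (simp add: algebra_simps)
    define P where "P = max (1 - x / (1 + al z)) 0 * max (1 - y / (1 - al z)) 0"
    have sP: "s \<le> P" unfolding s_def P_def
      by (rule product_lower_bound) (use alt[OF True] xnn[OF True] in \<open>auto simp: x_def y_def\<close>)
    have "(3/5) ^ 4 + 4 * (3/5) ^ 3 * (s - 3/5) \<le> (3/5) ^ 4 + 4 * (3/5) ^ 3 * (P - 3/5)" using sP by simp
    also have "\<dots> \<le> P ^ 4" by (rule pow4_tangent) simp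
    also have "P ^ 4 = F z" by (simp add: F_def P_def xi x_def y_def power_mult_distrib)
    finally show ?thesis unfolding L using S.wt_nonneg[of z] by (intro mult_left_mono)
  qed
  have mC: "(\<lambda>g. matrix_inv (mat 1 + C g)) \<in> borel_measurable borel" "(\<lambda>g. matrix_inv (mat 1 - C g)) \<in> borel_measurable borel"
    by (rule measurable_compose[OF _ measurable_matrix_inv], rule borel_measurable_continuous_onI,
        intro continuous_intros S.contC)+
  have mb: "b \<in> borel_measurable borel" "al \<in> borel_measurable borel"
    using cb cal by (auto intro: borel_measurable_continuous_onI)
  have mq: "(\<lambda>g. b g \<bullet> (N g *v b g)) \<in> borel_measurable borel" if N: "N \<in> borel_measurable borel" for N :: "real^'n \<Rightarrow> real^'m^'m"
  proof -
    have "(\<lambda>g. (N g, b g)) \<in> borel_measurable borel" using N mb by (simp add: borel_measurable_Pair)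
    moreover have "(\<lambda>p::(real^'m^'m) \<times> (real^'m). snd p \<bullet> (fst p *v snd p)) \<in> borel_measurable borel"
      by (intro borel_measurable_continuous_onI continuous_intros)
    ultimately show ?thesis by (auto dest: measurable_compose)
  qed
  \<comment> \<open>\<open>F\<close> has to be measurable on the whole space, hence also where
    \<open>mat 1 + C g\<close> or \<open>mat 1 - C g\<close> is singular.\<close>
  have mF: "F \<in> borel_measurable borel"
    unfolding F_def xi using mq[OF mC(1)] mq[OF mC(2)] mb by measurable
  \<comment> \<open>On \<Omega> both \<xi> values are nonnegative, so \<open>F\<close> lies between
    0 and 1 there; elsewhere the weight is 0.\<close>
  have iF: "integrable lborel (\<lambda>z. S.wt z * F z)"
  proof (rule Bochner_Integration.integrable_bound[OF S.integrable_wt])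
    show "AE z in lborel. norm (S.wt z * F z) \<le> norm (S.wt z)"
    proof (intro AE_I2)
      fix z
      show "norm (S.wt z * F z) \<le> norm (S.wt z)"
      proof (cases "z \<in> S.\<Omega>")
        case True
        have "0 \<le> xi_plus a u D z" "0 \<le> xi_minus a u D z"
          unfolding xi using xnn[OF True] alt[OF True] by (auto simp: abs_less_iff)
        then have "0 \<le> F z" "F z \<le> 1"
          unfolding F_def by (auto intro!: mult_le_one power_le_one)
        then show ?thesis using S.wt_nonneg[of z] by (simp add: mult_left_le)
      qed (simp add: S.wt_eq)
    qed
  qed (use mF S.measurable_wt in simp)
  have "(3/5) ^ 4 * S.Z \<le> (3/5) ^ 4 * S.Z + 4 * (3/5) ^ 3 * ((2/5) * S.Z - (\<integral>z. T z \<partial>lborel))"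
    using IT by simp
  also have "\<dots> = (\<integral>z. (3/5) ^ 4 * S.wt z + 4 * (3/5) ^ 3 * ((2/5) * S.wt z - T z) \<partial>lborel)"
    using S.integrable_wt iT by (simp add: S.Z_def)
  also have "\<dots> \<le> (\<integral>z. S.wt z * F z \<partial>lborel)"
    using S.integrable_wt iT iF lower by (intro integral_mono) auto
  finally have main: "(3/5) ^ 4 * S.Z \<le> (\<integral>z. S.wt z * F z \<partial>lborel)" .
  \<comment> \<open>The normalising constant of the Gaussian density; it cancels between the
    numerator and the mean of \<open>w0\<close>.\<close>
  define \<kappa> where "\<kappa> = (1 / sqrt (2 * pi)) ^ CARD('n)"
  have \<kappa>: "0 < \<kappa>" by (simp add: \<kappa>_def)
  have w0: "w0 a D = (\<lambda>g. exp ((g \<bullet> g) / 2) * S.wt g)" by (rule ext) (simp add: wt exp_minus)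
  have mw0 [measurable]: "w0 a D \<in> borel_measurable borel"
    unfolding w0 using S.measurable_wt by measurable
  have w0nn: "0 \<le> w0 a D g" for g unfolding w0 using S.wt_nonneg[of g] by simp
  have gauss: "(\<integral>g. h g \<partial>std_gaussian) = (\<integral>g. (\<kappa> * exp (- (g \<bullet> g) / 2)) * h g \<partial>lborel)"
    if "h \<in> borel_measurable borel" for h :: "real^'n \<Rightarrow> real"
    unfolding std_gaussian_eq \<kappa>_def[symmetric]
    by (subst integral_density) (use that \<kappa> in auto)
  have E: "(\<integral>h. w0 a D h \<partial>std_gaussian) = \<kappa> * S.Z"
    by (subst gauss[OF mw0]) (simp add: S.Z_def wt mult.assoc)
  have "(\<integral>g. F g \<partial>mu0 a D) = (\<integral>g. (w0 a D g / (\<kappa> * S.Z)) * F g \<partial>std_gaussian)"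
    unfolding mu0_def E
    by (subst integral_density) (use mF w0nn \<kappa> S.Z_pos in \<open>auto simp: std_gaussian_eq\<close>)
  also have "\<dots> = (\<integral>g. (\<kappa> * exp (- (g \<bullet> g) / 2)) * ((w0 a D g / (\<kappa> * S.Z)) * F g) \<partial>lborel)"
    by (rule gauss) (use mF in measurable)
  also have "\<dots> = (\<integral>g. (S.wt g * F g) / S.Z \<partial>lborel)"
    unfolding wt using \<kappa> by (intro Bochner_Integration.integral_cong refl) simp
  also have "\<dots> = (\<integral>g. S.wt g * F g \<partial>lborel) / S.Z" by simp
  also have "\<dots> \<ge> (3/5) ^ 4" using main S.Z_pos by (simp add: pos_le_divide_eq)
  finally show ?thesis using c_Schur_le unfolding F_def by linarith
qed

end
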